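(* Let $k,h,s$ be integers and set $t=k-h+1$. Suppose $k\ge 60$, $0.9k\le h\le k-2$, $2t\le s\le \lfloor h/2\rfloor t$, and $P\ge e^{Dk^2}$ where $D\ge 10$. Assume further that $\eta$ satisfies $$\frac{2}{k^3}<\eta\le\frac{1}{2k},\qquad \frac{18}{k}\le\frac{4\log k}{Dk^2\eta}\le 0.4.$$ Then $$J_{s,k,h}(\mathcal C(P,P^\eta))\le e^{C}\,P^{\,2s-\frac t2(h+k)+\frac{t(t-1)}{2}+\eta s^2/(2t)+ht\exp\{-s/(ht)\}},$$ where $$C=\frac{s^2}{t}+\frac{10.5\,t\log^2k}{Dk\eta^2}-s\Bigl(\Bigl(\frac1\eta+h\Bigr)\Bigl(1-\frac1h\Bigr)^{s/t}-h\Bigr)\log\Bigl(\frac{1}{10\eta}\Bigr).$$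
   Context: For real $P\ge1$ and $R>1$, $\mathcal C(P,R)$ is the set of positive integers $n\le P$ all of whose prime factors lie in the interval $(\sqrt R,R]$. For a finite set $\mathcal B$ of positive integers and integers $1\le h\le k$, $s\ge1$, $J_{s,k,h}(\mathcal B)$ is the number of solutions of $\sum_{i=1}^s(x_i^j-y_i^j)=0$ for all $h\le j\le k$ with all $x_i,y_i\in\mathcal B$. *)

theory Defs
  imports "HOL-Analysis.Analysis" "HOL-Computational_Algebra.Primes"
begin

definition smooth_set :: "real \<Rightarrow> real \<Rightarrow> nat set" ("\<C>") where
  "\<C> P R = {n. 0 < n \<and> real n \<le> P \<and>
      (\<forall>p. prime p \<longrightarrow> p dvd n \<longrightarrow> real p \<in> {sqrt R<..R})}"

lemma finite_smooth_set: "finite (\<C> P R)"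
proof (rule finite_subset)
  show "\<C> P R \<subseteq> {..nat \<lfloor>P\<rfloor>}"
    by (auto simp: smooth_set_def le_nat_floor)
qed simp

text \<open>
  The \<open>s\<close>-tuples are the extensional functions on \<open>{1..s}\<close>, so that \<^const>\<open>card\<close> counts each
  tuple once. The differences are formed in \<^typ>\<open>int\<close>, where subtraction does not truncate.
\<close>

definition J :: "nat \<Rightarrow> nat \<Rightarrow> nat \<Rightarrow> nat set \<Rightarrow> nat" where
  "J s k h B = card {(x, y).
      x \<in> {1..s} \<rightarrow>\<^sub>E B \<and> y \<in> {1..s} \<rightarrow>\<^sub>E B \<and>
      (\<forall>j\<in>{h..k}. (\<Sum>i=1..s. int (x i) ^ j - int (y i) ^ j) = 0)}"

end

theory Submission
  imports Defs "HOL-Number_Theory.Cong"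
begin

text \<open>
  The argument is efficient differencing on smooth numbers. Let \<open>Q = R\<^sup>y\<close> and \<open>C = \<C> Q R\<close>. In a solution counted
  by \<open>J\<close>, split off \<open>t\<close> of the variables on each side. If every other variable has a divisor
  \<open>m \<in> (Q powr (1/h), Q powr (1/h) * R]\<close> coprime to the \<open>t\<close> split variables and to their differences, then
  Cauchy's inequality makes \<open>m\<close> common to all of them, and the split variables satisfy \<open>t\<close> power sum
  congruences modulo \<open>m\<^sup>h > Q\<close>. By Hensel lifting and a Bezout-type bound these have few nonsingular
  solutions, so \<open>t + s\<close> variables at height \<open>Q\<close> are reduced to \<open>s\<close> variables at height \<open>Q / m\<close>.
  Otherwise some variable is, up to a factor at most \<open>Q powr (1/h)\<close>, composed of the few primes dividing the
  split variables and their differences; there are few such values, and log-convexity of the moments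
  then bounds \<open>J\<close> directly. Iterating \<open>s / t\<close> times, with the density of smooth numbers estimated by Rankin's
  trick from Chebyshev's bound, gives the theorem.
\<close>

section \<open>Power sum congruences\<close>

text \<open>Primes above sqrt R keep arithmetic costs low: a modulus m up to R powr (y/h + 1) has at
  most 2 (y/h + 1) of them, so the Bezout factor, at most k^(2t) for each, stays affordable. Primes
  at most R guarantee divisors in every interval of ratio R, at the price of a factor up to R in m;
  summed over all steps, this price is the term \<eta> s^2/(2t) of the exponent. With m about Q powr
  (1/h), a step turns a saving G in the exponent into t + (1 - 1/h) G, whose fixed point is ht; ht
  (1 - exp (-s/(ht))) obeys this recursion with a little to spare. The last term of C is a density
  gain: each variable ranges over a set of density about (2.86/y)^y, and y stays above the value
  that the recursion y' = (1 - 1/h) y - 1 reaches from 1/\<eta> after s/t steps. If exceptional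
  tuples dominate, no height is reduced. Instead J for n variables is at most L times J for n - 1,
  log-convexity extends this to all smaller n, and a product of ratios down to t variables remains,
  where solutions are nearly diagonal. This alternative consumes the log^2 k term of C and the lower
  bound 18/k.\<close>

lemma linear_dependency_int:
  fixes v :: "'i \<Rightarrow> 'g \<Rightarrow> int"
  assumes "finite G" "finite I" "card G < card I"
  shows "\<exists>l. (\<exists>i\<in>I. l i \<noteq> 0) \<and> (\<forall>g\<in>G. (\<Sum>i\<in>I. l i * v i g) = 0)"
  using assms
proof (induction G arbitrary: I v rule: finite_induct)
  case empty
  then have "I \<noteq> {}" by auto
  then show ?case by (intro exI[of _ "\<lambda>_. 1"]) auto
next
  case (insert g G)
  show ?case
  proof (cases "\<forall>i\<in>I. v i g = 0")
    case True
    obtain l where "\<exists>i\<in>I. l i \<noteq> 0" "\<forall>g\<in>G. (\<Sum>i\<in>I. l i * v i g) = 0"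
      using insert.IH[of I v] insert.prems insert.hyps by auto
    then show ?thesis using True by (intro exI[of _ l]) auto
  next
    case False
    then obtain i0 where i0: "i0 \<in> I" "v i0 g \<noteq> 0" by auto
    define I' where "I' = I - {i0}"
    \<comment> \<open>Elimination without division: cross-multiplying with the pivot row
      \<open>i0\<close> clears the coordinate \<open>g\<close> and keeps everything
      integral.\<close>
    define v' where "v' i g' = v i0 g * v i g' - v i g * v i0 g'" for i g'
    have I: "I = insert i0 I'" "i0 \<notin> I'" "finite I'"
      using i0 insert.prems by (auto simp: I'_def)
    have "card G < card I'" using insert.prems insert.hyps I by auto
    then obtain l where l: "\<exists>i\<in>I'. l i \<noteq> 0" "\<forall>g\<in>G. (\<Sum>i\<in>I'. l i * v' i g) = 0"
      using insert.IH[of I' v'] I by blast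
    define m where "m i = (if i = i0 then - (\<Sum>i\<in>I'. l i * v i g) else l i * v i0 g)" for i
    have m: "(\<Sum>i\<in>I. m i * v i x) = (\<Sum>i\<in>I'. l i * v i0 g * v i x) - (\<Sum>i\<in>I'. l i * v i g) * v i0 x" for x
    proof -
      have "(\<Sum>i\<in>I'. m i * v i x) = (\<Sum>i\<in>I'. l i * v i0 g * v i x)"
        using I by (intro sum.cong) (auto simp: m_def)
      then show ?thesis using I by (simp add: m_def)
    qed
    have "(\<Sum>i\<in>I. m i * v i x) = 0" if "x \<in> insert g G" for x
    proof (cases "x = g")
      case True
      then show ?thesis by (simp add: m sum_distrib_left sum_distrib_right mult_ac)
    next
      case False
      then have "(\<Sum>i\<in>I'. l i * v' i x) = 0" using l that by auto
      then show ?thesis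
        by (simp add: m v'_def algebra_simps sum_subtractf sum_distrib_left sum_distrib_right)
    qed
    moreover have "\<exists>i\<in>I. m i \<noteq> 0"
      using l(1) i0 I by (auto simp: m_def)
    ultimately show ?thesis by blast
  qed
qed

text \<open>Degree in each variable separately, expressed for functions, so that only univariate
  polynomials occur.\<close>

definition degree_in_le :: "nat \<Rightarrow> ((nat \<Rightarrow> int) \<Rightarrow> int) \<Rightarrow> bool" where
  "degree_in_le D g \<longleftrightarrow> (\<forall>i x. \<exists>q::int poly. degree q \<le> D \<and> (\<forall>u. g (x(i := u)) = poly q u))"

lemma degree_in_le_mono: "degree_in_le D g \<Longrightarrow> D \<le> E \<Longrightarrow> degree_in_le E g"
  unfolding degree_in_le_def by (blast intro: order_trans)

lemma degree_in_le_const: "degree_in_le D (\<lambda>_. c)"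
  unfolding degree_in_le_def by (auto intro!: exI[of _ "[:c:]"])

lemma degree_in_le_coord: "degree_in_le 1 (\<lambda>x. x l)"
  unfolding degree_in_le_def
proof (intro allI)
  fix i and x :: "nat \<Rightarrow> int"
  show "\<exists>q. degree q \<le> 1 \<and> (\<forall>u. (x(i := u)) l = poly q u)"
  proof (cases "i = l")
    case True
    then show ?thesis by (intro exI[of _ "[:0, 1:]"]) auto
  next
    case False
    then show ?thesis by (intro exI[of _ "[:x l:]"]) auto
  qed
qed

lemma degree_in_le_add:
  assumes "degree_in_le D f" "degree_in_le D g"
  shows "degree_in_le D (\<lambda>x. f x + g x)"
  unfolding degree_in_le_def
proof (intro allI)
  fix i x
  obtain q r where "degree q \<le> D" "\<forall>u. f (x(i := u)) = poly q u"
    "degree r \<le> D" "\<forall>u. g (x(i := u)) = poly r u"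
    using assms unfolding degree_in_le_def by meson
  then show "\<exists>q. degree q \<le> D \<and> (\<forall>u. f (x(i := u)) + g (x(i := u)) = poly q u)"
    by (intro exI[of _ "q + r"]) (auto intro: degree_add_le)
qed

lemma degree_in_le_mult:
  assumes "degree_in_le D f" "degree_in_le E g"
  shows "degree_in_le (D + E) (\<lambda>x. f x * g x)"
  unfolding degree_in_le_def
proof (intro allI)
  fix i x
  obtain q r where "degree q \<le> D" "\<forall>u. f (x(i := u)) = poly q u"
    "degree r \<le> E" "\<forall>u. g (x(i := u)) = poly r u"
    using assms unfolding degree_in_le_def by meson
  then show "\<exists>q. degree q \<le> D + E \<and> (\<forall>u. f (x(i := u)) * g (x(i := u)) = poly q u)"
    by (intro exI[of _ "q * r"]) (auto intro: order_trans[OF degree_mult_le])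
qed

lemma degree_in_le_sum:
  assumes "\<And>i. i \<in> I \<Longrightarrow> degree_in_le D (f i)"
  shows "degree_in_le D (\<lambda>x. \<Sum>i\<in>I. f i x)"
  using assms
  by (induction I rule: infinite_finite_induct) (auto intro: degree_in_le_const degree_in_le_add)

lemma degree_in_le_prod:
  assumes "\<And>i. i \<in> I \<Longrightarrow> degree_in_le (D i) (f i)"
  shows "degree_in_le (\<Sum>i\<in>I. D i) (\<lambda>x. \<Prod>i\<in>I. f i x)"
  using assms
  by (induction I rule: infinite_finite_induct) (auto intro: degree_in_le_const degree_in_le_mult)

lemma degree_in_le_power:
  assumes "degree_in_le D f"
  shows "degree_in_le (n * D) (\<lambda>x. f x ^ n)"
  using assms by (induction n) (auto intro: degree_in_le_const degree_in_le_mult)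

lemma degree_in_le_shift_power: "degree_in_le n (\<lambda>x. (x l - c) ^ n)"
proof -
  have "degree_in_le 1 (\<lambda>x. x l + (- c))"
    by (intro degree_in_le_add degree_in_le_coord degree_in_le_const)
  from degree_in_le_power[OF this, of n] show ?thesis by simp
qed

text \<open>The \<open>D + 1\<close> grid values are too many roots for a nonzero polynomial of
  degree at most \<open>D\<close>, so the coordinates can be freed from the grid one after
  another.\<close>

lemma vanish_on_grid:
  assumes g: "degree_in_le D g"
    and grid: "\<And>x. x \<in> {..<r} \<rightarrow>\<^sub>E {0..int D} \<Longrightarrow> g x = 0"
    and x: "x \<in> extensional {..<r}"
  shows "g x = 0"
proof -
  \<comment> \<open>Here \<open>m\<close> counts the coordinates that are already arbitrary; the
    others still lie on the grid.\<close>
  have "g x = 0" if "x \<in> extensional {..<r}" "\<And>i. m \<le> i \<Longrightarrow> i < r \<Longrightarrow> x i \<in> {0..int D}" "m \<le> r" for m x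
    using that
  proof (induction m arbitrary: x)
    case 0
    then show ?case by (intro grid) (auto simp: PiE_def)
  next
    case (Suc m)
    obtain q where q: "degree q \<le> D" "\<And>u. g (x(m := u)) = poly q u"
      using g unfolding degree_in_le_def by meson
    have z: "poly q u = 0" if "u \<in> {0..int D}" for u
    proof -
      have "g (x(m := u)) = 0"
      proof (rule Suc.IH)
        show "x(m := u) \<in> extensional {..<r}" using Suc.prems by (auto simp: extensional_def)
        show "(x(m := u)) i \<in> {0..int D}" if "m \<le> i" "i < r" for i
          using Suc.prems(2)[of i] that \<open>u \<in> _\<close> by auto
      qed (use Suc.prems in auto)
      then show ?thesis by (simp add: q)
    qed
    have "q = 0"
    proof (rule ccontr)
      assume "q \<noteq> 0"
      have "card {0..int D} \<le> card {u. poly q u = 0}"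
        using z \<open>q \<noteq> 0\<close> by (intro card_mono poly_roots_finite) auto
      also have "\<dots> \<le> degree q" using \<open>q \<noteq> 0\<close> by (rule card_poly_roots_bound)
      finally show False using q(1) by simp
    qed
    then have "g (x(m := x m)) = 0" unfolding q by simp
    then show ?case by simp
  qed
  from this[of x r] x show ?thesis by auto
qed

text \<open>The Lagrange polynomial of the node \<open>z l\<close> isolates the coefficient \<open>w l\<close>.\<close>

lemma vandermonde_mod_prime:
  fixes w z :: "nat \<Rightarrow> int" and p :: int
  assumes p: "prime p" and dist: "\<And>i i'. i < r \<Longrightarrow> i' < r \<Longrightarrow> i \<noteq> i' \<Longrightarrow> \<not> p dvd z i - z i'"
    and eq: "\<And>i. i < r \<Longrightarrow> p dvd (\<Sum>l<r. w l * z l ^ i)" and l: "l < r"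
  shows "p dvd w l"
proof -
  define q where "q = (\<Prod>l'\<in>{..<r} - {l}. [:- z l', 1:])"
  have deg: "degree q \<le> r - 1"
  proof -
    have "degree q \<le> (\<Sum>l'\<in>{..<r} - {l}. degree [:- z l', 1:])"
      unfolding q_def using degree_prod_sum_le[of "{..<r} - {l}" "\<lambda>l'. [:- z l', 1:]"] by (simp add: o_def)
    also have "\<dots> = r - 1" using l by simp
    finally show ?thesis .
  qed
  have polyq: "poly q u = (\<Prod>l'\<in>{..<r} - {l}. u - z l')" for u
    unfolding q_def by (simp add: poly_prod)
  have "(\<Sum>l'<r. w l' * poly q (z l')) = (\<Sum>l'<r. \<Sum>i\<le>degree q. coeff q i * (w l' * z l' ^ i))"
    by (simp add: poly_altdef sum_distrib_left mult_ac)
  also have "\<dots> = (\<Sum>i\<le>degree q. coeff q i * (\<Sum>l'<r. w l' * z l' ^ i))"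
    by (subst sum.swap) (simp add: sum_distrib_left)
  also have "p dvd \<dots>"
    using deg l by (intro dvd_sum dvd_mult eq) auto
  finally have "p dvd (\<Sum>l'<r. w l' * poly q (z l'))" .
  also have "(\<Sum>l'<r. w l' * poly q (z l')) = (\<Sum>l'\<in>{l}. w l' * poly q (z l'))"
    using l by (intro sum.mono_neutral_right) (auto simp: polyq)
  finally have "p dvd w l * (\<Prod>l'\<in>{..<r} - {l}. z l - z l')" by (simp add: polyq)
  moreover have "\<not> p dvd (\<Prod>l'\<in>{..<r} - {l}. z l - z l')"
    using p dist l by (subst prime_dvd_prod_iff) auto
  ultimately show ?thesis using p prime_dvd_multD by blast
qed

section \<open>Hensel lifting for power sums\<close>

lemma power_add_pow_cong:
  fixes z d p :: int
  assumes "A \<ge> 1"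
  shows "p ^ Suc A dvd (z + p ^ A * d) ^ n - z ^ n - of_nat n * z ^ (n - 1) * p ^ A * d"
proof (induction n)
  case 0
  then show ?case by simp
next
  case (Suc n)
  then obtain e where "(z + p ^ A * d) ^ n - z ^ n - of_nat n * z ^ (n - 1) * p ^ A * d = p ^ Suc A * e"
    by (elim dvdE)
  then have e: "(z + p ^ A * d) ^ n = z ^ n + of_nat n * z ^ (n - 1) * p ^ A * d + p ^ Suc A * e"
    by (simp only: algebra_simps)
  \<comment> \<open>Since \<open>A >= 1\<close>, \<open>p ^ (2 * A)\<close> is a multiple of
    \<open>p ^ Suc A\<close>; this removes the second-order term.\<close>
  have pA: "p ^ A * p ^ A = p ^ Suc A * p ^ (A - 1)"
    using assms by (simp add: power_add [symmetric] del: power_Suc)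
  \<comment> \<open>At \<open>n = 0\<close> the truncated exponent \<open>n - 1\<close> is harmless
    because its coefficient vanishes.\<close>
  have zn: "of_nat n * z ^ (n - 1) * z = of_nat n * z ^ n"
    by (cases n) auto
  have "(z + p ^ A * d) ^ Suc n - z ^ Suc n - of_nat (Suc n) * z ^ n * p ^ A * d
     = (of_nat n * z ^ (n - 1) * z) * p ^ A * d - of_nat n * z ^ n * p ^ A * d
       + p ^ Suc A * (e * (z + p ^ A * d)) + (p ^ A * p ^ A) * (of_nat n * z ^ (n - 1) * d * d)"
    unfolding power_Suc2 [of "z + p ^ A * d"] e by (simp add: algebra_simps)
  also have "p ^ Suc A dvd \<dots>"
    unfolding zn pA by (simp add: mult.assoc del: power_Suc)
  finally show ?case by (simp only: diff_Suc_1)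
qed

text \<open>Up to the factors \<open>h + j\<close>, the Jacobian of the power sums of degrees
  \<open>h\<close>, ..., \<open>h + r - 1\<close> is a product of powers of the \<open>z i\<close>
  and of their differences; \<open>p\<close> must divide none of these.\<close>

definition nonsingular_mod :: "int \<Rightarrow> nat \<Rightarrow> (nat \<Rightarrow> int) \<Rightarrow> bool" where
  "nonsingular_mod p r z \<longleftrightarrow>
     (\<forall>i<r. \<not> p dvd z i) \<and> (\<forall>i<r. \<forall>i'<r. i \<noteq> i' \<longrightarrow> \<not> p dvd z i - z i')"

text \<open>Writing \<open>z' = z + p ^ A * d\<close>, the first-order terms give a linear system
  for \<open>d\<close> modulo \<open>p\<close>. Its matrix is Vandermonde up to the invertible
  factors \<open>h + j\<close> and \<open>z l ^ (h - 1)\<close>, so \<open>p\<close> divides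
  \<open>d\<close> and the precision rises by one.\<close>

lemma hensel_unique:
  fixes z z' :: "nat \<Rightarrow> int" and p :: int
  assumes p: "prime p" "\<And>j. j < r \<Longrightarrow> \<not> p dvd int (h + j)" and h: "h \<ge> 1"
    and ns: "nonsingular_mod p r z"
    and z': "\<And>l. l < r \<Longrightarrow> p dvd z' l - z l"
    and eq: "\<And>j. j < r \<Longrightarrow> p ^ A dvd (\<Sum>l<r. z' l ^ (h + j)) - (\<Sum>l<r. z l ^ (h + j))"
    and l: "l < r"
  shows "p ^ A dvd z' l - z l"
  using eq l
proof (induction A arbitrary: l)
  case 0
  then show ?case by simp
next
  case (Suc A)
  have IH: "p ^ A dvd z' l - z l" if "l < r" for l
    using Suc.IH[OF _ that] Suc.prems(1) by (meson dvd_trans le_imp_power_dvd lessI less_imp_le)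
  show ?case
  proof (cases "A = 0")
    case True
    then show ?thesis using z' Suc.prems by simp
  next
    case False
    then have A: "A \<ge> 1" by simp
    have "\<exists>d. \<forall>l<r. z' l = z l + p ^ A * d l"
    proof -
      have "\<forall>l. \<exists>d. l < r \<longrightarrow> z' l = z l + p ^ A * d"
        using IH unfolding dvd_def by (metis add.commute diff_add_cancel)
      then show ?thesis by metis
    qed
    then obtain d where d: "\<And>l. l < r \<Longrightarrow> z' l = z l + p ^ A * d l" by auto
    \<comment> \<open>Absorbing \<open>z l ^ (h - 1)\<close> into the unknown leaves the pure powers
      \<open>z l ^ j\<close> as coefficients.\<close>
    have "p dvd z l ^ (h - 1) * d l" if "l < r" for l
    proof (rule vandermonde_mod_prime[OF p(1) _ _ that, where z = z])
      show "\<not> p dvd z i - z i'" if "i < r" "i' < r" "i \<noteq> i'" for i i'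
        using ns that unfolding nonsingular_mod_def by blast
      fix j assume j: "j < r"
      let ?n = "h + j"
      have "p ^ Suc A dvd (\<Sum>l<r. z' l ^ ?n) - (\<Sum>l<r. z l ^ ?n)" using Suc.prems j by blast
      moreover have "p ^ Suc A dvd (\<Sum>l<r. z' l ^ ?n - z l ^ ?n - of_nat ?n * z l ^ (?n - 1) * p ^ A * d l)"
        by (intro dvd_sum) (simp only: d lessThan_iff power_add_pow_cong[OF A])
      ultimately have "p ^ Suc A dvd ((\<Sum>l<r. z' l ^ ?n) - (\<Sum>l<r. z l ^ ?n))
          - (\<Sum>l<r. z' l ^ ?n - z l ^ ?n - of_nat ?n * z l ^ (?n - 1) * p ^ A * d l)"
        by (rule dvd_diff)
      also have "\<dots> = (\<Sum>l<r. of_nat ?n * z l ^ (?n - 1) * p ^ A * d l)"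
        by (simp add: sum_subtractf)
      also have "\<dots> = p ^ A * (of_nat ?n * (\<Sum>l<r. z l ^ (h - 1) * d l * z l ^ j))"
        using h by (simp add: sum_distrib_left mult_ac power_add [symmetric] add.commute)
      finally have "p dvd of_nat ?n * (\<Sum>l<r. z l ^ (h - 1) * d l * z l ^ j)"
        using p(1) by (simp add: mult.commute[of p])
      then show "p dvd (\<Sum>l<r. z l ^ (h - 1) * d l * z l ^ j)"
        using p j prime_dvd_multD by blast
    qed
    then have "p dvd z l ^ (h - 1) \<or> p dvd d l"
      using p(1) Suc.prems(2) prime_dvd_mult_iff by blast
    then have "p dvd d l"
      using p(1) ns Suc.prems(2) prime_dvd_power unfolding nonsingular_mod_def by blast
    then show ?thesis using d Suc.prems(2) by (simp add: mult.commute[of p])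
  qed
qed

text \<open>Uniqueness makes the lifting map injective on a finite set, hence surjective.\<close>

lemma hensel_exists:
  fixes z Y :: "nat \<Rightarrow> int" and p :: int
  assumes p: "prime p" "\<And>j. j < r \<Longrightarrow> \<not> p dvd int (h + j)" and h: "h \<ge> 1"
    and ns: "nonsingular_mod p r z"
    and Y: "\<And>j. j < r \<Longrightarrow> p dvd Y j - (\<Sum>l<r. z l ^ (h + j))"
  obtains z' where "z' \<in> extensional {..<r}" "\<And>l. l < r \<Longrightarrow> p dvd z' l - z l"
    "\<And>j. j < r \<Longrightarrow> p ^ Suc A dvd (\<Sum>l<r. z' l ^ (h + j)) - Y j"
proof -
  define U where "U = {..<r} \<rightarrow>\<^sub>E {0..<p ^ A}"
  define S where "S d j = (\<Sum>l<r. (z l + p * d l) ^ (h + j))" for d :: "nat \<Rightarrow> int" and j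
  define T where "T j = (\<Sum>l<r. z l ^ (h + j))" for j
  \<comment> \<open>The power sums of \<open>z + p * d\<close> differ from those of \<open>z\<close>
    by multiples of \<open>p\<close>. The quotients modulo \<open>p ^ A\<close> record them modulo
    \<open>p ^ Suc A\<close>, which makes \<open>f\<close> a map of \<open>U\<close> to
    itself.\<close>
  define f where "f d = (\<lambda>j\<in>{..<r}. ((S d j - T j) div p) mod p ^ A)" for d
  have p0: "p > 0" using p(1) prime_gt_0_int by blast
  have ST: "p dvd S d j - T j" for d j
  proof -
    have "p dvd (z l + p * d l) ^ n - z l ^ n" for l n
      using power_diff_sumr2[of "z l + p * d l" n "z l"] by simp
    then show ?thesis unfolding S_def T_def sum_subtractf [symmetric] by (intro dvd_sum) auto
  qed
  have step: "p ^ Suc A dvd u - v" if "p dvd u" "p dvd v" "(u div p) mod p ^ A = (v div p) mod p ^ A" for u v :: int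
  proof -
    obtain u' v' where uv: "u = p * u'" "v = p * v'" using \<open>p dvd u\<close> \<open>p dvd v\<close> by (auto elim!: dvdE)
    with that p0 show ?thesis by (simp add: mod_eq_dvd_iff right_diff_distrib [symmetric])
  qed
  have "finite U" unfolding U_def by (intro finite_PiE) auto
  moreover have "f ` U \<subseteq> U" unfolding U_def f_def using p0 by (intro image_subsetI) (simp add: restrict_PiE_iff)
  moreover have "inj_on f U"
  proof (rule inj_onI)
    fix d e assume de: "d \<in> U" "e \<in> U" "f d = f e"
    have "d l = e l" if l: "l < r" for l
    proof -
      have "p ^ Suc A dvd (z l + p * e l) - (z l + p * d l)"
      proof (rule hensel_unique[of p r h "\<lambda>l. z l + p * d l" "\<lambda>l. z l + p * e l"])
        have "p dvd (z i + p * d i) - (z i' + p * d i') \<longleftrightarrow> p dvd z i - z i'" for i i'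
          using dvd_add_right_iff[of p "p * (d i - d i')" "z i - z i'"] by (simp add: algebra_simps)
        then show "nonsingular_mod p r (\<lambda>l. z l + p * d l)"
          using ns unfolding nonsingular_mod_def by (auto simp: dvd_add_left_iff)
        show "p dvd z l + p * e l - (z l + p * d l)" for l by simp
        fix j assume j: "j < r"
        have "f e j = f d j" using de by simp
        then have "p ^ Suc A dvd (S e j - T j) - (S d j - T j)"
          using j by (intro step ST) (simp add: f_def)
        then show "p ^ Suc A dvd (\<Sum>l<r. (z l + p * e l) ^ (h + j)) - (\<Sum>l<r. (z l + p * d l) ^ (h + j))"
          by (simp add: S_def)
      qed (use p h l in auto)
      then have "p ^ A dvd e l - d l" using p0 by (simp add: right_diff_distrib [symmetric])
      then have "e l mod p ^ A = d l mod p ^ A" by (simp only: mod_eq_dvd_iff)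
      moreover have "d l \<in> {0..<p ^ A}" "e l \<in> {0..<p ^ A}"
        using PiE_mem[of d "{..<r}" _ l] PiE_mem[of e "{..<r}" _ l] de l unfolding U_def by blast+
      ultimately show ?thesis by simp
    qed
    then show "d = e" using de unfolding U_def by (intro PiE_ext) auto
  qed
  ultimately have "f ` U = U" by (rule endo_inj_surj)
  moreover have "(\<lambda>j\<in>{..<r}. ((Y j - T j) div p) mod p ^ A) \<in> U"
    unfolding U_def using p0 by (simp add: restrict_PiE_iff)
  ultimately have "(\<lambda>j\<in>{..<r}. ((Y j - T j) div p) mod p ^ A) \<in> f ` U" by blast
  then obtain d where d: "d \<in> U" "f d = (\<lambda>j\<in>{..<r}. ((Y j - T j) div p) mod p ^ A)"
    by force
  show thesis
  proof (rule that[of "\<lambda>l\<in>{..<r}. z l + p * d l"])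
    fix j assume j: "j < r"
    have "f d j = ((Y j - T j) div p) mod p ^ A" unfolding d(2) using j by simp
    then have "p ^ Suc A dvd (S d j - T j) - (Y j - T j)"
      using j Y by (intro step ST) (auto simp: f_def T_def)
    then show "p ^ Suc A dvd (\<Sum>l<r. (\<lambda>l\<in>{..<r}. z l + p * d l) l ^ (h + j)) - Y j"
      by (simp add: S_def)
  qed auto
qed

section \<open>Lacunary exponents and the number of nonsingular solutions\<close>

lemma digits_inj:
  fixes b c :: "nat \<Rightarrow> nat"
  assumes "\<And>j. j < r \<Longrightarrow> b j < N" "\<And>j. j < r \<Longrightarrow> c j < N"
    and "(\<Sum>j<r. b j * N ^ j) = (\<Sum>j<r. c j * N ^ j)" "j < r"
  shows "b j = c j"
  using assms
proof (induction r arbitrary: j b c)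
  case 0
  then show ?case by simp
next
  case (Suc r)
  have shift: "(\<Sum>j<Suc r. e j * N ^ j) = e 0 + N * (\<Sum>j<r. e (Suc j) * N ^ j)" for e :: "nat \<Rightarrow> nat"
    by (simp add: sum.lessThan_Suc_shift sum_distrib_left mult_ac del: sum.lessThan_Suc)
  have eq: "b 0 + N * (\<Sum>j<r. b (Suc j) * N ^ j) = c 0 + N * (\<Sum>j<r. c (Suc j) * N ^ j)"
    using Suc.prems(3) unfolding shift .
  have N: "b 0 < N" "c 0 < N" using Suc.prems by auto
  have 0: "b 0 = c 0"
    using arg_cong[OF eq, of "\<lambda>x. x mod N"] N by simp
  have "(\<Sum>j<r. b (Suc j) * N ^ j) = (\<Sum>j<r. c (Suc j) * N ^ j)"
    using eq 0 N by simp
  then have "b (Suc j) = c (Suc j)" if "j < r" for j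
    using Suc.IH[of "\<lambda>j. b (Suc j)" "\<lambda>j. c (Suc j)" j] Suc.prems(1,2) that by auto
  then show ?case using 0 Suc.prems(4) by (cases j) auto
qed


text \<open>Up to the factor \<open>V\<close>, a weight is the number with base-\<open>N\<close>
  digits \<open>b\<close>, so weights of distinct digit vectors are at least \<open>V\<close>
  apart.\<close>

lemma digit_weights:
  fixes N V r :: nat
  defines "W \<equiv> \<lambda>b. \<Sum>j<r. V * N ^ j * b j"
  assumes "b \<in> {..<r} \<rightarrow>\<^sub>E {..<N}" "c \<in> {..<r} \<rightarrow>\<^sub>E {..<N}" "b \<noteq> c" "W b \<le> W c"
  shows "W b + V \<le> W c"
proof -
  have W: "W b = V * (\<Sum>j<r. b j * N ^ j)" for b by (simp add: W_def sum_distrib_left mult_ac)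
  have neq: "(\<Sum>j<r. b j * N ^ j) \<noteq> (\<Sum>j<r. c j * N ^ j)"
  proof
    assume eq: "(\<Sum>j<r. b j * N ^ j) = (\<Sum>j<r. c j * N ^ j)"
    have "b j = c j" if "j < r" for j
      using assms(2,3) that by (intro digits_inj[OF _ _ eq that]) auto
    then have "b = c" using assms by (intro PiE_ext[OF assms(2,3)]) auto
    with assms show False by simp
  qed
  show ?thesis
  proof (cases "V = 0")
    case False
    then have "(\<Sum>j<r. b j * N ^ j) < (\<Sum>j<r. c j * N ^ j)"
      using assms(5) neq unfolding W by auto
    then have "V * Suc (\<Sum>j<r. b j * N ^ j) \<le> V * (\<Sum>j<r. c j * N ^ j)"
      by (intro mult_le_mono) auto
    then show ?thesis unfolding W by simp
  qed (simp add: W)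
qed

text \<open>
  A version of Bezout's bound for nonsingular solutions. If there were more solutions, a dimension count
  would give a linear relation between the functions \<open>F\<^sup>b \<phi>\<^sub>\<mu>\<close>, where \<open>\<phi>\<^sub>\<mu>\<close> separates the solution
  \<open>\<mu>\<close> from the others. Each solution has a \<open>p\<close>-adic lift at which \<open>F\<^sub>j\<close> is a prescribed high power of
  \<open>p\<close>; choosing these powers lacunary, a single term of the relation has the smallest valuation.
\<close>

lemma card_power_sum_congruences:
  fixes c :: "nat \<Rightarrow> int" and p :: int
  assumes p: "prime p" "int k < p" and h: "h \<ge> 1" "h + r \<le> Suc k"
  defines "Sol \<equiv> {z \<in> {..<r} \<rightarrow>\<^sub>E {0..<p}. nonsingular_mod p r z
             \<and> (\<forall>j<r. p dvd (\<Sum>l<r. z l ^ (h + j)) - c j)}"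
  shows "card Sol \<le> (r * k + 1) ^ r"
proof (rule ccontr)
  assume "\<not> ?thesis"
  then have big: "(r * k + 1) ^ r < card Sol" by simp
  have finS: "finite Sol" unfolding Sol_def by (rule finite_subset[OF _ finite_PiE[of "{..<r}" "\<lambda>_. {0..<p}"]]) auto
  define N where "N = card Sol"
  have N: "N \<ge> 1" using big by (simp add: N_def)
  define F where "F j x = (\<Sum>l<r. x l ^ (h + j)) - c j" for j and x :: "nat \<Rightarrow> int"
  define sep where "sep \<mu> \<nu> = (SOME i. i < r \<and> \<mu> i \<noteq> \<nu> i)" for \<mu> \<nu> :: "nat \<Rightarrow> int"
  \<comment> \<open>At a lift of a solution, \<open>\<phi> \<mu>\<close> is divisible by
    \<open>p\<close> unless that solution is \<open>\<mu>\<close> itself. The exponent 1 only serves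
    to fit \<open>degree_in_le_shift_power\<close>.\<close>
  define \<phi> where "\<phi> \<mu> x = (\<Prod>\<nu>\<in>Sol - {\<mu>}. (x (sep \<mu> \<nu>) - \<nu> (sep \<mu> \<nu>)) ^ 1)" for \<mu> and x :: "nat \<Rightarrow> int"
  define Bx where "Bx = {..<r} \<rightarrow>\<^sub>E {..<N}"
  define I where "I = Bx \<times> Sol"
  define D where "D = r * ((N - 1) * k) + (N - 1)"
  define G where "G = {..<r} \<rightarrow>\<^sub>E {0..int D}"
  define v where "v i x = (\<Prod>j<r. F j x ^ fst i j) * \<phi> (snd i) x" for i :: "(nat \<Rightarrow> nat) \<times> (nat \<Rightarrow> int)" and x
  have p0: "p > 1" using p(1) prime_gt_1_int by blast
  have pj: "\<not> p dvd int (h + j)" if "j < r" for j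
    using h p that zdvd_not_zless[of "int (h + j)" p] by auto
  have sep: "sep \<mu> \<nu> < r \<and> \<mu> (sep \<mu> \<nu>) \<noteq> \<nu> (sep \<mu> \<nu>)" if "\<mu> \<in> Sol" "\<nu> \<in> Sol" "\<mu> \<noteq> \<nu>" for \<mu> \<nu>
  proof -
    have "\<exists>i. i < r \<and> \<mu> i \<noteq> \<nu> i"
      using PiE_ext[of \<mu> "{..<r}" "\<lambda>_. {0..<p}" \<nu>] that unfolding Sol_def by auto
    then show ?thesis unfolding sep_def by (rule someI_ex)
  qed
  have finI: "finite I" unfolding I_def Bx_def using finS by (intro finite_cartesian_product finite_PiE) auto
  \<comment> \<open>The grid has \<open>(D + 1) ^ r <= ((r * k + 1) * N) ^ r\<close> points and the
    family has \<open>N ^ Suc r\<close> members, so the assumption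
    \<open>N > (r * k + 1) ^ r\<close> forces a relation.\<close>
  have "card G < card I"
  proof -
    have "D + 1 \<le> (r * k + 1) * N" using N by (cases N) (auto simp: D_def algebra_simps)
    then have "card G \<le> ((r * k + 1) * N) ^ r"
      unfolding G_def by (simp add: card_PiE) (intro power_mono, auto simp: nat_add_distrib)
    also have "\<dots> = (r * k + 1) ^ r * N ^ r" by (rule power_mult_distrib)
    also have "\<dots> < N * N ^ r" using big N by (intro mult_strict_right_mono) (auto simp: N_def)
    also have "\<dots> = card I" by (simp add: I_def Bx_def card_PiE N_def card_cartesian_product mult.commute)
    finally show ?thesis .
  qed
  then obtain cf where cf: "\<exists>i\<in>I. cf i \<noteq> 0" "\<And>x. x \<in> G \<Longrightarrow> (\<Sum>i\<in>I. cf i * v i x) = 0"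
    using linear_dependency_int[of G I v] finI unfolding G_def by (auto simp: finite_PiE)
  have deg: "degree_in_le D (\<lambda>x. \<Sum>i\<in>I. cf i * v i x)"
  proof (rule degree_in_le_sum)
    fix i assume i: "i \<in> I"
    have "degree_in_le k (F j)" if "j < r" for j
    proof -
      have "degree_in_le k (\<lambda>x. (\<Sum>l<r. (x l - 0) ^ (h + j)) + (- c j))"
        using that h by (intro degree_in_le_add degree_in_le_const degree_in_le_sum
            degree_in_le_mono[OF degree_in_le_shift_power]) auto
      then show ?thesis unfolding F_def by simp
    qed
    then have "degree_in_le (\<Sum>j<r. (N - 1) * k) (\<lambda>x. \<Prod>j<r. F j x ^ fst i j)"
      using i by (intro degree_in_le_prod degree_in_le_mono[OF degree_in_le_power] mult_le_mono)
        (auto simp: I_def Bx_def dest!: PiE_mem)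
    moreover have "degree_in_le (\<Sum>\<nu>\<in>Sol - {snd i}. 1) (\<phi> (snd i))"
      unfolding \<phi>_def by (intro degree_in_le_prod degree_in_le_shift_power)
    ultimately have "degree_in_le (0 + ((\<Sum>j<r. (N - 1) * k) + (\<Sum>\<nu>\<in>Sol - {snd i}. 1))) (\<lambda>x. cf i * v i x)"
      unfolding v_def by (intro degree_in_le_mult degree_in_le_const)
    then show "degree_in_le D (\<lambda>x. cf i * v i x)"
      by (rule degree_in_le_mono) (use i finS in \<open>auto simp: D_def I_def N_def\<close>)
  qed
  have zero: "(\<Sum>i\<in>I. cf i * v i x) = 0" if "x \<in> extensional {..<r}" for x
    using vanish_on_grid[OF deg _ that] cf(2) unfolding G_def by blast
  \<comment> \<open>So large that \<open>p ^ V\<close> exceeds every coefficient: a nonzero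
    coefficient has valuation less than \<open>V\<close>.\<close>
  define V where "V = Suc (nat (\<Sum>i\<in>I. \<bar>cf i\<bar>))"
  have V: "cf i = 0" if "i \<in> I" "p ^ V dvd cf i" for i
  proof (rule ccontr)
    assume "cf i \<noteq> 0"
    have "\<bar>cf i\<bar> \<le> (\<Sum>i\<in>I. \<bar>cf i\<bar>)" using that finI by (intro member_le_sum) auto
    also have "\<dots> < int V" by (simp add: V_def)
    also have "int V < 2 ^ V" using of_nat_less_two_power by blast
    also have "(2::int) ^ V \<le> p ^ V" using p0 by (intro power_mono) auto
    finally show False using that(2) \<open>cf i \<noteq> 0\<close> dvd_imp_le_int[of "cf i" "p ^ V"] by auto
  qed
  \<comment> \<open>The valuation of the product of the \<open>F j ^ b j\<close> once
    \<open>F j\<close> is \<open>p ^ (V * N ^ j)\<close>. The gap \<open>V\<close> between distinct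
    weights outweighs the valuation of any nonzero coefficient.\<close>
  define W where "W = (\<lambda>b :: nat \<Rightarrow> nat. \<Sum>j<r. V * N ^ j * b j)"
  define Supp where "Supp = {b \<in> Bx. \<exists>\<mu>\<in>Sol. cf (b, \<mu>) \<noteq> 0}"
  have "Supp \<noteq> {}" using cf(1) by (auto simp: Supp_def I_def)
  moreover have "finite Supp" unfolding Supp_def Bx_def by (simp add: finite_PiE)
  ultimately obtain b where b: "b \<in> Supp" "\<And>b'. b' \<in> Supp \<Longrightarrow> W b \<le> W b'"
    by (metis arg_min_if_finite(1) arg_min_least)
  \<comment> \<open>Among the terms with the minimal exponent vector \<open>b\<close>, the least
    valuation \<open>e\<close> of a coefficient is sought; it is attained at some
    \<open>\<nu>\<close>.\<close>
  define P where "P e \<longleftrightarrow> (\<forall>\<mu>\<in>Sol. p ^ e dvd cf (b, \<mu>))" for e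
  have bB: "b \<in> Bx" using b by (simp add: Supp_def)
  have Pbound: "e < V" if "P e" for e
  proof (rule ccontr)
    assume "\<not> e < V"
    then have "p ^ V dvd cf (b, \<mu>)" if "\<mu> \<in> Sol" for \<mu>
      using \<open>P e\<close> that unfolding P_def by (meson dvd_trans le_imp_power_dvd not_less)
    then have "cf (b, \<mu>) = 0" if "\<mu> \<in> Sol" for \<mu> using V[of "(b, \<mu>)"] that bB by (auto simp: I_def)
    then show False using b(1) by (auto simp: Supp_def)
  qed
  have "P 0" by (simp add: P_def)
  have "\<exists>e. P e \<and> \<not> P (Suc e)"
  proof (rule ccontr)
    assume "\<nexists>e. P e \<and> \<not> P (Suc e)"
    then have "P e" for e using \<open>P 0\<close> by (induction e) auto
    then show False using Pbound by blast
  qed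
  then obtain e where e: "P e" "\<not> P (Suc e)" by blast
  then obtain \<nu> where \<nu>: "\<nu> \<in> Sol" "\<not> p ^ Suc e dvd cf (b, \<nu>)" by (auto simp: P_def)
  \<comment> \<open>One more than the valuation \<open>W b + e\<close> of the term for
    \<open>(b, \<nu>)\<close>; all other terms will vanish to this precision.\<close>
  define A where "A = W b + Suc e"
  obtain z where z: "z \<in> extensional {..<r}" "\<And>l. l < r \<Longrightarrow> p dvd z l - \<nu> l"
    "\<And>j. j < r \<Longrightarrow> p ^ Suc A dvd (\<Sum>l<r. z l ^ (h + j)) - (c j + p ^ (V * N ^ j))"
  proof (rule hensel_exists[OF p(1) pj h(1)])
    show "nonsingular_mod p r \<nu>" using \<nu> by (simp add: Sol_def)
    fix j assume j: "j < r"
    have "V * N ^ j > 0" using N by (simp add: V_def)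
    then have "p dvd p ^ (V * N ^ j)" by (simp add: dvd_power)
    moreover have "p dvd (\<Sum>l<r. \<nu> l ^ (h + j)) - c j" using \<nu> j by (simp add: Sol_def)
    ultimately have "p dvd p ^ (V * N ^ j) - ((\<Sum>l<r. \<nu> l ^ (h + j)) - c j)" by (rule dvd_diff)
    then show "p dvd c j + p ^ (V * N ^ j) - (\<Sum>l<r. \<nu> l ^ (h + j))" by (simp add: algebra_simps)
  qed blast+
  have FW: "[(\<Prod>j<r. F j z ^ b' j) = p ^ W b'] (mod p ^ A)" for b'
  proof -
    have "[F j z = p ^ (V * N ^ j)] (mod p ^ A)" if "j < r" for j
    proof -
      have "p ^ A dvd F j z - p ^ (V * N ^ j)"
        using z(3)[OF that] dvd_trans[OF le_imp_power_dvd[of A "Suc A" p]] by (auto simp: F_def algebra_simps)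
      then show ?thesis by (simp add: cong_iff_dvd_diff)
    qed
    then have "[(\<Prod>j<r. F j z ^ b' j) = (\<Prod>j<r. (p ^ (V * N ^ j)) ^ b' j)] (mod p ^ A)"
      by (intro cong_prod cong_pow) auto
    then show ?thesis by (simp add: W_def power_sum power_mult)
  qed
  have pz: "p dvd \<phi> \<mu> z" if "\<mu> \<in> Sol" "\<mu> \<noteq> \<nu>" for \<mu>
  proof -
    have "z (sep \<mu> \<nu>) - \<nu> (sep \<mu> \<nu>) dvd \<phi> \<mu> z"
      unfolding \<phi>_def power_one_right using that \<nu> finS by (intro dvd_prodI) auto
    then show ?thesis using z(2) sep[of \<mu> \<nu>] that \<nu> dvd_trans by blast
  qed
  have npz: "\<not> p dvd \<phi> \<nu> z"
  proof
    assume "p dvd \<phi> \<nu> z"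
    then obtain \<mu> where \<mu>: "\<mu> \<in> Sol" "\<mu> \<noteq> \<nu>" "p dvd z (sep \<nu> \<mu>) - \<mu> (sep \<nu> \<mu>)"
      unfolding \<phi>_def using p(1) finS by (auto simp: prime_dvd_prod_iff)
    have s: "sep \<nu> \<mu> < r" "\<nu> (sep \<nu> \<mu>) \<noteq> \<mu> (sep \<nu> \<mu>)" using sep[of \<nu> \<mu>] \<mu> \<nu> by auto
    have "p dvd (z (sep \<nu> \<mu>) - \<mu> (sep \<nu> \<mu>)) - (z (sep \<nu> \<mu>) - \<nu> (sep \<nu> \<mu>))"
      using \<mu>(3) z(2)[OF s(1)] by (rule dvd_diff)
    then have "\<nu> (sep \<nu> \<mu>) mod p = \<mu> (sep \<nu> \<mu>) mod p" by (simp add: mod_eq_dvd_iff)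
    moreover have "\<nu> (sep \<nu> \<mu>) \<in> {0..<p}" "\<mu> (sep \<nu> \<mu>) \<in> {0..<p}"
      using \<mu> \<nu> s unfolding Sol_def by auto
    ultimately show False using s by simp
  qed
  \<comment> \<open>With the same exponent vector, \<open>\<phi> \<mu>\<close> contributes an extra
    factor \<open>p\<close>. With another one in the support, the weight is larger by at least
    \<open>V > e\<close>.\<close>
  have other: "p ^ A dvd cf (b', \<mu>) * v (b', \<mu>) z" if "b' \<in> Bx" "\<mu> \<in> Sol" "(b', \<mu>) \<noteq> (b, \<nu>)" for b' \<mu>
  proof (cases "b' = b")
    case True
    then have "\<mu> \<noteq> \<nu>" using that by auto
    have "p ^ e * (p ^ W b * p) dvd cf (b, \<mu>) * (p ^ W b * \<phi> \<mu> z)"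
      using e(1) that pz[OF that(2) \<open>\<mu> \<noteq> \<nu>\<close>] unfolding P_def by (intro mult_dvd_mono) auto
    also have "p ^ e * (p ^ W b * p) = p ^ A" by (simp add: A_def power_add mult_ac)
    finally have "[cf (b, \<mu>) * (p ^ W b * \<phi> \<mu> z) = 0] (mod p ^ A)" by (simp add: cong_0_iff)
    moreover have "[cf (b, \<mu>) * v (b, \<mu>) z = cf (b, \<mu>) * (p ^ W b * \<phi> \<mu> z)] (mod p ^ A)"
      unfolding v_def fst_conv snd_conv by (intro cong_mult FW) auto
    ultimately show ?thesis using True cong_trans cong_0_iff by metis
  next
    case False
    show ?thesis
    proof (cases "cf (b', \<mu>) = 0")
      case nz: False
      then have "b' \<in> Supp" using that by (auto simp: Supp_def)
      then have "W b + V \<le> W b'"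
        using digit_weights[of b r N b' V] b(2) bB that False unfolding W_def Bx_def by auto
      then have "A \<le> W b'" using Pbound[OF e(1)] by (simp add: A_def)
      then have "[p ^ W b' = 0] (mod p ^ A)" by (simp add: cong_0_iff le_imp_power_dvd)
      then have "[v (b', \<mu>) z = 0 * \<phi> \<mu> z] (mod p ^ A)"
        unfolding v_def fst_conv snd_conv by (intro cong_mult cong_trans[OF FW]) auto
      then show ?thesis by (simp add: cong_0_iff)
    qed simp
  qed
  have "(\<Sum>i\<in>I. cf i * v i z) = cf (b, \<nu>) * v (b, \<nu>) z + (\<Sum>i\<in>I - {(b, \<nu>)}. cf i * v i z)"
    using finI bB \<nu> by (intro sum.remove) (auto simp: I_def)
  moreover have "p ^ A dvd (\<Sum>i\<in>I - {(b, \<nu>)}. cf i * v i z)"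
    using other by (intro dvd_sum) (auto simp: I_def)
  ultimately have dv: "p ^ A dvd cf (b, \<nu>) * v (b, \<nu>) z"
    using zero[OF z(1)] dvd_add_left_iff[of "p ^ A" "\<Sum>i\<in>I - {(b, \<nu>)}. cf i * v i z" "cf (b, \<nu>) * v (b, \<nu>) z"]
    by simp
  have "[cf (b, \<nu>) * v (b, \<nu>) z = cf (b, \<nu>) * (p ^ W b * \<phi> \<nu> z)] (mod p ^ A)"
    unfolding v_def fst_conv snd_conv by (intro cong_mult FW) auto
  then have "p ^ A dvd cf (b, \<nu>) * (p ^ W b * \<phi> \<nu> z)"
    using dv cong_trans[OF cong_sym] unfolding cong_0_iff [symmetric] by blast
  then have "p ^ W b * p ^ Suc e dvd p ^ W b * (cf (b, \<nu>) * \<phi> \<nu> z)"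
    by (simp add: A_def power_add mult_ac)
  moreover have "p ^ W b \<noteq> 0" using p0 by simp
  ultimately have "p ^ Suc e dvd cf (b, \<nu>) * \<phi> \<nu> z"
    using dvd_mult_cancel_left by blast
  moreover have "coprime (p ^ Suc e) (\<phi> \<nu> z)"
    using npz p(1) prime_imp_coprime[of p "\<phi> \<nu> z"] by (simp only: coprime_power_left_iff simp_thms)
  ultimately have "p ^ Suc e dvd cf (b, \<nu>)" using coprime_dvd_mult_left_iff by blast
  then show False using \<nu>(2) by contradiction
qed

section \<open>Smooth numbers\<close>

text \<open>Splitting off the exact power of one prime maps \<open>F\<close> injectively into pairs
  of an exponent and a number free of that prime; the sum over exponents is a truncated geometric
  series.\<close>

lemma sum_le_euler_product:
  fixes g :: "nat \<Rightarrow> real"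
  assumes "finite S" "\<And>p. p \<in> S \<Longrightarrow> prime p"
    and g: "g 1 = 1" "\<And>a b. a > 0 \<Longrightarrow> b > 0 \<Longrightarrow> g (a * b) = g a * g b" "\<And>a. g a \<ge> 0"
    and "\<And>p. p \<in> S \<Longrightarrow> g p < 1"
    and "finite F" "\<And>a. a \<in> F \<Longrightarrow> a > 0 \<and> prime_factors a \<subseteq> S"
  shows "(\<Sum>a\<in>F. g a) \<le> (\<Prod>p\<in>S. 1 / (1 - g p))"
  using assms(1,2,6-)
proof (induction S arbitrary: F rule: finite_induct)
  case empty
  then have "F \<subseteq> {1}" by (auto simp: prime_factorization_empty_iff)
  then have "F = {} \<or> F = {1}" by auto
  then show ?case using g by auto
next
  case (insert p S)
  have p: "prime p" using insert by auto
  define f where "f a = (multiplicity p a, a div p ^ multiplicity p a)" for a :: nat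
  have split: "a = p ^ fst (f a) * snd (f a)" if "a > 0" for a
    using that by (simp add: f_def multiplicity_dvd)
  have inj: "inj_on f F"
    using split insert.prems(4) by (intro inj_onI) metis
  define F' where "F' = (snd \<circ> f) ` F"
  define N where "N = Max (insert 0 ((fst \<circ> f) ` F))"
  have "finite F'" using insert by (simp add: F'_def)
  have F': "b > 0 \<and> prime_factors b \<subseteq> S" if "b \<in> F'" for b
  proof -
    obtain a where a: "a \<in> F" "b = a div p ^ multiplicity p a" using \<open>b \<in> F'\<close> by (auto simp: F'_def f_def)
    have a0: "a > 0" "prime_factors a \<subseteq> insert p S" using insert.prems a by auto
    have ab: "a = p ^ multiplicity p a * b" using split[OF a0(1)] a by (simp add: f_def)
    then have b0: "b > 0" using a0 by (metis mult_0_right neq0_conv)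
    have "\<not> p dvd b"
      using a(2) a0 not_prime_unit[of p] p multiplicity_decompose[of a p] by fastforce
    moreover have "prime_factors b \<subseteq> prime_factors a"
      using dvd_triv_right[of b "p ^ multiplicity p a"] ab a0 by (intro dvd_prime_factors) auto
    ultimately show ?thesis using a0 b0 by (auto simp: prime_factors_dvd)
  qed
  have gpow: "g (p ^ e) = g p ^ e" for e
    using g p prime_gt_0_nat by (induction e) auto
  have gp: "0 \<le> g p" "g p < 1" using g insert by auto
  have "(\<Sum>a\<in>F. g a) = (\<Sum>a\<in>F. case f a of (e, b) \<Rightarrow> g p ^ e * g b)"
  proof (rule sum.cong)
    fix a assume "a \<in> F"
    then have a: "a > 0" using insert by auto
    have b: "snd (f a) > 0" using F' \<open>a \<in> F\<close> by (auto simp: F'_def)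
    have "g a = g (p ^ fst (f a) * snd (f a))" using split[OF a] by simp
    also have "\<dots> = g p ^ fst (f a) * g (snd (f a))"
      using b p prime_gt_0_nat by (simp add: g gpow)
    finally show "g a = (case f a of (e, b) \<Rightarrow> g p ^ e * g b)" by (simp add: case_prod_beta)
  qed simp
  also have "\<dots> = (\<Sum>(e, b)\<in>f ` F. g p ^ e * g b)"
    using inj by (simp add: sum.reindex)
  also have "\<dots> \<le> (\<Sum>(e, b)\<in>{..N} \<times> F'. g p ^ e * g b)"
  proof (rule sum_mono2)
    show "f ` F \<subseteq> {..N} \<times> F'"
    proof
      fix x assume "x \<in> f ` F"
      then have "fst x \<in> insert 0 ((fst \<circ> f) ` F)" "snd x \<in> F'" by (auto simp: F'_def)
      then show "x \<in> {..N} \<times> F'"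
        using Max_ge[of "insert 0 ((fst \<circ> f) ` F)" "fst x"] insert.prems unfolding N_def by (cases x) auto
    qed
  qed (use g gp \<open>finite F'\<close> in auto)
  also have "\<dots> = (\<Sum>e\<le>N. g p ^ e) * (\<Sum>b\<in>F'. g b)"
    by (simp add: sum.cartesian_product [symmetric] sum_product)
  also have "\<dots> \<le> 1 / (1 - g p) * (\<Prod>q\<in>S. 1 / (1 - g q))"
  proof (rule mult_mono)
    have "(\<Sum>e\<le>N. g p ^ e) = (1 - g p ^ Suc N) / (1 - g p)"
      using gp by (simp add: sum_gp0)
    also have "\<dots> \<le> 1 / (1 - g p)"
      using gp by (intro divide_right_mono) auto
    finally show "(\<Sum>e\<le>N. g p ^ e) \<le> 1 / (1 - g p)" .
    show "(\<Sum>b\<in>F'. g b) \<le> (\<Prod>q\<in>S. 1 / (1 - g q))"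
      by (rule insert.IH) (use insert F' \<open>finite F'\<close> in auto)
  qed (use g gp in \<open>auto intro!: sum_nonneg\<close>)
  also have "\<dots> = (\<Prod>q\<in>insert p S. 1 / (1 - g q))" using insert by simp
  finally show ?case .
qed

section \<open>Chebyshev's upper bound and sums over primes\<close>

lemma prod_primes_dvd:
  fixes n :: nat
  assumes "finite S" "\<And>p. p \<in> S \<Longrightarrow> prime p" "\<And>p. p \<in> S \<Longrightarrow> p dvd n"
  shows "\<Prod>S dvd n"
  using assms
proof (induction S rule: finite_induct)
  case (insert p S)
  have "coprime p (\<Prod>S)"
    using insert by (intro prod_coprime_right) (auto intro: primes_coprime)
  then show ?case using insert by (auto intro: divides_mult)
qed simp

text \<open>The two equal central entries of row \<open>2 * m + 1\<close> together are at most the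
  row sum \<open>2 * 4 ^ m\<close>.\<close>

lemma choose_middle_le: "(2 * m + 1) choose m \<le> (4::nat) ^ m"
proof -
  have "2 * ((2 * m + 1) choose m) = ((2 * m + 1) choose m) + ((2 * m + 1) choose (m + 1))"
    using binomial_symmetric[of m "2 * m + 1"] by simp
  also have "\<dots> = (\<Sum>k\<in>{m, m + 1}. (2 * m + 1) choose k)" by simp
  also have "\<dots> \<le> (\<Sum>k\<le>2 * m + 1. (2 * m + 1) choose k)" by (intro sum_mono2) auto
  also have "\<dots> = 2 * 4 ^ m" unfolding choose_row_sum by (simp add: power_mult)
  finally show ?thesis by simp
qed

text \<open>Erdos's argument: an even \<open>n > 2\<close> is not prime, and for
  \<open>n = 2 * m + 1\<close> all primes in \<open>(m + 1, n]\<close> divide the central binomial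
  coefficient, which is at most \<open>4 ^ m\<close>.\<close>

lemma prod_primes_le: "\<Prod>{p::nat. prime p \<and> p \<le> n} \<le> 4 ^ n"
proof (induction n rule: less_induct)
  case (less n)
  show ?case
  proof (cases "n \<le> 2")
    case True
    have "p = 2 \<and> n = 2" if "prime p" "p \<le> n" for p :: nat
      using True prime_ge_2_nat[OF that(1)] that(2) by linarith
    then have "{p::nat. prime p \<and> p \<le> n} = (if n = 2 then {2} else {})" by auto
    then show ?thesis by simp
  next
    case False
    show ?thesis
    proof (cases "even n")
      case True
      have "\<not> prime n" using True False primes_dvd_imp_eq two_is_prime_nat by blast
      then have eq: "{p::nat. prime p \<and> p \<le> n} = {p. prime p \<and> p \<le> n - 1}"
      proof -
        have "p \<le> n \<longleftrightarrow> p \<le> n - 1" if "prime p" for p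
          using that \<open>\<not> prime n\<close> by (cases "p = n") auto
        then show ?thesis by auto
      qed
      have "\<Prod>{p::nat. prime p \<and> p \<le> n} \<le> 4 ^ (n - 1)" unfolding eq using less False by auto
      also have "\<dots> \<le> 4 ^ n" by (intro power_increasing) auto
      finally show ?thesis .
    next
      case odd: False
      then obtain m where m: "n = 2 * m + 1" by (elim oddE)
      define A where "A = {p::nat. prime p \<and> p \<le> m + 1}"
      define B where "B = {p::nat. prime p \<and> m + 1 < p \<and> p \<le> n}"
      have AB: "{p::nat. prime p \<and> p \<le> n} = A \<union> B" "A \<inter> B = {}" "finite A" "finite B"
        using m by (auto simp: A_def B_def)
      have "\<Prod>B dvd (n choose m)"
      proof (rule prod_primes_dvd)
        fix p assume "p \<in> B"
        then have p: "prime p" "m + 1 < p" "p \<le> n" by (auto simp: B_def)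
        have "fact m * fact (n - m) * (n choose m) = (fact n :: nat)"
          using m by (intro binomial_fact_lemma) auto
        moreover have "p dvd (fact n :: nat)" using p by (simp add: prime_dvd_fact_iff)
        moreover have "n - m = m + 1" using m by simp
        then have "\<not> p dvd (fact m :: nat)" "\<not> p dvd (fact (n - m) :: nat)"
          using p prime_dvd_fact_iff[of p m] prime_dvd_fact_iff[of p "n - m"] by linarith+
        ultimately show "p dvd n choose m" using p(1) by (metis prime_dvd_mult_iff)
      qed (use AB in \<open>auto simp: B_def\<close>)
      moreover have "0 < n choose m" using m by simp
      ultimately have "\<Prod>B \<le> n choose m" by (rule dvd_imp_le)
      then have "\<Prod>B \<le> 4 ^ m" using choose_middle_le[of m] m by simp
      moreover have "\<Prod>A \<le> 4 ^ (m + 1)" unfolding A_def using less[of "m + 1"] m False by simp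
      ultimately have "\<Prod>A * \<Prod>B \<le> 4 ^ (m + 1) * 4 ^ m" by (intro mult_le_mono)
      also have "\<dots> = 4 ^ n" using m by (simp add: power_add [symmetric] mult_2)
      finally show ?thesis using AB by (simp add: prod.union_disjoint)
    qed
  qed
qed

lemma sum_ln_primes_le: "(\<Sum>p | prime p \<and> p \<le> n. ln (real p)) \<le> real n * ln 4"
proof -
  have "(\<Sum>p | prime p \<and> p \<le> n. ln (real p)) = ln (real (\<Prod>{p. prime p \<and> p \<le> n}))"
    using prime_gt_0_nat by (subst of_nat_prod, subst ln_prod) auto
  also have "\<dots> \<le> ln (real (4 ^ n))"
  proof (rule ln_mono)
    show "real (\<Prod>{p. prime p \<and> p \<le> n}) > 0" using prime_gt_0_nat by (auto intro!: prod_pos)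
    show "real (\<Prod>{p. prime p \<and> p \<le> n}) \<le> real (4 ^ n)" using prod_primes_le of_nat_le_iff by blast
  qed
  also have "\<dots> = real n * ln 4" by (simp add: ln_realpow)
  finally show ?thesis .
qed

text \<open>Discrete form of the fact that \<open>1 / (x ln x)\<close> is the derivative of
  \<open>ln (ln x)\<close>: the inequality \<open>ln u <= u - 1\<close> is used once for each
  logarithm.\<close>

lemma inverse_n_ln_n_le:
  assumes "n \<ge> 3"
  shows "1 / (real n * ln (real n)) \<le> ln (ln (real n)) - ln (ln (real n - 1))"
proof -
  have l: "ln (real n - 1) > 0" "ln (real n) > 0" using assms by auto
  have "1 / real n \<le> ln (real n) - ln (real n - 1)"
  proof -
    have "ln ((real n - 1) / real n) \<le> (real n - 1) / real n - 1" using assms by (intro ln_le_minus_one) auto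
    moreover have "ln ((real n - 1) / real n) = ln (real n - 1) - ln (real n)"
      using assms by (simp add: ln_div)
    ultimately show ?thesis using assms by (simp add: diff_divide_distrib)
  qed
  then have "1 / (real n * ln (real n)) \<le> (ln (real n) - ln (real n - 1)) / ln (real n)"
    using l by (simp add: divide_right_mono flip: divide_divide_eq_left)
  also have "\<dots> = 1 - ln (real n - 1) / ln (real n)" using l by (simp add: diff_divide_distrib)
  also have "\<dots> \<le> - ln (ln (real n - 1) / ln (real n))"
    using ln_le_minus_one[of "ln (real n - 1) / ln (real n)"] l by simp
  also have "\<dots> = ln (ln (real n)) - ln (ln (real n - 1))" using l by (simp add: ln_div)
  finally show ?thesis .
qed

text \<open>Partial summation against \<open>1 / (n ln n)\<close>, starting from the Chebyshev bound above.\<close>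

lemma sum_inverse_primes_le:
  assumes "A \<ge> 2" "A < B"
  shows "(\<Sum>p | prime p \<and> A < p \<and> p \<le> B. 1 / real p)
     \<le> ln 4 * (1 / ln (real A) + ln (ln (real B) / ln (real A)))"
proof -
  define g where "g n = 1 / (real n * ln (real n))" for n
  define a where "a n = (if prime n then ln (real n) else 0)" for n :: nat
  \<comment> \<open>The excess of the Chebyshev sum over its mean value \<open>ln 4\<close>. The
    bound for all primes up to \<open>n\<close> leaves at most \<open>ln 4 * real A\<close>, because
    the primes up to \<open>A\<close> are discarded.\<close>
  define U where "U n = (\<Sum>m\<in>{A<..n}. a m - ln 4)" for n
  have g_mono: "g (Suc n) \<le> g n" if "n > A" for n
    unfolding g_def using that assms by (intro divide_left_mono mult_mono mult_pos_pos) auto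
  have g0: "g n \<ge> 0" if "n > A" for n unfolding g_def using that assms by auto
  have U: "U n \<le> ln 4 * real A" if "n \<ge> A" for n
  proof -
    have "(\<Sum>m\<in>{A<..n}. a m) = (\<Sum>p\<in>{p\<in>{A<..n}. prime p}. ln (real p))"
      unfolding a_def by (subst sum.inter_filter [symmetric]) auto
    also have "\<dots> \<le> (\<Sum>p | prime p \<and> p \<le> n. ln (real p))"
      using prime_gt_0_nat by (intro sum_mono2) (auto simp: Suc_le_eq)
    also have "\<dots> \<le> real n * ln 4" by (rule sum_ln_primes_le)
    finally show ?thesis using that by (simp add: U_def sum_subtractf of_nat_diff algebra_simps)
  qed
  \<comment> \<open>Summation by parts as an induction: \<open>g\<close> decreases, so the upper
    bound for \<open>U\<close> suffices.\<close>
  have main: "(\<Sum>n\<in>{A<..n}. (a n - ln 4) * g n) \<le> U n * g n + ln 4 * real A * (g (Suc A) - g n)"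
    if "n \<ge> Suc A" for n
    using that
  proof (induction n rule: dec_induct)
    case base
    have "{A<..Suc A} = {Suc A}" by auto
    then show ?case by (simp add: U_def)
  next
    case (step n)
    have "{A<..Suc n} = insert (Suc n) {A<..n}" using step by auto
    then have Suc: "U (Suc n) = (a (Suc n) - ln 4) + U n"
      "(\<Sum>n\<in>{A<..Suc n}. (a n - ln 4) * g n) = (a (Suc n) - ln 4) * g (Suc n) + (\<Sum>n\<in>{A<..n}. (a n - ln 4) * g n)"
      by (simp_all add: U_def)
    have "U n * (g n - g (Suc n)) \<le> ln 4 * real A * (g n - g (Suc n))"
      using U[of n] g_mono[of n] step by (intro mult_right_mono) auto
    then show ?case unfolding Suc(2) using step.IH by (simp add: Suc(1) algebra_simps)
  qed
  have "(\<Sum>p | prime p \<and> A < p \<and> p \<le> B. 1 / real p) = (\<Sum>n\<in>{n\<in>{A<..B}. prime n}. ln (real n) * g n)"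
    using assms by (intro sum.cong) (auto simp: g_def)
  also have "\<dots> = (\<Sum>n\<in>{A<..B}. a n * g n)"
    unfolding a_def by (subst sum.inter_filter) (auto intro!: sum.cong)
  also have "\<dots> = (\<Sum>n\<in>{A<..B}. (a n - ln 4) * g n) + ln 4 * (\<Sum>n\<in>{A<..B}. g n)"
    by (simp add: sum_distrib_left left_diff_distrib sum_subtractf)
  also have "(\<Sum>n\<in>{A<..B}. (a n - ln 4) * g n) \<le> U B * g B + ln 4 * real A * (g (Suc A) - g B)"
    using main[of B] assms by simp
  also have "\<dots> \<le> ln 4 * real A * g B + ln 4 * real A * (g (Suc A) - g B)"
    using U[of B] g0[of B] assms by (intro add_right_mono mult_right_mono) auto
  also have "\<dots> = ln 4 * (real A * g (Suc A))" by (simp add: algebra_simps)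
  also have "real A * g (Suc A) \<le> 1 / ln (real A)"
  proof -
    have "real A * g (Suc A) = (real A / real (Suc A)) * (1 / ln (real (Suc A)))" by (simp add: g_def)
    also have "\<dots> \<le> 1 * (1 / ln (real A))" using assms by (intro mult_mono divide_left_mono) auto
    finally show ?thesis by simp
  qed
  also have "(\<Sum>n\<in>{A<..B}. g n) \<le> ln (ln (real B)) - ln (ln (real A))"
  proof -
    have "(\<Sum>n\<in>{A<..B}. g n) \<le> (\<Sum>n\<in>{A<..B}. ln (ln (real n)) - ln (ln (real (n - 1))))"
    proof (rule sum_mono)
      fix n assume n: "n \<in> {A<..B}"
      then have "n \<ge> 3" using assms by auto
      then have "real (n - 1) = real n - 1" by simp
      then show "g n \<le> ln (ln (real n)) - ln (ln (real (n - 1)))"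
        using inverse_n_ln_n_le[OF \<open>n \<ge> 3\<close>] unfolding g_def by simp
    qed
    also have "\<dots> = ln (ln (real B)) - ln (ln (real A))"
      using sum_telescope''[of A B "\<lambda>n. ln (ln (real n))"] assms
      by (simp add: atLeastSucAtMost_greaterThanAtMost [symmetric])
    finally show ?thesis .
  qed
  also have "ln (ln (real B)) - ln (ln (real A)) = ln (ln (real B) / ln (real A))"
    using assms by (simp add: ln_div)
  finally show ?thesis by (simp add: algebra_simps)
qed


section \<open>Density of smooth numbers\<close>

definition smooth_primes :: "real \<Rightarrow> nat set" where
  "smooth_primes R = {p. prime p \<and> real p \<in> {sqrt R<..R}}"

lemma finite_smooth_primes: "finite (smooth_primes R)"
  by (rule finite_subset[of _ "{..nat \<lfloor>R\<rfloor>}"]) (auto simp: smooth_primes_def le_nat_floor)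

lemma smooth_set_iff:
  "n \<in> smooth_set P R \<longleftrightarrow> 0 < n \<and> real n \<le> P \<and> prime_factors n \<subseteq> smooth_primes R"
  unfolding smooth_set_def smooth_primes_def by (auto simp: prime_factors_dvd)

text \<open>The ratio of \<open>ln R\<close> to \<open>ln (sqrt R)\<close> is 2, so the bound is
  essentially \<open>ln 4 * ln 2\<close>, about 0.96. The margin up to 1.04 covers the term
  \<open>1 / ln A\<close> and the rounding of both endpoints.\<close>

lemma sum_inverse_smooth_primes_le:
  assumes R: "ln R \<ge> 40" "R > 0"
  shows "(\<Sum>p\<in>smooth_primes R. 1 / real p) \<le> 1.04"
proof -
  define L where "L = ln (sqrt R)"
  have L: "L \<ge> 20" "ln R = 2 * L" using R by (auto simp: L_def ln_sqrt)
  have s: "sqrt R = exp L" using R by (simp add: L_def)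
  \<comment> \<open>This makes \<open>sqrt R\<close> at least 1000, so that taking its floor lowers
    the logarithm by at most 0.0011.\<close>
  have "(1 + L / 4) ^ 4 \<le> exp (L / 4) ^ 4" using L by (intro power_mono) auto
  also have "\<dots> = sqrt R" by (simp add: s flip: exp_of_nat_mult)
  finally have "(1 + L / 4) ^ 4 \<le> sqrt R" .
  moreover have "(6::real) ^ 4 \<le> (1 + L / 4) ^ 4" using L by (intro power_mono) auto
  ultimately have big: "sqrt R \<ge> 1000" by simp
  define A where "A = nat \<lfloor>sqrt R\<rfloor>"
  define B where "B = nat \<lfloor>R\<rfloor>"
  have A: "real A \<ge> sqrt R - 1" "real A \<le> sqrt R"
    using big of_int_floor_le[of "sqrt R"] real_of_int_floor_add_one_gt[of "sqrt R"] unfolding A_def by linarith+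
  have RR: "R = sqrt R * sqrt R" using R by simp
  have R2: "R \<ge> 2 * sqrt R" using big mult_right_mono[of 2 "sqrt R" "sqrt R"] RR by linarith
  have B: "real B \<le> R" "real B > R - 1"
    using R of_int_floor_le[of R] real_of_int_floor_add_one_gt[of R] unfolding B_def by linarith+
  have AB: "A \<ge> 2" "A < B" using A B R2 big by linarith+
  have eq: "smooth_primes R = {p. prime p \<and> A < p \<and> p \<le> B}"
    using R by (auto simp: smooth_primes_def A_def B_def nat_less_iff le_nat_iff floor_less_iff le_floor_iff)
  have lnA: "ln (real A) \<ge> L - 0.0011"
  proof -
    have "exp L * (999 / 1000) \<le> real A" using A big unfolding s by linarith
    then have "ln (exp L * (999 / 1000)) \<le> ln (real A)" by (intro ln_mono) auto
    moreover have "ln (exp L * (999 / 1000)) = L + ln (999 / 1000)" by (subst ln_mult) auto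
    moreover have "ln (1 / (999 / 1000)) \<le> 1 / (999 / 1000) - (1::real)" by (intro ln_le_minus_one) auto
    moreover have "ln (1 / (999 / 1000)) = - ln (999 / 1000 :: real)" by (subst ln_div) auto
    ultimately show ?thesis by simp
  qed
  have lnB: "ln (real B) \<le> 2 * L" "ln (real B) > 0"
    using ln_mono[of "real B" R] B AB L by auto
  have "ln (real B) / ln (real A) \<le> 2 * L / (L - 0.0011)"
    using lnA lnB L by (intro frac_le) auto
  also have "\<dots> \<le> 2 * (10001 / 10000)" using L by (simp add: field_simps)
  finally have "ln (ln (real B) / ln (real A)) \<le> ln (2 * (10001 / 10000))"
    using lnA lnB L by (intro ln_mono) auto
  also have "\<dots> = ln 2 + ln (10001 / 10000)" by (rule ln_mult_pos) auto
  also have "ln (10001 / 10000 :: real) \<le> 10001 / 10000 - 1" by (intro ln_le_minus_one) auto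
  finally have 1: "ln (ln (real B) / ln (real A)) \<le> 25 / 36 + 0.0001" using ln2_le_25_over_36 by simp
  have "1 / ln (real A) \<le> 1 / 19.9" using lnA L by (intro divide_left_mono) auto
  then have 2: "1 / ln (real A) + ln (ln (real B) / ln (real A)) \<le> 1 / 19.9 + (25 / 36 + 0.0001)"
    using 1 by linarith
  have "ln (4::real) = 2 * ln 2" using ln_realpow[of 2 2] by simp
  then have 4: "ln (4::real) \<le> 25 / 18" "ln (4::real) \<ge> 0" using ln2_le_25_over_36 by auto
  have "(\<Sum>p\<in>smooth_primes R. 1 / real p) \<le> ln 4 * (1 / ln (real A) + ln (ln (real B) / ln (real A)))"
    unfolding eq by (rule sum_inverse_primes_le) (use AB in auto)
  also have "\<dots> \<le> ln 4 * (1 / 19.9 + (25 / 36 + 0.0001))" using 2 4 by (intro mult_left_mono) auto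
  also have "\<dots> \<le> 25 / 18 * (1 / 19.9 + (25 / 36 + 0.0001))" using 4 by (intro mult_right_mono) auto
  finally show ?thesis by simp
qed

text \<open>For \<open>u <= 1/200\<close> one has \<open>1 / (1 - u) <= exp (200 * u / 199)\<close>,
  and \<open>1.04 * 200 / 199 < 1.05\<close>; the hypothesis on \<open>\<rho>\<close> makes every
  \<open>\<rho> / p\<close> that small.\<close>

lemma prod_smooth_primes_le:
  assumes R: "ln R \<ge> 40" "R > 0" and \<rho>: "0 < \<rho>" "200 * \<rho> \<le> sqrt R"
  shows "\<And>p. p \<in> smooth_primes R \<Longrightarrow> \<rho> / real p < 1"
    and "(\<Prod>p\<in>smooth_primes R. 1 / (1 - \<rho> / real p)) \<le> exp (1.05 * \<rho>)"
proof -
  have p: "real p > 0" "\<rho> / real p \<le> 1 / 200" if "p \<in> smooth_primes R" for p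
  proof -
    show "real p > 0" using that prime_gt_0_nat by (auto simp: smooth_primes_def)
    have "200 * \<rho> \<le> real p" using that \<rho> by (auto simp: smooth_primes_def)
    then show "\<rho> / real p \<le> 1 / 200" using \<open>real p > 0\<close> by (simp add: field_simps)
  qed
  show "\<rho> / real p < 1" if "p \<in> smooth_primes R" for p using p[OF that] by linarith
  have "(\<Prod>p\<in>smooth_primes R. 1 / (1 - \<rho> / real p)) \<le> (\<Prod>p\<in>smooth_primes R. exp (\<rho> * 200 / 199 * (1 / real p)))"
  proof (rule prod_mono, safe)
    fix q assume q: "q \<in> smooth_primes R"
    define u where "u = \<rho> / real q"
    have u: "0 < u" "u \<le> 1 / 200" using p[OF q] \<rho> by (auto simp: u_def)
    have "0 \<le> 1 / (1 - u)" using u by simp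
    then show "0 \<le> 1 / (1 - \<rho> / real q)" by (simp add: u_def)
    have "1 / (1 - u) \<le> 1 + u * 200 / 199" using u by (simp add: field_simps)
    also have "\<dots> \<le> exp (u * 200 / 199)" by (rule exp_ge_add_one_self)
    finally show "1 / (1 - \<rho> / real q) \<le> exp (\<rho> * 200 / 199 * (1 / real q))" by (simp add: u_def mult_ac)
  qed
  also have "\<dots> = exp (\<rho> * 200 / 199 * (\<Sum>p\<in>smooth_primes R. 1 / real p))"
    by (simp only: sum_distrib_left exp_sum[OF finite_smooth_primes])
  also have "\<dots> \<le> exp (1.05 * \<rho>)"
  proof -
    have "\<rho> * 200 / 199 * (\<Sum>p\<in>smooth_primes R. 1 / real p) \<le> \<rho> * 200 / 199 * 1.04"
      using \<rho> by (intro mult_left_mono sum_inverse_smooth_primes_le R) auto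
    also have "\<dots> \<le> 1.05 * \<rho>" using \<rho> by simp
    finally show ?thesis by simp
  qed
  finally show "(\<Prod>p\<in>smooth_primes R. 1 / (1 - \<rho> / real p)) \<le> exp (1.05 * \<rho>)" .
qed

abbreviation bigomega :: "nat \<Rightarrow> nat" where
  "bigomega n \<equiv> size (prime_factorization n)"

lemma bigomega_mult: "a > 0 \<Longrightarrow> b > 0 \<Longrightarrow> bigomega (a * b) = bigomega a + bigomega b"
  by (simp add: prime_factorization_mult)

lemma power_bigomega_le:
  assumes "n > 0" "r \<ge> 0" "\<And>p. p \<in> prime_factors n \<Longrightarrow> r \<le> real p"
  shows "r ^ bigomega n \<le> real n"
proof -
  have "r ^ size M \<le> real (\<Prod>\<^sub># M)" if "\<And>p. p \<in># M \<Longrightarrow> r \<le> real p" for M :: "nat multiset"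
    using that
  proof (induction M)
    case (add x M)
    then show ?case using assms(2) by (auto intro!: mult_mono)
  qed simp
  from this[of "prime_factorization n"] show ?thesis
    using assms by (simp add: prod_mset_prime_factorization_nat)
qed

lemma le_power_bigomega:
  assumes "n > 0" "\<And>p. p \<in> prime_factors n \<Longrightarrow> real p \<le> r"
  shows "real n \<le> r ^ bigomega n"
proof -
  have "real (\<Prod>\<^sub># M) \<le> r ^ size M" if "\<And>p. p \<in># M \<Longrightarrow> real p \<le> r" for M :: "nat multiset"
    using that
  proof (induction M)
    case (add x M)
    then have "real x \<le> r" "real (\<Prod>\<^sub># M) \<le> r ^ size M" by auto
    then show ?case using order_trans[OF of_nat_0_le_iff \<open>real x \<le> r\<close>] by (auto intro!: mult_mono)
  qed simp
  from this[of "prime_factorization n"] show ?thesis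
    using assms by (simp add: prod_mset_prime_factorization_nat)
qed

text \<open>Rankin's trick, with weight \<open>\<rho>\<close> for each prime factor.\<close>

lemma card_smooth_set_le:
  assumes R: "ln R \<ge> 40" "R > 0" and y: "1.05 \<le> y" "200 * y \<le> sqrt R"
  shows "real (card (smooth_set (R powr y) R)) \<le> R powr y * (2.86 / y) powr y"
proof -
  define C where "C = smooth_set (R powr y) R"
  \<comment> \<open>This value minimises \<open>exp (1.05 * \<rho>) / \<rho> powr y\<close>. The
    minimum is \<open>(1.05 * e / y) powr y\<close>, and \<open>1.05 * 2.72 < 2.86\<close>.\<close>
  define \<rho> where "\<rho> = y / 1.05"
  define g where "g x = \<rho> ^ bigomega x / real x" for x
  have \<rho>: "\<rho> \<ge> 1" "\<rho> \<le> y" using y by (auto simp: \<rho>_def)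
  have R1: "R > 1" using R ln_le_zero_iff[of R] by linarith
  have sR: "sqrt R \<ge> 1" using R1 by simp
  have "sqrt R * 1 \<le> sqrt R * sqrt R" using sR by (intro mult_left_mono) auto
  then have "\<rho> \<le> R" using y \<rho> R1 by simp
  have fin: "finite C" unfolding C_def by (rule finite_smooth_set)
  have pr: "(\<Prod>p\<in>smooth_primes R. 1 / (1 - g p)) \<le> exp (1.05 * \<rho>)" and lt: "\<And>p. p \<in> smooth_primes R \<Longrightarrow> g p < 1"
  proof -
    have gp: "g p = \<rho> / real p" if "p \<in> smooth_primes R" for p
      using that by (simp add: g_def smooth_primes_def prime_factorization_prime)
    have "200 * \<rho> \<le> sqrt R" "0 < \<rho>" using \<rho> y by auto
    note * = prod_smooth_primes_le[OF R this(2,1)]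
    show "(\<Prod>p\<in>smooth_primes R. 1 / (1 - g p)) \<le> exp (1.05 * \<rho>)" using *(2) by (simp add: gp cong: prod.cong)
    show "\<And>p. p \<in> smooth_primes R \<Longrightarrow> g p < 1" using *(1) by (simp add: gp)
  qed
  \<comment> \<open>With at least \<open>y\<close> prime factors this is clear from
    \<open>\<rho> >= 1\<close>. With \<open>w < y\<close> of them, \<open>x\<close> is at most
    \<open>R ^ w\<close>, and \<open>\<rho> <= R\<close> compensates for the missing
    factors.\<close>
  have lower: "\<rho> powr y / R powr y \<le> g x" if "x \<in> C" for x
  proof -
    have x: "x > 0" "real x \<le> R powr y" "prime_factors x \<subseteq> smooth_primes R"
      using that by (auto simp: C_def smooth_set_iff)
    define w where "w = bigomega x"
    show ?thesis
    proof (cases "real w \<ge> y")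
      case True
      then have "\<rho> powr y \<le> \<rho> powr real w" using \<rho> by (intro powr_mono) auto
      then show ?thesis unfolding g_def w_def [symmetric] using x \<rho> by (intro frac_le) (auto simp: powr_realpow)
    next
      case False
      have xw: "real x \<le> R powr real w"
        using le_power_bigomega[of x R] x R1 by (auto simp: w_def powr_realpow smooth_primes_def)
      have "\<rho> powr (y - real w) \<le> R powr (y - real w)" using False \<rho> \<open>\<rho> \<le> R\<close> by (intro powr_mono2) auto
      then have "\<rho> powr y * R powr real w \<le> R powr y * \<rho> powr real w"
        using \<rho> R1 by (simp add: powr_diff field_simps)
      moreover have "\<rho> powr y * real x \<le> \<rho> powr y * R powr real w" using xw by (intro mult_left_mono) auto
      ultimately have "\<rho> powr y * real x \<le> R powr y * \<rho> powr real w" by linarith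
      then show ?thesis using x \<rho> R1 by (simp add: g_def w_def [symmetric] powr_realpow field_simps)
    qed
  qed
  have "real (card C) * (\<rho> powr y / R powr y) \<le> (\<Sum>x\<in>C. g x)"
    using sum_mono[of C "\<lambda>_. \<rho> powr y / R powr y" g] lower by simp
  also have "\<dots> \<le> (\<Prod>p\<in>smooth_primes R. 1 / (1 - g p))"
  proof (rule sum_le_euler_product)
    show "finite (smooth_primes R)" by (rule finite_smooth_primes)
    show "g (a * b) = g a * g b" if "a > 0" "b > 0" for a b
      using that by (simp add: g_def bigomega_mult power_add)
  qed (use \<rho> lt fin in \<open>auto simp: g_def C_def smooth_set_iff smooth_primes_def\<close>)
  also note pr
  also have "exp (1.05 * \<rho>) = exp 1 powr y" by (simp add: \<rho>_def powr_def)
  finally have "real (card C) \<le> R powr y * (exp 1 powr y / \<rho> powr y)"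
    using R1 \<rho> by (simp add: field_simps)
  also have "exp 1 powr y / \<rho> powr y = (exp 1 / \<rho>) powr y" using \<rho> by (simp add: powr_divide)
  also have "\<dots> \<le> (2.86 / y) powr y"
    using e_less_272 y by (intro powr_mono2) (auto simp: \<rho>_def field_simps)
  finally show ?thesis unfolding C_def using R1 by (simp add: mult_left_mono)
qed

text \<open>The case \<open>\<rho> = 1\<close> of the Euler product, which will bound the sum over
  moduli independently of their size and number.\<close>

lemma sum_inverse_smooth_le:
  assumes R: "ln R \<ge> 40" "R > 0" "200 \<le> sqrt R"
    and F: "finite F" "\<And>m. m \<in> F \<Longrightarrow> m > 0 \<and> prime_factors m \<subseteq> smooth_primes R"
  shows "(\<Sum>m\<in>F. 1 / real m) \<le> exp 1.05"
proof -
  have "(\<Sum>m\<in>F. 1 / real m) \<le> (\<Prod>p\<in>smooth_primes R. 1 / (1 - 1 / real p))"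
    by (rule sum_le_euler_product[OF finite_smooth_primes])
       (use F prod_smooth_primes_le(1)[of R 1] R in \<open>auto simp: smooth_primes_def\<close>)
  also have "\<dots> \<le> exp 1.05" using prod_smooth_primes_le(2)[of R 1] R by simp
  finally show ?thesis .
qed

text \<open>Rankin's trick with weight \<open>\<xi>\<close> for each prime factor: since the primes
  are at least \<open>sqrt R\<close>, a number up to \<open>R powr y\<close> has at most
  \<open>2 * y\<close> of them and so weighs at least \<open>\<xi> powr (2 * y)\<close>.\<close>

lemma card_supported_le:
  assumes R: "R > 1" and \<xi>: "0 < \<xi>" "\<xi> < 1"
    and S: "finite S" "\<And>p. p \<in> S \<Longrightarrow> prime p \<and> sqrt R \<le> real p"
  shows "real (card {a. 0 < a \<and> real a \<le> R powr y \<and> prime_factors a \<subseteq> S})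
     \<le> \<xi> powr (- 2 * y) * (1 / (1 - \<xi>)) ^ card S"
proof -
  define F where "F = {a. 0 < a \<and> real a \<le> R powr y \<and> prime_factors a \<subseteq> S}"
  have fin: "finite F"
    by (rule finite_subset[of _ "{..nat \<lfloor>R powr y\<rfloor>}"]) (auto simp: F_def le_nat_floor)
  have "\<xi> powr (2 * y) \<le> \<xi> ^ bigomega a" if "a \<in> F" for a
  proof -
    have a: "a > 0" "real a \<le> R powr y" "prime_factors a \<subseteq> S" using that by (auto simp: F_def)
    have "sqrt R ^ bigomega a \<le> real a" using a S R by (intro power_bigomega_le) auto
    also have "sqrt R ^ bigomega a = R powr (bigomega a / 2)"
      using R by (simp add: powr_half_sqrt [symmetric] powr_realpow [symmetric] powr_powr)
    finally have "R powr (bigomega a / 2) \<le> R powr y" using a by linarith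
    then have "bigomega a / 2 \<le> y" using R by simp
    then have "\<xi> powr (2 * y) \<le> \<xi> powr bigomega a" using \<xi> by (intro powr_mono') auto
    then show ?thesis using \<xi> by (simp add: powr_realpow)
  qed
  then have "real (card F) * \<xi> powr (2 * y) \<le> (\<Sum>a\<in>F. \<xi> ^ bigomega a)"
    using sum_mono[of F "\<lambda>_. \<xi> powr (2 * y)" "\<lambda>a. \<xi> ^ bigomega a"] by simp
  also have "\<dots> \<le> (\<Prod>p\<in>S. 1 / (1 - \<xi> ^ bigomega p))"
    by (rule sum_le_euler_product)
       (use S \<xi> fin in \<open>auto simp: F_def bigomega_mult power_add prime_factorization_prime\<close>)
  also have "\<dots> = (\<Prod>p\<in>S. 1 / (1 - \<xi>))"
    using S by (intro prod.cong) (auto simp: prime_factorization_prime)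
  also have "\<dots> = (1 / (1 - \<xi>)) ^ card S" by simp
  finally show ?thesis using \<xi> by (simp add: F_def powr_minus field_simps)
qed

lemma card_large_prime_divisors_le:
  assumes R: "R > 1" and n: "0 < n" "real n \<le> R powr y"
    and S: "finite S" "\<And>p. p \<in> S \<Longrightarrow> prime p \<and> sqrt R \<le> real p \<and> p dvd n"
  shows "real (card S) \<le> 2 * y"
proof -
  have "sqrt R ^ card S = (\<Prod>p\<in>S. sqrt R)" by simp
  also have "\<dots> \<le> (\<Prod>p\<in>S. real p)" using S R by (intro prod_mono) auto
  also have "\<dots> = real (\<Prod>S)" by simp
  also have "\<dots> \<le> real n"
    using prod_primes_dvd[of S n] S n by (intro of_nat_mono dvd_imp_le) auto
  also have "\<dots> \<le> R powr y" by fact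
  also have "sqrt R ^ card S = R powr (card S / 2)"
    using R by (simp add: powr_half_sqrt [symmetric] powr_realpow [symmetric] powr_powr)
  finally show ?thesis using R by simp
qed

section \<open>Energies and exponential sums\<close>

text \<open>The second moment of the fibre sizes of \<open>V\<close> on \<open>S\<close>. Arbitrary
  index and value types allow the variables of a system to be split and recombined.\<close>

definition energy :: "'a set \<Rightarrow> ('a \<Rightarrow> 'c) \<Rightarrow> nat" where
  "energy S V = card {(u, w). u \<in> S \<and> w \<in> S \<and> V u = V w}"

lemma finite_energy_set: "finite S \<Longrightarrow> finite {(u, w). u \<in> S \<and> w \<in> S \<and> P u w}"
  by (rule finite_subset[of _ "S \<times> S"]) auto

lemma energy_mono: "S \<subseteq> T \<Longrightarrow> finite T \<Longrightarrow> energy S V \<le> energy T V"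
  unfolding energy_def by (intro card_mono finite_energy_set) auto

lemma card_pairs_eq_sum:
  assumes "finite S" "finite S'" "finite T" "V ` S \<subseteq> T"
  shows "card {(u, w). u \<in> S \<and> w \<in> S' \<and> V u = U w} = (\<Sum>c\<in>T. card {u\<in>S. V u = c} * card {w\<in>S'. U w = c})"
proof -
  have "{(u, w). u \<in> S \<and> w \<in> S' \<and> V u = U w} = (\<Union>c\<in>T. {u\<in>S. V u = c} \<times> {w\<in>S'. U w = c})"
    using assms by auto
  then have "card {(u, w). u \<in> S \<and> w \<in> S' \<and> V u = U w} = card (\<Union>c\<in>T. {u\<in>S. V u = c} \<times> {w\<in>S'. U w = c})"
    by simp
  also have "\<dots> = (\<Sum>c\<in>T. card ({u\<in>S. V u = c} \<times> {w\<in>S'. U w = c}))"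
    using assms by (intro card_UN_disjoint) auto
  finally show ?thesis by (simp add: card_cartesian_product)
qed

lemma energy_eq_sum:
  assumes "finite S" "finite T" "V ` S \<subseteq> T"
  shows "real (energy S V) = (\<Sum>c\<in>T. (real (card {u\<in>S. V u = c}))\<^sup>2)"
  unfolding energy_def card_pairs_eq_sum[OF assms(1,1,2,3)] by (simp add: power2_eq_square)

text \<open>Cauchy's inequality on each fibre, with weights that can be adapted to the sizes of the
  pieces.\<close>

lemma energy_UN_le:
  assumes "finite I" "\<And>i. i \<in> I \<Longrightarrow> finite (A i)" "S \<subseteq> (\<Union>i\<in>I. A i)" "\<And>i. i \<in> I \<Longrightarrow> w i > (0::real)"
  shows "real (energy S V) \<le> (\<Sum>i\<in>I. w i) * (\<Sum>i\<in>I. real (energy (A i) V) / w i)"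
proof -
  define T where "T = V ` (\<Union>i\<in>I. A i)"
  define r where "r i c = real (card {u\<in>A i. V u = c})" for i c
  have fin: "finite T" "finite S" using assms by (auto simp: T_def intro: finite_subset)
  have "real (energy S V) = (\<Sum>c\<in>T. (real (card {u\<in>S. V u = c}))\<^sup>2)"
    using assms fin by (intro energy_eq_sum) (auto simp: T_def)
  also have "\<dots> \<le> (\<Sum>c\<in>T. (\<Sum>i\<in>I. w i) * (\<Sum>i\<in>I. (r i c)\<^sup>2 / w i))"
  proof (rule sum_mono)
    fix c
    have "card {u\<in>S. V u = c} \<le> card (\<Union>i\<in>I. {u\<in>A i. V u = c})"
      using assms by (intro card_mono) auto
    also have "\<dots> \<le> (\<Sum>i\<in>I. card {u\<in>A i. V u = c})" using assms by (intro card_UN_le)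
    finally have "real (card {u\<in>S. V u = c}) \<le> (\<Sum>i\<in>I. r i c)"
      unfolding r_def of_nat_sum [symmetric] of_nat_le_iff .
    also have "\<dots> = (\<Sum>i\<in>I. sqrt (w i) * (r i c / sqrt (w i)))"
      using assms(4) by (intro sum.cong) (auto simp: less_imp_neq[symmetric])
    finally have "(real (card {u\<in>S. V u = c}))\<^sup>2 \<le> (\<Sum>i\<in>I. sqrt (w i) * (r i c / sqrt (w i)))\<^sup>2"
      by (intro power_mono) auto
    also have "\<dots> \<le> (\<Sum>i\<in>I. (sqrt (w i))\<^sup>2) * (\<Sum>i\<in>I. (r i c / sqrt (w i))\<^sup>2)"
      by (rule Cauchy_Schwarz_ineq_sum)
    also have "\<dots> = (\<Sum>i\<in>I. w i) * (\<Sum>i\<in>I. (r i c)\<^sup>2 / w i)"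
      using assms(4) by (intro arg_cong2[where f = "(*)"] sum.cong) (auto simp: power_divide less_imp_le)
    finally show "(real (card {u\<in>S. V u = c}))\<^sup>2 \<le> (\<Sum>i\<in>I. w i) * (\<Sum>i\<in>I. (r i c)\<^sup>2 / w i)" .
  qed
  also have "\<dots> = (\<Sum>i\<in>I. w i) * (\<Sum>i\<in>I. (\<Sum>c\<in>T. (r i c)\<^sup>2) / w i)"
    by (subst sum_distrib_left [symmetric], subst sum.swap) (simp add: sum_divide_distrib)
  also have "\<dots> = (\<Sum>i\<in>I. w i) * (\<Sum>i\<in>I. real (energy (A i) V) / w i)"
  proof (intro arg_cong2[where f = "(*)"] sum.cong refl)
    fix i assume "i \<in> I"
    then have "real (energy (A i) V) = (\<Sum>c\<in>T. (r i c)\<^sup>2)"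
      unfolding r_def using assms fin by (intro energy_eq_sum) (auto simp: T_def)
    then show "(\<Sum>c\<in>T. (r i c)\<^sup>2) / w i = real (energy (A i) V) / w i" by simp
  qed
  finally show ?thesis .
qed

lemma energy_UN_le_card:
  assumes "finite I" "\<And>i. i \<in> I \<Longrightarrow> finite (A i)" "S \<subseteq> (\<Union>i\<in>I. A i)"
  shows "real (energy S V) \<le> real (card I) * (\<Sum>i\<in>I. real (energy (A i) V))"
  using energy_UN_le[OF assms, of "\<lambda>_. 1" V] by simp

text \<open>In the application \<open>U\<close> is a translate of \<open>V\<close>, so both have the
  same level sets. The inequality \<open>2 a b <= a^2 + b^2\<close> for fibre sizes shows that an
  inhomogeneous system has no more solutions than the homogeneous one.\<close>

lemma card_shifted_pairs_le_energy:
  fixes V U :: "'a \<Rightarrow> 'c"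
  assumes S: "finite S" and inj: "\<And>u w. U u = U w \<longleftrightarrow> V u = V w"
  shows "card {(u, w). u \<in> S \<and> w \<in> S \<and> V u = U w} \<le> energy S V"
proof -
  define T where "T = V ` S \<union> U ` S"
  define r where "r X c = real (card {u\<in>S. X u = c})" for X :: "'a \<Rightarrow> 'c" and c
  have T: "finite T" using S by (simp add: T_def)
  have "energy S U = energy S V" by (simp add: energy_def inj)
  then have 1: "real (energy S V) = (\<Sum>c\<in>T. (r V c)\<^sup>2)" "real (energy S V) = (\<Sum>c\<in>T. (r U c)\<^sup>2)"
    using energy_eq_sum[OF S T, of V] energy_eq_sum[OF S T, of U] unfolding r_def by (auto simp: T_def)
  have "real (card {(u, w). u \<in> S \<and> w \<in> S \<and> V u = U w}) = (\<Sum>c\<in>T. r V c * r U c)"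
    using card_pairs_eq_sum[OF S S T, of V U] unfolding r_def by (simp add: T_def)
  also have "\<dots> \<le> (\<Sum>c\<in>T. ((r V c)\<^sup>2 + (r U c)\<^sup>2) / 2)"
  proof (rule sum_mono)
    fix c
    show "r V c * r U c \<le> ((r V c)\<^sup>2 + (r U c)\<^sup>2) / 2"
      using sum_squares_bound[of "r V c" "r U c"] by simp
  qed
  also have "\<dots> = real (energy S V)" using 1 by (simp add: sum.distrib flip: sum_divide_distrib)
  finally show ?thesis by simp
qed

section \<open>Finite Fourier analysis\<close>

definition chi :: "nat set \<Rightarrow> nat \<Rightarrow> (nat \<Rightarrow> nat) \<Rightarrow> (nat \<Rightarrow> int) \<Rightarrow> complex" where
  "chi K N a v = (\<Prod>j\<in>K. cis (2 * pi * real (a j) * real_of_int (v j) / real N))"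

lemma chi_add: "chi K N a (\<lambda>j. u j + v j) = chi K N a u * chi K N a v"
  unfolding chi_def by (simp add: prod.distrib [symmetric] cis_mult add_divide_distrib ring_distribs)

lemma chi_minus: "chi K N a (\<lambda>j. u j - v j) = chi K N a u * cnj (chi K N a v)"
  unfolding chi_def
  by (simp add: prod.distrib [symmetric] cis_mult cis_cnj diff_divide_distrib ring_distribs)

lemma chi_sum:
  "finite I \<Longrightarrow> chi K N a (\<lambda>j. \<Sum>i\<in>I. v i j) = (\<Prod>i\<in>I. chi K N a (v i))"
proof (induction I rule: finite_induct)
  case empty
  show ?case by (simp add: chi_def)
qed (simp add: chi_add)

lemma sum_roots_of_unity:
  fixes v :: int
  assumes "\<bar>v\<bar> < int N"
  shows "(\<Sum>a<N. cis (2 * pi * real a * real_of_int v / real N)) = (if v = 0 then of_nat N else 0)"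
proof (cases "v = 0")
  case False
  define z where "z = cis (2 * pi * real_of_int v / real N)"
  have N: "real N > 0" using assms False by linarith
  have "z \<noteq> 1"
  proof
    assume "z = 1"
    then have "cos (2 * pi * real_of_int v / real N) = 1" by (simp add: z_def complex_eq_iff)
    then obtain n :: int where "2 * pi * real_of_int v / real N = of_int n * 2 * pi"
      using cos_one_2pi_int by auto
    then have "real_of_int v = of_int n * real N" using N by (simp add: field_simps)
    then have "v = n * int N" by (metis of_int_eq_iff of_int_mult of_int_of_nat_eq)
    then have "int N dvd v" by simp
    then show False using False assms zdvd_imp_le[of "int N" "\<bar>v\<bar>"] by auto
  qed
  have "z ^ N = cis (of_int v * (2 * pi))" using N by (simp add: z_def Complex.DeMoivre mult_ac)
  also have "\<dots> = 1"
    using cos_int_2pin[of v] sin_int_2pin[of v] by (simp add: complex_eq_iff mult_ac)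
  finally have "(\<Sum>a<N. z ^ a) = 0" using \<open>z \<noteq> 1\<close> by (simp add: geometric_sum)
  then show ?thesis using False by (simp add: z_def Complex.DeMoivre mult_ac)
qed (use assms in auto)

text \<open>The frequencies of the group of vectors modulo \<open>N\<close>. Taking \<open>N\<close>
  large replaces integration over a torus by a finite average, free of wrap-around.\<close>

definition freqs :: "nat set \<Rightarrow> nat \<Rightarrow> (nat \<Rightarrow> nat) set" where
  "freqs K N = K \<rightarrow>\<^sub>E {..<N}"

lemma sum_chi:
  assumes "finite K" "\<And>j. j \<in> K \<Longrightarrow> \<bar>v j\<bar> < int N"
  shows "(\<Sum>a\<in>freqs K N. chi K N a v) = (if \<forall>j\<in>K. v j = 0 then of_nat (N ^ card K) else 0)"
proof -
  have "(\<Sum>a\<in>freqs K N. chi K N a v)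
     = (\<Prod>j\<in>K. \<Sum>b<N. cis (2 * pi * real b * real_of_int (v j) / real N))"
    unfolding freqs_def chi_def using assms(1) by (subst prod_sum_PiE) auto
  also have "\<dots> = (\<Prod>j\<in>K. if v j = 0 then of_nat N else 0)"
    using assms by (intro prod.cong sum_roots_of_unity) auto
  also have "\<dots> = (if \<forall>j\<in>K. v j = 0 then of_nat (N ^ card K) else 0)"
    using assms(1) by auto
  finally show ?thesis .
qed

definition char_sum :: "nat set \<Rightarrow> nat \<Rightarrow> (nat \<Rightarrow> nat) \<Rightarrow> 'a set \<Rightarrow> ('a \<Rightarrow> nat \<Rightarrow> int) \<Rightarrow> complex" where
  "char_sum K N a S V = (\<Sum>u\<in>S. chi K N a (V u))"

text \<open>Under this normalisation, agreement on the degrees in \<open>K\<close> is equality of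
  functions, as \<open>energy\<close> requires.\<close>

definition vanish_off :: "nat set \<Rightarrow> ('a \<Rightarrow> nat \<Rightarrow> int) \<Rightarrow> bool" where
  "vanish_off K V \<longleftrightarrow> (\<forall>u j. j \<notin> K \<longrightarrow> V u j = 0)"

lemma parseval:
  assumes K: "finite K" and S: "finite S" and V: "vanish_off K V"
  shows "\<forall>\<^sub>F N in sequentially.
     (\<Sum>a\<in>freqs K N. (cmod (char_sum K N a S V))\<^sup>2) = real N ^ card K * real (energy S V)"
proof -
  \<comment> \<open>A bound for all differences of values: for \<open>N > B\<close>, a difference
    divisible by \<open>N\<close> is zero. Inserting 0 keeps \<open>Max\<close> meaningful for empty
    sets.\<close>
  define B where "B = Max (insert 0 ((\<lambda>(u, w, j). nat \<bar>V u j - V w j\<bar>) ` (S \<times> S \<times> K)))"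
  have B: "nat \<bar>V u j - V w j\<bar> \<le> B" if "u \<in> S" "w \<in> S" "j \<in> K" for u w j
    unfolding B_def using that S K by (intro Max_ge) (auto intro!: image_eqI[of _ _ "(u, w, j)"])
  have "(\<Sum>a\<in>freqs K N. (cmod (char_sum K N a S V))\<^sup>2) = real N ^ card K * real (energy S V)"
    if N: "N > B" for N
  proof -
    have "complex_of_real (\<Sum>a\<in>freqs K N. (cmod (char_sum K N a S V))\<^sup>2)
       = (\<Sum>a\<in>freqs K N. char_sum K N a S V * cnj (char_sum K N a S V))"
      unfolding of_real_sum by (simp only: complex_norm_square)
    also have "\<dots> = (\<Sum>a\<in>freqs K N. \<Sum>u\<in>S. \<Sum>w\<in>S. chi K N a (\<lambda>j. V u j - V w j))"
      unfolding char_sum_def chi_minus by (simp add: sum_product)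
    also have "\<dots> = (\<Sum>u\<in>S. \<Sum>w\<in>S. \<Sum>a\<in>freqs K N. chi K N a (\<lambda>j. V u j - V w j))"
      by (subst sum.swap, rule sum.cong[OF refl], subst sum.swap) simp
    also have "\<dots> = (\<Sum>u\<in>S. \<Sum>w\<in>S. if V u = V w then of_nat (N ^ card K) else 0)"
    proof (intro sum.cong refl)
      fix u w assume uw: "u \<in> S" "w \<in> S"
      have "(\<Sum>a\<in>freqs K N. chi K N a (\<lambda>j. V u j - V w j))
          = (if \<forall>j\<in>K. V u j - V w j = 0 then of_nat (N ^ card K) else 0)"
        using B[OF uw] N by (intro sum_chi K) fastforce
      also have "(\<forall>j\<in>K. V u j - V w j = 0) \<longleftrightarrow> V u = V w"
        using V unfolding vanish_off_def by (auto simp: fun_eq_iff)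
      finally show "(\<Sum>a\<in>freqs K N. chi K N a (\<lambda>j. V u j - V w j)) = (if V u = V w then of_nat (N ^ card K) else 0)" .
    qed
    also have "\<dots> = (\<Sum>x\<in>S \<times> S. if V (fst x) = V (snd x) then of_nat (N ^ card K) else 0)"
      by (simp add: sum.cartesian_product case_prod_beta)
    also have "\<dots> = (\<Sum>x\<in>{x\<in>S \<times> S. V (fst x) = V (snd x)}. of_nat (N ^ card K))"
      using S by (intro sum.inter_filter [symmetric]) auto
    also have "\<dots> = of_nat (energy S V) * of_nat (N ^ card K)"
    proof -
      have "{x\<in>S \<times> S. V (fst x) = V (snd x)} = {(u, w). u \<in> S \<and> w \<in> S \<and> V u = V w}" by auto
      then show ?thesis by (simp add: energy_def)
    qed
    also have "\<dots> = complex_of_real (real N ^ card K * real (energy S V))" by simp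
    finally show ?thesis using of_real_eq_iff by blast
  qed
  then show ?thesis using eventually_gt_at_top[of B] by (rule eventually_mono[rotated]) auto
qed


section \<open>Power sums and moments of exponential sums\<close>

definition power_vec :: "nat set \<Rightarrow> nat \<Rightarrow> nat \<Rightarrow> int" where
  "power_vec K x = (\<lambda>j. if j \<in> K then int x ^ j else 0)"

definition psum :: "nat set \<Rightarrow> 'i set \<Rightarrow> ('i \<Rightarrow> nat) \<Rightarrow> nat \<Rightarrow> int" where
  "psum K I x = (\<lambda>j. if j \<in> K then \<Sum>i\<in>I. int (x i) ^ j else 0)"

definition pair_sum :: "('a \<Rightarrow> nat \<Rightarrow> int) \<Rightarrow> ('b \<Rightarrow> nat \<Rightarrow> int) \<Rightarrow> 'a \<times> 'b \<Rightarrow> nat \<Rightarrow> int" where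
  "pair_sum V W = (\<lambda>u j. V (fst u) j + W (snd u) j)"

lemma vanish_off_psum: "vanish_off K (psum K I)"
  and vanish_off_pair_sum: "vanish_off K V \<Longrightarrow> vanish_off K W \<Longrightarrow> vanish_off K (pair_sum V W)"
  by (auto simp: vanish_off_def psum_def pair_sum_def)

lemma char_sum_psum:
  assumes "finite I" "\<And>i. i \<in> I \<Longrightarrow> finite (B i)"
  shows "char_sum K N a (Pi\<^sub>E I B) (psum K I) = (\<Prod>i\<in>I. char_sum K N a (B i) (power_vec K))"
proof -
  have "psum K I x = (\<lambda>j. \<Sum>i\<in>I. power_vec K (x i) j)" for x
    by (auto simp: psum_def power_vec_def fun_eq_iff)
  then show ?thesis
    using assms unfolding char_sum_def by (simp add: chi_sum prod_sum_PiE)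
qed

lemma char_sum_pair_sum:
  "char_sum K N a (S \<times> T) (pair_sum V W) = char_sum K N a S V * char_sum K N a T W"
  by (simp add: char_sum_def pair_sum_def chi_add sum_product sum.cartesian_product case_prod_beta)

lemma J_eq_energy: "J s k h B = energy ({1..s} \<rightarrow>\<^sub>E B) (psum {h..k} {1..s})"
proof -
  have "(\<forall>j\<in>{h..k}. (\<Sum>i=1..s. int (x i) ^ j - int (y i) ^ j) = 0)
      \<longleftrightarrow> psum {h..k} {1..s} x = psum {h..k} {1..s} y" for x y
    by (auto simp: psum_def fun_eq_iff sum_subtractf)
  then show ?thesis unfolding J_def energy_def by simp
qed

lemma J_moment:
  assumes "finite B"
  shows "\<forall>\<^sub>F N in sequentially.
     (\<Sum>a\<in>freqs {h..k} N. cmod (char_sum {h..k} N a B (power_vec {h..k})) ^ (2 * s))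
        = real N ^ card {h..k} * real (J s k h B)"
proof -
  have "finite ({1..s} \<rightarrow>\<^sub>E B)" using assms by (intro finite_PiE) auto
  from parseval[OF finite_atLeastAtMost this vanish_off_psum[where I = "{1..s}"], of h k]
  show ?thesis unfolding J_eq_energy
    by eventually_elim (use assms in \<open>simp add: char_sum_psum norm_power power_mult [symmetric] mult.commute\<close>)
qed

lemma eventually_scaled_eq_imp:
  assumes "\<forall>\<^sub>F N in sequentially. f N = real N ^ d * x" "\<forall>\<^sub>F N in sequentially. f N = real N ^ d * y"
  shows "x = y"
proof -
  have "\<forall>\<^sub>F N in sequentially. x = y"
    using assms eventually_gt_at_top[of 0] by eventually_elim auto
  then show ?thesis by simp
qed

text \<open>Both sides are the same even moment of one exponential sum, so only the total number of
  variables matters.\<close>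

lemma energy_pair_eq_J:
  assumes "finite B" "finite I" "finite I'"
  shows "energy ((I \<rightarrow>\<^sub>E B) \<times> (I' \<rightarrow>\<^sub>E B)) (pair_sum (psum {h..k} I) (psum {h..k} I')) = J (card I + card I') k h B"
proof -
  have "finite ((I \<rightarrow>\<^sub>E B) \<times> (I' \<rightarrow>\<^sub>E B))" using assms by (intro finite_cartesian_product finite_PiE) auto
  note * = parseval[OF finite_atLeastAtMost this vanish_off_pair_sum[OF vanish_off_psum[where I = I] vanish_off_psum[where I = I']], of h k]
  have "\<forall>\<^sub>F N in sequentially.
     (\<Sum>a\<in>freqs {h..k} N. cmod (char_sum {h..k} N a B (power_vec {h..k})) ^ (2 * (card I + card I')))
        = real N ^ card {h..k} * real (energy ((I \<rightarrow>\<^sub>E B) \<times> (I' \<rightarrow>\<^sub>E B)) (pair_sum (psum {h..k} I) (psum {h..k} I')))"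
    using *
    by eventually_elim (use assms in \<open>simp add: char_sum_pair_sum char_sum_psum norm_mult norm_power power_mult_distrib
        power_mult [symmetric] power_add [symmetric] mult.commute distrib_left\<close>)
  from eventually_scaled_eq_imp[OF this J_moment[OF assms(1)]] show ?thesis by simp
qed

text \<open>Cauchy's inequality for the moments, splitting \<open>f ^ (2 * Suc i)\<close> as
  \<open>f ^ i * f ^ (i + 2)\<close>.\<close>

lemma J_log_convex:
  assumes "finite B"
  shows "(real (J (Suc i) k h B))\<^sup>2 \<le> real (J i k h B) * real (J (Suc (Suc i)) k h B)"
proof -
  have "\<forall>\<^sub>F N in sequentially.
     (real N ^ card {h..k} * real (J (Suc i) k h B))\<^sup>2
       \<le> (real N ^ card {h..k} * real (J i k h B)) * (real N ^ card {h..k} * real (J (Suc (Suc i)) k h B))"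
    using J_moment[OF assms, of h k i] J_moment[OF assms, of h k "Suc i"] J_moment[OF assms, of h k "Suc (Suc i)"]
  proof eventually_elim
    case (elim N)
    define f where "f a = cmod (char_sum {h..k} N a B (power_vec {h..k}))" for a
    have sq: "(f a ^ n)\<^sup>2 = f a ^ (2 * n)" for a n by (simp add: power_mult [symmetric] mult.commute)
    have "(\<Sum>a\<in>freqs {h..k} N. f a ^ (2 * Suc i))\<^sup>2 = (\<Sum>a\<in>freqs {h..k} N. f a ^ i * f a ^ (i + 2))\<^sup>2"
      by (simp only: power_add [symmetric]) (simp add: mult_2 del: power_Suc)
    also have "\<dots> \<le> (\<Sum>a\<in>freqs {h..k} N. (f a ^ i)\<^sup>2) * (\<Sum>a\<in>freqs {h..k} N. (f a ^ (i + 2))\<^sup>2)"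
      by (rule Cauchy_Schwarz_ineq_sum)
    also have "\<dots> = (\<Sum>a\<in>freqs {h..k} N. f a ^ (2 * i)) * (\<Sum>a\<in>freqs {h..k} N. f a ^ (2 * Suc (Suc i)))"
      by (simp only: sq add_2_eq_Suc')
    finally show ?case unfolding f_def elim .
  qed
  then have "\<forall>\<^sub>F N in sequentially.
    (real (J (Suc i) k h B))\<^sup>2 \<le> real (J i k h B) * real (J (Suc (Suc i)) k h B)"
    using eventually_gt_at_top[of 0]
  proof eventually_elim
    case (elim N)
    then have "(real N ^ card {h..k})\<^sup>2 * (real (J (Suc i) k h B))\<^sup>2
        \<le> (real N ^ card {h..k})\<^sup>2 * (real (J i k h B) * real (J (Suc (Suc i)) k h B))"
      by (simp add: power_mult_distrib power2_eq_square mult_ac)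
    moreover have "(real N ^ card {h..k})\<^sup>2 > 0" using elim by simp
    ultimately show ?case by (rule mult_left_le_imp_le)
  qed
  then show ?thesis by simp
qed

text \<open>Every factor is at most the largest one. This crude form of the inequality of means
  loses only a factor \<open>card I\<close>.\<close>

lemma prod_le_sum_power:
  fixes b :: "'i \<Rightarrow> real"
  assumes "finite I" "I \<noteq> {}" "\<And>i. i \<in> I \<Longrightarrow> b i \<ge> 0"
  shows "(\<Prod>i\<in>I. b i) \<le> (\<Sum>i\<in>I. b i ^ card I)"
proof -
  obtain i0 where i0: "i0 \<in> I" "\<And>i. i \<in> I \<Longrightarrow> b i \<le> b i0"
    using assms Max_in[of "b ` I"] by (metis (no_types, lifting) Max_ge finite_imageI image_iff image_is_empty)
  have "(\<Prod>i\<in>I. b i) \<le> (\<Prod>i\<in>I. b i0)" using assms i0 by (intro prod_mono) auto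
  also have "\<dots> = b i0 ^ card I" by simp
  also have "\<dots> \<le> (\<Sum>i\<in>I. b i ^ card I)" using assms i0 by (intro member_le_sum) auto
  finally show ?thesis .
qed

text \<open>On the Fourier side the variables become independent factors, and their product is at
  most a sum of pure powers. Dividing each factor by \<open>(w i)^2\<close> beforehand balances
  pieces of different sizes.\<close>

lemma energy_mixed_le:
  assumes K: "finite K" and Z: "finite Z" "vanish_off K V" and s: "s \<ge> 1"
    and D: "\<And>i. i \<in> {1..s} \<Longrightarrow> finite (D i)" and w: "\<And>i. i \<in> {1..s} \<Longrightarrow> w i > (0::real)"
  shows "real (energy (Z \<times> Pi\<^sub>E {1..s} D) (pair_sum V (psum K {1..s})))
     \<le> (\<Prod>i\<in>{1..s}. (w i)\<^sup>2) *
       (\<Sum>i\<in>{1..s}. real (energy (Z \<times> ({1..s} \<rightarrow>\<^sub>E D i)) (pair_sum V (psum K {1..s}))) / w i ^ (2 * s))"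
proof -
  define E where "E D = real (energy (Z \<times> Pi\<^sub>E {1..s} D) (pair_sum V (psum K {1..s})))" for D
  define f where "f N a B = (cmod (char_sum K N a B (power_vec K)))\<^sup>2" for N a B
  define g where "g N a = (cmod (char_sum K N a Z V))\<^sup>2" for N a
  define P where "P = (\<Prod>i\<in>{1..s}. (w i)\<^sup>2)"
  have P: "P > 0" unfolding P_def using w by (intro prod_pos zero_less_power)
  have parseval': "\<forall>\<^sub>F N in sequentially.
      (\<Sum>a\<in>freqs K N. g N a * (\<Prod>i\<in>{1..s}. f N a (D i))) = real N ^ card K * E D"
    if "\<And>i. i \<in> {1..s} \<Longrightarrow> finite (D i)" for D
  proof -
    have "finite (Z \<times> Pi\<^sub>E {1..s} D)" using Z that by (intro finite_cartesian_product finite_PiE) auto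
    have *: "(cmod (char_sum K N a (Pi\<^sub>E {1..s} D) (psum K {1..s})))\<^sup>2 = (\<Prod>i\<in>{1..s}. f N a (D i))" for N a
    proof -
      have "char_sum K N a (Pi\<^sub>E {1..s} D) (psum K {1..s}) = (\<Prod>i\<in>{1..s}. char_sum K N a (D i) (power_vec K))"
        using that by (intro char_sum_psum) auto
      then show ?thesis by (simp only: f_def prod_norm [symmetric] prod_power_distrib)
    qed
    from parseval[OF K \<open>finite (Z \<times> _)\<close> vanish_off_pair_sum[OF Z(2) vanish_off_psum[where I = "{1..s}"]]] show ?thesis unfolding E_def
      by eventually_elim (simp only: g_def char_sum_pair_sum * norm_mult power_mult_distrib)
  qed
  have pw: "g N a * (\<Prod>i\<in>{1..s}. f N a (D i)) \<le> P * (\<Sum>i\<in>{1..s}. g N a * f N a (D i) ^ s / w i ^ (2 * s))" for N a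
  proof -
    have "(\<Prod>i\<in>{1..s}. f N a (D i)) = P * (\<Prod>i\<in>{1..s}. f N a (D i) / (w i)\<^sup>2)"
      unfolding P_def prod.distrib [symmetric]
    proof (rule prod.cong)
      show "f N a (D i) = (w i)\<^sup>2 * (f N a (D i) / (w i)\<^sup>2)" if "i \<in> {1..s}" for i
        using w[OF that] by simp
    qed simp
    also have "\<dots> \<le> P * (\<Sum>i\<in>{1..s}. (f N a (D i) / (w i)\<^sup>2) ^ card {1..s})"
      using P s by (intro mult_left_mono prod_le_sum_power) (auto simp: f_def)
    finally have "g N a * (\<Prod>i\<in>{1..s}. f N a (D i))
        \<le> g N a * (P * (\<Sum>i\<in>{1..s}. (f N a (D i) / (w i)\<^sup>2) ^ card {1..s}))"
      by (intro mult_left_mono) (auto simp: g_def)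
    then show ?thesis by (simp add: power_divide sum_distrib_left mult_ac flip: power_mult)
  qed
  have all: "\<forall>\<^sub>F N in sequentially. \<forall>i\<in>{1..s}.
      (\<Sum>a\<in>freqs K N. g N a * f N a (D i) ^ s) = real N ^ card K * E (\<lambda>_. D i)"
  proof (rule eventually_ball_finite, simp, rule ballI)
    fix i assume "i \<in> {1..s}"
    from parseval'[of "\<lambda>_. D i"] D[OF this]
    show "\<forall>\<^sub>F N in sequentially. (\<Sum>a\<in>freqs K N. g N a * f N a (D i) ^ s) = real N ^ card K * E (\<lambda>_. D i)"
      by simp
  qed
  have parsevalD: "\<forall>\<^sub>F N in sequentially.
      (\<Sum>a\<in>freqs K N. g N a * (\<Prod>i\<in>{1..s}. f N a (D i))) = real N ^ card K * E D"
    by (rule parseval') (rule D)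
  have "\<forall>\<^sub>F N in sequentially. E D \<le> P * (\<Sum>i\<in>{1..s}. E (\<lambda>_. D i) / w i ^ (2 * s))"
    using parsevalD all eventually_gt_at_top[of 0]
  proof eventually_elim
    case (elim N)
    have "real N ^ card K * E D = (\<Sum>a\<in>freqs K N. g N a * (\<Prod>i\<in>{1..s}. f N a (D i)))" using elim by simp
    also have "\<dots> \<le> (\<Sum>a\<in>freqs K N. P * (\<Sum>i\<in>{1..s}. g N a * f N a (D i) ^ s / w i ^ (2 * s)))"
      by (intro sum_mono pw)
    also have "\<dots> = P * (\<Sum>i\<in>{1..s}. (\<Sum>a\<in>freqs K N. g N a * f N a (D i) ^ s) / w i ^ (2 * s))"
      by (subst sum_distrib_left [symmetric], subst sum.swap) (simp add: sum_divide_distrib)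
    also have "\<dots> = P * (\<Sum>i\<in>{1..s}. real N ^ card K * E (\<lambda>_. D i) / w i ^ (2 * s))"
      using elim(2) by (intro arg_cong2[where f = "(*)"] sum.cong) auto
    also have "\<dots> = real N ^ card K * (P * (\<Sum>i\<in>{1..s}. E (\<lambda>_. D i) / w i ^ (2 * s)))"
      by (simp add: sum_distrib_left mult_ac)
    finally show ?case using elim(3) by simp
  qed
  then show ?thesis unfolding E_def P_def by simp
qed

section \<open>Log-convex sequences\<close>

lemma log_convex_ratio_mono:
  fixes a :: "nat \<Rightarrow> real"
  assumes pos: "\<And>i. a i > 0" and conv: "\<And>i. (a (Suc i))\<^sup>2 \<le> a i * a (Suc (Suc i))" and "i \<le> j"
  shows "a (Suc i) / a i \<le> a (Suc j) / a j"
proof (rule lift_Suc_mono_le[OF _ \<open>i \<le> j\<close>])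
  fix n
  show "a (Suc n) / a n \<le> a (Suc (Suc n)) / a (Suc n)"
    using conv[of n] pos[of n] pos[of "Suc n"] by (simp add: field_simps power2_eq_square)
qed

text \<open>Successive ratios do not decrease, so a bound for the last one bounds all earlier
  ones.\<close>

lemma log_convex_bound:
  fixes a :: "nat \<Rightarrow> real"
  assumes pos: "\<And>i. a i > 0" and conv: "\<And>i. (a (Suc i))\<^sup>2 \<le> a i * a (Suc (Suc i))"
    and le: "a (Suc n) \<le> L * a n" and m: "m \<le> Suc n"
  shows "a (Suc n) \<le> L ^ (Suc n - m) * a m"
proof -
  have L: "L \<ge> a (Suc n) / a n" "L > 0"
  proof -
    show "L \<ge> a (Suc n) / a n" using le pos[of n] by (simp add: pos_divide_le_eq)
    then show "L > 0" using pos[of n] pos[of "Suc n"] divide_pos_pos[of "a (Suc n)" "a n"] by linarith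
  qed
  have "a (m + d) \<le> L ^ d * a m" if "m + d \<le> Suc n" for d
    using that
  proof (induction d)
    case (Suc d)
    have "a (Suc (m + d)) / a (m + d) \<le> a (Suc n) / a n"
      using Suc.prems by (intro log_convex_ratio_mono pos conv) auto
    then have "a (Suc (m + d)) / a (m + d) \<le> L" using L by linarith
    then have "a (Suc (m + d)) \<le> L * a (m + d)" using pos[of "m + d"] by (simp add: pos_divide_le_eq)
    also have "\<dots> \<le> L * (L ^ d * a m)" using Suc L by (intro mult_left_mono) auto
    finally show ?case by simp
  qed simp
  from this[of "Suc n - m"] m show ?thesis by simp
qed

section \<open>One differencing step\<close>

text \<open>The Jacobian of the power sums at \<open>z\<close> is, up to factors prime to \<open>m\<close>, a product of the quantities tested here.\<close>

definition nonsing :: "nat \<Rightarrow> nat set \<Rightarrow> (nat \<Rightarrow> nat) \<Rightarrow> bool" where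
  "nonsing m I z \<longleftrightarrow> (\<forall>p\<in>prime_factors m. (\<forall>i\<in>I. \<not> p dvd z i) \<and>
     (\<forall>i\<in>I. \<forall>i'\<in>I. i \<noteq> i' \<longrightarrow> \<not> int p dvd int (z i) - int (z i')))"

lemma prime_power_dvd_imp_dvd:
  fixes n :: nat and d :: int
  assumes "n > 0" "\<And>p A. p \<in> prime_factors n \<Longrightarrow> p ^ A dvd n \<Longrightarrow> int p ^ A dvd d"
  shows "int n dvd d"
proof (cases "d = 0")
  case False
  define e where "e = nat \<bar>d\<bar>"
  have e: "e > 0" using False by (simp add: e_def)
  have "int e = \<bar>d\<bar>" by (simp add: e_def)
  then have dvd_e: "int m dvd d \<longleftrightarrow> m dvd e" for m
    using int_dvd_int_iff[of m e] by simp
  have "n dvd e"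
  proof (rule multiplicity_le_imp_dvd)
    show "n \<noteq> 0" using assms by simp
    fix p :: nat assume p: "prime p"
    show "multiplicity p n \<le> multiplicity p e"
    proof (cases "p \<in> prime_factors n")
      case True
      have "int (p ^ multiplicity p n) dvd d"
        using assms(2)[OF True multiplicity_dvd] by simp
      then have "p ^ multiplicity p n dvd e" using dvd_e by blast
      then show ?thesis using e p by (intro multiplicity_geI) (auto dest: not_prime_unit)
    next
      case False
      then have "multiplicity p n = 0" using p assms by (auto simp: prime_factors_multiplicity)
      then show ?thesis by simp
    qed
  qed
  then show ?thesis using dvd_e by blast
qed simp

text \<open>Since \<open>Q < m ^ h\<close>, a tuple is determined by its residues modulo
  \<open>m ^ h\<close>, and by Hensel uniqueness already by its residues modulo the primes of
  \<open>m\<close>; for each prime the Bezout-type bound applies.\<close>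

lemma card_power_sum_class_le:
  fixes c :: "nat \<Rightarrow> int"
  assumes m: "m > 0" "\<And>p. p \<in> prime_factors m \<Longrightarrow> k < p"
    and h: "h \<ge> 1" "h + r \<le> Suc k" and Q: "Q < m ^ h"
  shows "card {z \<in> {1..r} \<rightarrow>\<^sub>E {..Q}. nonsing m {1..r} z \<and>
            (\<forall>j\<in>{h..<h + r}. int (m ^ h) dvd (\<Sum>i\<in>{1..r}. int (z i) ^ j) - c j)}
     \<le> ((r * k + 1) ^ r) ^ card (prime_factors m)"
proof -
  define T where "T = {z \<in> {1..r} \<rightarrow>\<^sub>E {..Q}. nonsing m {1..r} z \<and>
            (\<forall>j\<in>{h..<h + r}. int (m ^ h) dvd (\<Sum>i\<in>{1..r}. int (z i) ^ j) - c j)}"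
  define Sol where "Sol p = {z \<in> {..<r} \<rightarrow>\<^sub>E {0..<int p}. nonsingular_mod (int p) r z
             \<and> (\<forall>j<r. int p dvd (\<Sum>l<r. z l ^ (h + j)) - c (h + j))}" for p
  define f where "f z = (\<lambda>p\<in>prime_factors m. \<lambda>l\<in>{..<r}. int (z (Suc l)) mod int p)" for z :: "nat \<Rightarrow> nat"
  have sum_shift: "(\<Sum>i\<in>{1..r}. int (z i) ^ j) = (\<Sum>l<r. int (z (Suc l)) ^ j)" for z :: "nat \<Rightarrow> nat" and j
    by (simp add: sum.atLeast1_atMost_eq)
  have pp: "prime p" "p dvd m" "p > 1" if "p \<in> prime_factors m" for p
    using that prime_gt_1_nat by auto
  have ns: "nonsingular_mod (int p) r (\<lambda>l. int (z (Suc l)))" if "z \<in> T" "p \<in> prime_factors m" for z p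
    using that unfolding T_def nonsing_def nonsingular_mod_def by (auto simp: Suc_le_eq)
  have "f ` T \<subseteq> Pi\<^sub>E (prime_factors m) Sol"
  proof (rule image_subsetI)
    fix z assume z: "z \<in> T"
    have "(\<lambda>l\<in>{..<r}. int (z (Suc l)) mod int p) \<in> Sol p" if p: "p \<in> prime_factors m" for p
    proof -
      have nsp: "nonsingular_mod (int p) r (\<lambda>l\<in>{..<r}. int (z (Suc l)) mod int p)"
        using ns[OF z p] pp[OF p] unfolding nonsingular_mod_def
        by (auto simp: dvd_mod_iff mod_eq_dvd_iff [symmetric] simp flip: mod_diff_eq)
      have "int p dvd (\<Sum>l<r. (\<lambda>l\<in>{..<r}. int (z (Suc l)) mod int p) l ^ (h + j)) - c (h + j)" if "j < r" for j
      proof -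
        have "int (m ^ h) dvd (\<Sum>l<r. int (z (Suc l)) ^ (h + j)) - c (h + j)"
          using z that unfolding T_def sum_shift by auto
        moreover have "int p dvd int (m ^ h)"
          using pp[OF p] h dvd_trans[of p m "m ^ h"] by (simp only: int_dvd_int_iff) (simp add: dvd_power)
        ultimately have 1: "int p dvd (\<Sum>l<r. int (z (Suc l)) ^ (h + j)) - c (h + j)" by (rule dvd_trans[rotated])
        have "[(\<Sum>l<r. (int (z (Suc l)) mod int p) ^ (h + j)) = (\<Sum>l<r. int (z (Suc l)) ^ (h + j))] (mod int p)"
          by (intro cong_sum cong_pow) (simp add: cong_def)
        then have "[(\<Sum>l<r. (int (z (Suc l)) mod int p) ^ (h + j)) - c (h + j) = (\<Sum>l<r. int (z (Suc l)) ^ (h + j)) - c (h + j)] (mod int p)"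
          by (intro cong_diff) auto
        then show ?thesis using 1 by (simp add: cong_dvd_iff)
      qed
      then show ?thesis using nsp pp[OF p] unfolding Sol_def by (auto simp: restrict_PiE_iff)
    qed
    then show "f z \<in> Pi\<^sub>E (prime_factors m) Sol" unfolding f_def by (simp add: restrict_PiE_iff)
  qed
  moreover have "inj_on f T"
  proof (rule inj_onI)
    fix z z' assume zz: "z \<in> T" "z' \<in> T" "f z = f z'"
    have "z i = z' i" if i: "i \<in> {1..r}" for i
    proof -
      have "int (m ^ h) dvd int (z' i) - int (z i)"
      proof (rule prime_power_dvd_imp_dvd)
        fix p A assume p: "p \<in> prime_factors (m ^ h)" and A: "p ^ A dvd m ^ h"
        have pm: "p \<in> prime_factors m" using p m(1) prime_dvd_power[of p m h] by (simp add: prime_factors_dvd)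
        obtain l where l: "i = Suc l" "l < r" using i by (cases i) auto
        have "int p ^ A dvd int (z' (Suc l)) - int (z (Suc l))"
        proof (rule hensel_unique[where z = "\<lambda>l. int (z (Suc l))" and z' = "\<lambda>l. int (z' (Suc l))" and h = h and r = r])
          show "prime (int p)" using pp[OF pm] by simp
          show "\<not> int p dvd int (h + j)" if "j < r" for j
          proof -
            have "h + j < p" using m(2)[OF pm] h that by linarith
            then have "\<not> p dvd h + j" using h by (auto dest: dvd_imp_le)
            then show ?thesis using int_dvd_int_iff by blast
          qed
          show "nonsingular_mod (int p) r (\<lambda>l. int (z (Suc l)))" using ns zz pm by blast
          show "int p dvd int (z' (Suc l)) - int (z (Suc l))" if "l < r" for l
          proof -
            have "f z p l = f z' p l" using zz by simp
            then show ?thesis using that pm by (simp add: f_def mod_eq_dvd_iff dvd_diff_commute)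
          qed
          show "int p ^ A dvd (\<Sum>l<r. int (z' (Suc l)) ^ (h + j)) - (\<Sum>l<r. int (z (Suc l)) ^ (h + j))" if "j < r" for j
          proof -
            have "int (m ^ h) dvd ((\<Sum>l<r. int (z' (Suc l)) ^ (h + j)) - c (h + j)) - ((\<Sum>l<r. int (z (Suc l)) ^ (h + j)) - c (h + j))"
              using zz(1,2) that unfolding T_def sum_shift by (intro dvd_diff[of "int (m ^ h)" "_ - _" "_ - _"]) auto
            moreover have "int p ^ A dvd int (m ^ h)" using A int_dvd_int_iff[of "p ^ A" "m ^ h"] by simp
            ultimately show ?thesis by (auto dest: dvd_trans)
          qed
        qed (use h l in auto)
        then show "int p ^ A dvd int (z' i) - int (z i)" using l by simp
      qed (use m in auto)
      then have "int (z' i) mod int (m ^ h) = int (z i) mod int (m ^ h)" by (simp only: mod_eq_dvd_iff)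
      moreover have "int (z i) < int (m ^ h)" "int (z' i) < int (m ^ h)"
        using zz i Q unfolding T_def by (auto simp del: of_nat_power dest!: PiE_mem intro: le_less_trans)
      ultimately show ?thesis by simp
    qed
    moreover have "z \<in> {1..r} \<rightarrow>\<^sub>E {..Q}" "z' \<in> {1..r} \<rightarrow>\<^sub>E {..Q}"
      using zz unfolding T_def by blast+
    ultimately show "z = z'" by (intro PiE_ext)
  qed
  moreover have finSol: "finite (Sol p)" for p
    unfolding Sol_def by (rule finite_subset[OF _ finite_PiE[of "{..<r}" "\<lambda>_. {0..<int p}"]]) auto
  then have "finite (Pi\<^sub>E (prime_factors m) Sol)" by (intro finite_PiE) auto
  ultimately have "card T \<le> card (Pi\<^sub>E (prime_factors m) Sol)"
    by (metis card_image card_mono)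
  also have "\<dots> = (\<Prod>p\<in>prime_factors m. card (Sol p))" by (simp add: card_PiE)
  also have "\<dots> \<le> (\<Prod>p\<in>prime_factors m. (r * k + 1) ^ r)"
    unfolding Sol_def using pp m(2) h
    by (intro prod_mono conjI card_power_sum_congruences) auto
  finally show ?thesis by (simp add: T_def)
qed

section \<open>Exceptional, good and congruent variables\<close>

lemma energy_inj_le:
  assumes "finite W" "inj_on f S" "f ` S \<subseteq> W" "\<And>u w. u \<in> S \<Longrightarrow> w \<in> S \<Longrightarrow> V u = V w \<Longrightarrow> V' (f u) = V' (f w)"
  shows "energy S V \<le> energy W V'"
proof -
  have "map_prod f f ` {(u, w). u \<in> S \<and> w \<in> S \<and> V u = V w} \<subseteq> {(u, w). u \<in> W \<and> w \<in> W \<and> V' u = V' w}"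
    using assms(3,4) by auto
  moreover have "inj_on (map_prod f f) {(u, w). u \<in> S \<and> w \<in> S \<and> V u = V w}"
    using assms(2) by (auto simp: inj_on_def)
  ultimately show ?thesis
    unfolding energy_def by (intro card_inj_on_le finite_energy_set assms(1))
qed

lemma card_le_energy: "finite S \<Longrightarrow> card S \<le> energy S V"
  unfolding energy_def
  by (rule card_inj_on_le[of "\<lambda>u. (u, u)"]) (auto simp: inj_on_def intro: finite_energy_set)

lemma psum_remove:
  assumes "finite I" "A \<subseteq> I"
  shows "psum K I x = (\<lambda>j. psum K (I - A) (restrict x (I - A)) j + psum K A x j)"
proof
  fix j
  have "(\<Sum>i\<in>I. int (x i) ^ j) = (\<Sum>i\<in>I - A. int (x i) ^ j) + (\<Sum>i\<in>A. int (x i) ^ j)"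
    by (rule sum.subset_diff[OF assms(2,1)])
  then show "psum K I x j = psum K (I - A) (restrict x (I - A)) j + psum K A x j"
    by (simp add: psum_def)
qed

lemma PiE_eq_from_parts:
  assumes "x \<in> I \<rightarrow>\<^sub>E B" "x' \<in> I \<rightarrow>\<^sub>E B" "restrict x (I - A) = restrict x' (I - A)" "\<And>i. i \<in> A \<Longrightarrow> x i = x' i"
  shows "x = x'"
proof (rule PiE_ext[OF assms(1,2)])
  fix i assume "i \<in> I"
  then show "x i = x' i" using assms(4) fun_cong[OF assms(3), of i] by (cases "i \<in> A") auto
qed

lemma restrict_Diff_PiE: "x \<in> I \<rightarrow>\<^sub>E B \<Longrightarrow> restrict x (I - A) \<in> (I - A) \<rightarrow>\<^sub>E B"
  by (auto simp: restrict_PiE_iff dest: PiE_mem)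

text \<open>Fix two coinciding positions and their common value. Within such a piece they contribute
  equally to both sides and cancel, which leaves two variables fewer; Cauchy's inequality squares
  the number of pieces.\<close>

lemma energy_nondistinct_le:
  assumes B: "finite B" and I: "finite I" "finite I'"
  shows "real (energy {(z, x). z \<in> I \<rightarrow>\<^sub>E B \<and> \<not> inj_on z I \<and> x \<in> I' \<rightarrow>\<^sub>E B} (pair_sum (psum {h..k} I) (psum {h..k} I')))
    \<le> (real (card I)) ^ 4 * (real (card B))\<^sup>2 * real (J (card I - 2 + card I') k h B)"
    (is "real (energy ?N ?V) \<le> _")
proof -
  define P where "P = {(a, b). a \<in> I \<and> b \<in> I \<and> a \<noteq> b} \<times> B"
  define A where "A = (\<lambda>((a, b), c). {(z, x). z \<in> I \<rightarrow>\<^sub>E B \<and> z a = c \<and> z b = c \<and> x \<in> I' \<rightarrow>\<^sub>E B})"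
  have finP': "finite {(a, b). a \<in> I \<and> b \<in> I \<and> a \<noteq> b}" "card {(a, b). a \<in> I \<and> b \<in> I \<and> a \<noteq> b} \<le> card I * card I"
  proof -
    have "{(a, b). a \<in> I \<and> b \<in> I \<and> a \<noteq> b} \<subseteq> I \<times> I" by auto
    then show "finite {(a, b). a \<in> I \<and> b \<in> I \<and> a \<noteq> b}" "card {(a, b). a \<in> I \<and> b \<in> I \<and> a \<noteq> b} \<le> card I * card I"
      using I card_mono[of "I \<times> I"] finite_subset[of _ "I \<times> I"] by (auto simp: card_cartesian_product)
  qed
  have P: "finite P" "card P \<le> card I * card I * card B"
    unfolding P_def using finP' B by (auto simp: card_cartesian_product)
  have finA: "finite (A q)" for q
    unfolding A_def
    by (rule finite_subset[of _ "(I \<rightarrow>\<^sub>E B) \<times> (I' \<rightarrow>\<^sub>E B)"])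
       (use I B in \<open>auto simp: case_prod_beta intro!: finite_cartesian_product finite_PiE\<close>)
  have EA: "energy (A q) ?V \<le> J (card I - 2 + card I') k h B" if qP: "q \<in> P" for q
  proof -
    obtain a b c where q: "q = ((a, b), c)" "a \<in> I" "b \<in> I" "a \<noteq> b" using qP unfolding P_def by blast
    define W where "W = ((I - {a, b}) \<rightarrow>\<^sub>E B) \<times> (I' \<rightarrow>\<^sub>E B)"
    define f where "f u = (restrict (fst u) (I - {a, b}), snd u)" for u :: "('a \<Rightarrow> nat) \<times> ('b \<Rightarrow> nat)"
    have "energy (A q) ?V \<le> energy W (pair_sum (psum {h..k} (I - {a, b})) (psum {h..k} I'))"
    proof (rule energy_inj_le[of W f])
      show "finite W" unfolding W_def using I B by (intro finite_cartesian_product finite_PiE) auto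
      show "f ` A q \<subseteq> W" by (auto simp: f_def A_def q(1) W_def simp del: restrict_apply intro!: restrict_Diff_PiE)
      show "inj_on f (A q)"
      proof (rule inj_onI)
        fix u w assume "u \<in> A q" "w \<in> A q" "f u = f w"
        then have *: "fst u \<in> I \<rightarrow>\<^sub>E B" "fst w \<in> I \<rightarrow>\<^sub>E B" "restrict (fst u) (I - {a, b}) = restrict (fst w) (I - {a, b})"
          "snd u = snd w" "\<And>i. i \<in> {a, b} \<Longrightarrow> fst u i = fst w i"
          by (auto simp: f_def A_def q(1) simp del: restrict_apply)
        show "u = w" using PiE_eq_from_parts[OF *(1-3,5)] *(4) by (intro prod_eqI)
      qed
      fix u w assume uw: "u \<in> A q" "w \<in> A q" "?V u = ?V w"
      have eqc: "psum {h..k} {a, b} (fst u) = psum {h..k} {a, b} (fst w)"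
        using uw q by (auto simp: A_def psum_def)
      have "?V u j = ?V w j" for j using uw by simp
      then show "pair_sum (psum {h..k} (I - {a, b})) (psum {h..k} I') (f u) = pair_sum (psum {h..k} (I - {a, b})) (psum {h..k} I') (f w)"
        unfolding pair_sum_def f_def fst_conv snd_conv
        using psum_remove[of I "{a, b}" "{h..k}" "fst u"] psum_remove[of I "{a, b}" "{h..k}" "fst w"] q I eqc
        by (auto simp: fun_eq_iff)
    qed
    also have "\<dots> = J (card (I - {a, b}) + card I') k h B"
      unfolding W_def using I B by (intro energy_pair_eq_J) auto
    also have "card (I - {a, b}) = card I - 2" using q I by (simp add: card_Diff_subset)
    finally show ?thesis .
  qed
  have "real (energy ?N ?V) \<le> real (card P) * (\<Sum>q\<in>P. real (energy (A q) ?V))"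
  proof (rule energy_UN_le_card[OF P(1) finA])
    show "?N \<subseteq> (\<Union>q\<in>P. A q)"
    proof safe
      fix z x assume z: "z \<in> I \<rightarrow>\<^sub>E B" "\<not> inj_on z I" "x \<in> I' \<rightarrow>\<^sub>E B"
      then obtain a b where "a \<in> I" "b \<in> I" "a \<noteq> b" "z a = z b" by (auto simp: inj_on_def)
      then show "(z, x) \<in> (\<Union>q\<in>P. A q)"
        using z by (intro UN_I[of "((a, b), z a)"]) (auto simp: P_def A_def)
    qed
  qed
  also have "\<dots> \<le> real (card P) * (\<Sum>q\<in>P. real (J (card I - 2 + card I') k h B))"
    using EA by (intro mult_left_mono sum_mono) auto
  also have "\<dots> = (real (card P))\<^sup>2 * real (J (card I - 2 + card I') k h B)" by (simp add: power2_eq_square)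
  also have "\<dots> \<le> (real (card I * card I * card B))\<^sup>2 * real (J (card I - 2 + card I') k h B)"
    using of_nat_mono[OF P(2)] by (intro mult_right_mono power_mono) auto
  also have "\<dots> = (real (card I)) ^ 4 * (real (card B))\<^sup>2 * real (J (card I - 2 + card I') k h B)"
    by (simp add: power_mult_distrib power_mult [symmetric] power2_eq_square power4_eq_xxxx)
  finally show ?thesis .
qed


text \<open>Fixing the value \<open>c\<close> at position \<open>a\<close> cancels that variable.
  Summing over \<open>c\<close> after fixing the remaining solution admits only the values that are
  bad for its \<open>z\<close>, so one of two factors \<open>card B\<close> improves to
  \<open>b\<close>.\<close>

lemma energy_bad_le:
  assumes B: "finite B" and I: "finite I" "finite I'" "a \<in> I'"
    and Bz: "\<And>z. z \<in> I \<rightarrow>\<^sub>E B \<Longrightarrow> real (card {c\<in>B. c \<in> Bz z}) \<le> b"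
  shows "real (energy {(z, x). z \<in> I \<rightarrow>\<^sub>E B \<and> x \<in> I' \<rightarrow>\<^sub>E B \<and> x a \<in> Bz z} (pair_sum (psum {h..k} I) (psum {h..k} I')))
    \<le> real (card B) * b * real (J (card I + card I' - 1) k h B)"
    (is "real (energy ?S ?V) \<le> _")
proof -
  define A where "A c = {(z, x). z \<in> I \<rightarrow>\<^sub>E B \<and> x \<in> I' \<rightarrow>\<^sub>E B \<and> x a = c \<and> c \<in> Bz z}" for c
  define W where "W = (I \<rightarrow>\<^sub>E B) \<times> ((I' - {a}) \<rightarrow>\<^sub>E B)"
  define V' where "V' = pair_sum (psum {h..k} I) (psum {h..k} (I' - {a}))"
  define E where "E = {(u, w). u \<in> W \<and> w \<in> W \<and> V' u = V' w}"
  have finW: "finite W" unfolding W_def using I B by (intro finite_cartesian_product finite_PiE) auto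
  have finE: "finite E" unfolding E_def by (rule finite_energy_set[OF finW])
  have finA: "finite (A c)" for c
    unfolding A_def
    by (rule finite_subset[of _ "(I \<rightarrow>\<^sub>E B) \<times> (I' \<rightarrow>\<^sub>E B)"])
       (use I B in \<open>auto simp: case_prod_beta intro!: finite_cartesian_product finite_PiE\<close>)
  have EA: "energy (A c) ?V \<le> (\<Sum>e\<in>E. if c \<in> Bz (fst (fst e)) then 1 else 0)" for c
  proof -
    define f where "f u = (fst u, restrict (snd u) (I' - {a}))" for u :: "('a \<Rightarrow> nat) \<times> ('b \<Rightarrow> nat)"
    define Wc where "Wc = {u\<in>W. c \<in> Bz (fst u)}"
    have "energy (A c) ?V \<le> energy Wc V'"
    proof (rule energy_inj_le[of Wc f])
      show "finite Wc" unfolding Wc_def using finW by simp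
      show "f ` A c \<subseteq> Wc"
        by (auto simp: f_def A_def W_def Wc_def simp del: restrict_apply intro!: restrict_Diff_PiE)
      show "inj_on f (A c)"
      proof (rule inj_onI)
        fix u w assume "u \<in> A c" "w \<in> A c" "f u = f w"
        then have *: "snd u \<in> I' \<rightarrow>\<^sub>E B" "snd w \<in> I' \<rightarrow>\<^sub>E B" "restrict (snd u) (I' - {a}) = restrict (snd w) (I' - {a})"
          "fst u = fst w" "\<And>i. i \<in> {a} \<Longrightarrow> snd u i = snd w i"
          by (auto simp: f_def A_def simp del: restrict_apply)
        show "u = w" using PiE_eq_from_parts[OF *(1-3,5)] *(4) by (intro prod_eqI)
      qed
      fix u w assume uw: "u \<in> A c" "w \<in> A c" "?V u = ?V w"
      have eqc: "psum {h..k} {a} (snd u) = psum {h..k} {a} (snd w)"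
        using uw by (auto simp: A_def psum_def)
      have "?V u j = ?V w j" for j using uw by simp
      then show "V' (f u) = V' (f w)"
        unfolding pair_sum_def f_def fst_conv snd_conv V'_def
        using psum_remove[of I' "{a}" "{h..k}" "snd u"] psum_remove[of I' "{a}" "{h..k}" "snd w"] I eqc
        by (auto simp: fun_eq_iff)
    qed
    \<comment> \<open>Only the constraint on the first half of each pair is kept; one constraint
      suffices for the later exchange of sums.\<close>
    also have "\<dots> \<le> card {e\<in>E. c \<in> Bz (fst (fst e))}"
      unfolding energy_def by (rule card_mono) (use finE in \<open>auto simp: E_def Wc_def\<close>)
    also have "\<dots> = (\<Sum>e\<in>E. if c \<in> Bz (fst (fst e)) then 1 else 0)"
      using finE by (simp add: sum.If_cases Int_def)
    finally show ?thesis .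
  qed
  have "(\<Sum>c\<in>B. real (energy (A c) ?V)) \<le> (\<Sum>c\<in>B. real (\<Sum>e\<in>E. if c \<in> Bz (fst (fst e)) then 1 else 0))"
    using EA by (intro sum_mono of_nat_mono)
  also have "\<dots> = real (\<Sum>e\<in>E. \<Sum>c\<in>B. if c \<in> Bz (fst (fst e)) then 1 else 0)"
    by (subst sum.swap) (rule of_nat_sum [symmetric])
  also have "\<dots> = (\<Sum>e\<in>E. real (card {c\<in>B. c \<in> Bz (fst (fst e))}))"
    using B by (simp add: sum.If_cases Int_def)
  also have "\<dots> \<le> (\<Sum>e\<in>E. b)"
    by (intro sum_mono Bz) (auto simp: E_def W_def)
  also have "\<dots> = b * real (energy W V')" by (simp add: E_def energy_def)
  also have "energy W V' = J (card I + card (I' - {a})) k h B"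
    unfolding W_def V'_def using I B by (intro energy_pair_eq_J) auto
  also have "card I + card (I' - {a}) = card I + card I' - 1" using I card_gt_0_iff[of I'] by auto
  finally have 1: "(\<Sum>c\<in>B. real (energy (A c) ?V)) \<le> b * real (J (card I + card I' - 1) k h B)" .
  have "real (energy ?S ?V) \<le> real (card B) * (\<Sum>c\<in>B. real (energy (A c) ?V))"
    by (rule energy_UN_le_card[OF B finA]) (use I in \<open>auto simp: A_def\<close>)
  also have "\<dots> \<le> real (card B) * (b * real (J (card I + card I' - 1) k h B))"
    using 1 by (intro mult_left_mono) auto
  finally show ?thesis by (simp add: mult.assoc)
qed

text \<open>
  Choosing a modulus \<open>m\<close> for each coordinate splits the solutions into pieces; Cauchy's inequality with
  weights and the inequality between products and powers reduce to pieces with a single modulus.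
\<close>

lemma energy_good_le:
  fixes w :: "nat \<Rightarrow> real"
  assumes K: "finite K" "vanish_off K V" and B: "finite B" and M: "finite M"
    and w: "\<And>m. m \<in> M \<Longrightarrow> w m > 0" and Z: "\<And>m. m \<in> M \<Longrightarrow> finite (Z m)" and s: "s \<ge> 1" and "\<Gamma> \<ge> 0"
    and \<Gamma>: "\<And>m. m \<in> M \<Longrightarrow> real (energy (Z m \<times> ({1..s} \<rightarrow>\<^sub>E {x\<in>B. m dvd x})) (pair_sum V (psum K {1..s}))) \<le> \<Gamma> * w m ^ (2 * s)"
  shows "real (energy {(z, x). x \<in> {1..s} \<rightarrow>\<^sub>E B \<and> (\<forall>i\<in>{1..s}. \<exists>m\<in>M. m dvd x i \<and> z \<in> Z m)} (pair_sum V (psum K {1..s})))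
    \<le> real s * \<Gamma> * (\<Sum>m\<in>M. w m) ^ (2 * s)" (is "real (energy ?S ?V) \<le> _")
proof -
  define Bm where "Bm m = {x\<in>B. m dvd x}" for m
  define I where "I = {1..s} \<rightarrow>\<^sub>E M"
  \<comment> \<open>The same \<open>z\<close> has to be admissible for all chosen moduli; each pure
    piece later relaxes this to a single modulus.\<close>
  define Zm where "Zm \<mu> = (\<Inter>i\<in>{1..s}. Z (\<mu> i))" for \<mu> :: "nat \<Rightarrow> nat"
  define A where "A \<mu> = Zm \<mu> \<times> Pi\<^sub>E {1..s} (\<lambda>i. Bm (\<mu> i))" for \<mu>
  define \<omega> where "\<omega> \<mu> = (\<Prod>i\<in>{1..s}. w (\<mu> i))" for \<mu>
  have \<mu>: "\<mu> i \<in> M" if "\<mu> \<in> I" "i \<in> {1..s}" for \<mu> i using that by (auto simp: I_def)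
  have finBm: "finite (Bm m)" for m using B by (simp add: Bm_def)
  have finZm: "finite (Zm \<mu>)" if "\<mu> \<in> I" for \<mu>
  proof -
    have "Zm \<mu> \<subseteq> Z (\<mu> 1)" using s by (auto simp: Zm_def)
    then show ?thesis using Z \<mu>[OF that, of 1] s finite_subset by auto
  qed
  have finA: "finite (A \<mu>)" if "\<mu> \<in> I" for \<mu>
    unfolding A_def using finZm[OF that] finBm by (intro finite_cartesian_product finite_PiE) auto
  have \<omega>: "\<omega> \<mu> > 0" if "\<mu> \<in> I" for \<mu> unfolding \<omega>_def using w \<mu>[OF that] by (intro prod_pos) auto
  have EA: "real (energy (A \<mu>) ?V) / \<omega> \<mu> \<le> \<omega> \<mu> * (real s * \<Gamma>)" if \<mu>I: "\<mu> \<in> I" for \<mu>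
  proof -
    have "real (energy (A \<mu>) ?V) \<le> (\<Prod>i\<in>{1..s}. (w (\<mu> i))\<^sup>2) *
        (\<Sum>i\<in>{1..s}. real (energy (Zm \<mu> \<times> ({1..s} \<rightarrow>\<^sub>E Bm (\<mu> i))) ?V) / w (\<mu> i) ^ (2 * s))"
      unfolding A_def using K finZm[OF \<mu>I] s finBm w \<mu>[OF \<mu>I] by (intro energy_mixed_le) auto
    also have "\<dots> \<le> (\<Prod>i\<in>{1..s}. (w (\<mu> i))\<^sup>2) * (\<Sum>i\<in>{1..s}. \<Gamma>)"
    proof (intro mult_left_mono sum_mono prod_nonneg ballI)
      fix i assume i: "i \<in> {1..s}"
      have "energy (Zm \<mu> \<times> ({1..s} \<rightarrow>\<^sub>E Bm (\<mu> i))) ?V \<le> energy (Z (\<mu> i) \<times> ({1..s} \<rightarrow>\<^sub>E Bm (\<mu> i))) ?V"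
        using i finBm Z[OF \<mu>[OF \<mu>I i]]
        by (intro energy_mono finite_cartesian_product finite_PiE) (auto simp: Zm_def)
      then have "real (energy (Zm \<mu> \<times> ({1..s} \<rightarrow>\<^sub>E Bm (\<mu> i))) ?V) \<le> \<Gamma> * w (\<mu> i) ^ (2 * s)"
        using \<Gamma>[OF \<mu>[OF \<mu>I i]] unfolding Bm_def by linarith
      then show "real (energy (Zm \<mu> \<times> ({1..s} \<rightarrow>\<^sub>E Bm (\<mu> i))) ?V) / w (\<mu> i) ^ (2 * s) \<le> \<Gamma>"
        using w[OF \<mu>[OF \<mu>I i]] by (simp add: pos_divide_le_eq)
    qed auto
    also have "\<dots> = (\<omega> \<mu>)\<^sup>2 * (real s * \<Gamma>)" by (simp add: \<omega>_def prod_power_distrib)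
    finally show ?thesis using \<omega>[OF \<mu>I] by (simp add: pos_divide_le_eq power2_eq_square mult_ac)
  qed
  have sum\<omega>: "(\<Sum>\<mu>\<in>I. \<omega> \<mu>) = (\<Sum>m\<in>M. w m) ^ s"
    unfolding \<omega>_def I_def using M by (subst prod_sum_PiE [symmetric]) auto
  have "real (energy ?S ?V) \<le> (\<Sum>\<mu>\<in>I. \<omega> \<mu>) * (\<Sum>\<mu>\<in>I. real (energy (A \<mu>) ?V) / \<omega> \<mu>)"
  proof (rule energy_UN_le[OF _ finA _ \<omega>])
    show "finite I" unfolding I_def using M by (intro finite_PiE) auto
    show "?S \<subseteq> (\<Union>\<mu>\<in>I. A \<mu>)"
    proof safe
      fix z x assume x: "x \<in> {1..s} \<rightarrow>\<^sub>E B" "\<forall>i\<in>{1..s}. \<exists>m\<in>M. m dvd x i \<and> z \<in> Z m"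
      then obtain \<mu> where \<mu>: "\<And>i. i \<in> {1..s} \<Longrightarrow> \<mu> i \<in> M \<and> \<mu> i dvd x i \<and> z \<in> Z (\<mu> i)"
        using bchoice[of "{1..s}" "\<lambda>i m. m \<in> M \<and> m dvd x i \<and> z \<in> Z m"] by blast
      show "(z, x) \<in> (\<Union>\<mu>\<in>I. A \<mu>)"
      proof (rule UN_I)
        show "restrict \<mu> {1..s} \<in> I" using \<mu> unfolding I_def restrict_PiE_iff by blast
        have "x i \<in> B" if "i \<in> {1..s}" for i using x that by blast
        then have "x \<in> Pi\<^sub>E {1..s} (\<lambda>i. Bm (restrict \<mu> {1..s} i))"
          using x \<mu> by (intro PiE_I) (auto simp: Bm_def PiE_def extensional_def)
        moreover have "z \<in> Zm (restrict \<mu> {1..s})" using \<mu> by (auto simp: Zm_def)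
        ultimately show "(z, x) \<in> A (restrict \<mu> {1..s})" by (simp add: A_def)
      qed
    qed
  qed
  also have "\<dots> \<le> (\<Sum>\<mu>\<in>I. \<omega> \<mu>) * (\<Sum>\<mu>\<in>I. \<omega> \<mu> * (real s * \<Gamma>))"
    using EA \<omega> by (intro mult_left_mono sum_mono sum_nonneg) (auto intro: less_imp_le)
  also have "\<dots> = (\<Sum>m\<in>M. w m) ^ s * ((\<Sum>m\<in>M. w m) ^ s * (real s * \<Gamma>))"
    by (simp add: sum_distrib_right [symmetric] sum\<omega>)
  also have "\<dots> = real s * \<Gamma> * (\<Sum>m\<in>M. w m) ^ (2 * s)"
    unfolding mult_2 power_add by (simp add: mult_ac)
  finally show ?thesis .
qed

text \<open>Once \<open>w\<close> and a congruent \<open>z\<close> are fixed, the remaining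
  variables solve a translated system, which has at most \<open>energy S U\<close>
  solutions.\<close>

lemma energy_pairs_le_class:
  assumes Z: "finite Z" and S: "finite S"
    and cg: "\<And>z w x y. z \<in> Z \<Longrightarrow> w \<in> Z \<Longrightarrow> x \<in> S \<Longrightarrow> y \<in> S \<Longrightarrow> pair_sum V U (z, x) = pair_sum V U (w, y) \<Longrightarrow> cg z w"
    and \<kappa>: "\<And>w. w \<in> Z \<Longrightarrow> card {z\<in>Z. cg z w} \<le> \<kappa>"
  shows "energy (Z \<times> S) (pair_sum V U) \<le> card Z * \<kappa> * energy S U"
proof -
  define P where "P = {(w, z). w \<in> Z \<and> z \<in> Z \<and> cg z w}"
  define R where "R = (\<lambda>(w, z). {(x, y). x \<in> S \<and> y \<in> S \<and> U x = (\<lambda>j. U y j + V w j - V z j)})"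
  have P: "P = Sigma Z (\<lambda>w. {z\<in>Z. cg z w})" by (auto simp: P_def)
  have finP: "finite P" unfolding P using Z by auto
  have finR: "finite (R q)" for q unfolding R_def using S by (auto simp: case_prod_beta intro: finite_energy_set)
  have "energy (Z \<times> S) (pair_sum V U) \<le> card (Sigma P R)"
    unfolding energy_def
  proof (rule card_inj_on_le)
    show "inj_on (\<lambda>((z, x), (w, y)). ((w, z), (x, y))) {(u, w). u \<in> Z \<times> S \<and> w \<in> Z \<times> S \<and> pair_sum V U u = pair_sum V U w}"
      by (auto simp: inj_on_def)
    show "(\<lambda>((z, x), (w, y)). ((w, z), (x, y))) ` {(u, w). u \<in> Z \<times> S \<and> w \<in> Z \<times> S \<and> pair_sum V U u = pair_sum V U w} \<subseteq> Sigma P R"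
    proof (safe)
      fix z x w y assume *: "z \<in> Z" "x \<in> S" "w \<in> Z" "y \<in> S" "pair_sum V U (z, x) = pair_sum V U (w, y)"
      show "(w, z) \<in> P" using * cg by (auto simp: P_def)
      have "V z j + U x j = V w j + U y j" for j using fun_cong[OF *(5), of j] by (simp add: pair_sum_def)
      then have "U x = (\<lambda>j. U y j + V w j - V z j)" by (auto simp: fun_eq_iff algebra_simps)
      then show "(x, y) \<in> R (w, z)" using * by (simp add: R_def)
    qed
    show "finite (Sigma P R)" using finP finR by auto
  qed
  also have "\<dots> = (\<Sum>q\<in>P. card (R q))" using finP finR by (intro card_SigmaI) auto
  also have "\<dots> \<le> (\<Sum>q\<in>P. energy S U)"
  proof (rule sum_mono)
    fix q
    have "card {(x, y). x \<in> S \<and> y \<in> S \<and> U x = (\<lambda>j. U y j + V (fst q) j - V (snd q) j)} \<le> energy S U"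
      by (rule card_shifted_pairs_le_energy[OF S]) (auto simp: fun_eq_iff)
    then show "card (R q) \<le> energy S U" by (simp add: R_def case_prod_beta)
  qed
  also have "\<dots> = (\<Sum>w\<in>Z. card {z\<in>Z. cg z w}) * energy S U" unfolding P using Z by (simp add: card_SigmaI)
  also have "\<dots> \<le> (\<Sum>w\<in>Z. \<kappa>) * energy S U" using \<kappa> by (intro mult_right_mono sum_mono) auto
  finally show ?thesis by simp
qed

section \<open>Comparison of mean values of different orders\<close>

lemma J_0: "J 0 k h B = 1"
proof -
  have "{(u, w). u \<in> {1..0::nat} \<rightarrow>\<^sub>E B \<and> w \<in> {1..0::nat} \<rightarrow>\<^sub>E B
        \<and> psum {h..k} {1..0::nat} u = psum {h..k} {1..0::nat} w} = {(\<lambda>_. undefined, \<lambda>_. undefined)}" by auto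
  then show ?thesis unfolding J_eq_energy energy_def by simp
qed

lemma J_pos:
  assumes "finite B" "B \<noteq> {}"
  shows "real (J s k h B) > 0"
proof -
  have fin: "finite ({1..s} \<rightarrow>\<^sub>E B)" using assms by (intro finite_PiE) auto
  have "{1..s} \<rightarrow>\<^sub>E B \<noteq> {}" using assms by (simp add: PiE_eq_empty_iff)
  then have "0 < card ({1..s} \<rightarrow>\<^sub>E B)" using fin by (simp add: card_gt_0_iff)
  also have "\<dots> \<le> J s k h B" unfolding J_eq_energy by (rule card_le_energy[OF fin])
  finally show ?thesis by simp
qed

text \<open>By log-convexity every ratio is at least the first one, and the diagonal makes that at
  least \<open>card B\<close>.\<close>

lemma J_Suc_ge:
  assumes "finite B" "B \<noteq> {}"
  shows "real (card B) * real (J i k h B) \<le> real (J (Suc i) k h B)"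
proof -
  have "real (J (Suc 0) k h B) / real (J 0 k h B) \<le> real (J (Suc i) k h B) / real (J i k h B)"
    by (rule log_convex_ratio_mono[where a = "\<lambda>i. real (J i k h B)", OF J_pos[OF assms] J_log_convex[OF assms(1)]]) simp
  moreover have "card B \<le> J (Suc 0) k h B"
  proof -
    have "card ({1..Suc 0} \<rightarrow>\<^sub>E B) \<le> J (Suc 0) k h B"
      unfolding J_eq_energy using assms(1) by (intro card_le_energy finite_PiE) auto
    then show ?thesis by (simp add: card_PiE)
  qed
  ultimately have "real (card B) \<le> real (J (Suc i) k h B) / real (J i k h B)" by (simp add: J_0)
  then show ?thesis using J_pos[OF assms, of i k h] by (simp add: pos_le_divide_eq)
qed

text \<open>Brings the nondistinct tuples into the shape of the bad ones, a multiple of the mean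
  value with one variable fewer, so that one ratio argument serves both.\<close>

lemma energy_nondistinct_le':
  assumes B: "finite B" "B \<noteq> {}" and I: "finite I" "finite I'" "card I \<ge> 1"
  shows "real (energy {(z, x). z \<in> I \<rightarrow>\<^sub>E B \<and> \<not> inj_on z I \<and> x \<in> I' \<rightarrow>\<^sub>E B} (pair_sum (psum {h..k} I) (psum {h..k} I')))
    \<le> (real (card I)) ^ 4 * (real (card B) * real (J (card I + card I' - 1) k h B))"
proof (cases "card I \<ge> 2")
  case True
  define i where "i = card I - 2 + card I'"
  have i: "card I + card I' - 1 = Suc i" using True by (simp add: i_def)
  have "(real (card I)) ^ 4 * (real (card B))\<^sup>2 * real (J i k h B)
      = (real (card I)) ^ 4 * (real (card B) * (real (card B) * real (J i k h B)))"
    by (simp add: power2_eq_square)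
  also have "\<dots> \<le> (real (card I)) ^ 4 * (real (card B) * real (J (Suc i) k h B))"
    by (intro mult_left_mono J_Suc_ge B) auto
  finally show ?thesis using energy_nondistinct_le[OF B(1) I(1,2), of h k] unfolding i i_def by linarith
next
  case False
  then have "card I = 1" using I by simp
  then obtain a where "I = {a}" by (auto simp: card_1_singleton_iff)
  then have e: "{(z, x). z \<in> I \<rightarrow>\<^sub>E B \<and> \<not> inj_on z I \<and> x \<in> I' \<rightarrow>\<^sub>E B} = {}" by auto
  show ?thesis unfolding e energy_def by simp
qed

text \<open>Powers of degree at least \<open>h\<close> of multiples of \<open>m\<close> vanish
  modulo \<open>m ^ h\<close>, so the equations leave congruences for the split variables
  alone.\<close>

lemma energy_class_nonsing_le:
  assumes h: "h \<ge> 1" "h + r \<le> Suc k" and m: "m > 0" "\<And>p. p \<in> prime_factors m \<Longrightarrow> k < p" and Q: "Q < m ^ h"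
    and Z: "Z \<subseteq> {z \<in> {1..r} \<rightarrow>\<^sub>E {..Q}. nonsing m {1..r} z}" and S: "finite S"
    and dvd: "\<And>x i. x \<in> S \<Longrightarrow> i \<in> I \<Longrightarrow> m dvd x i"
  shows "energy (Z \<times> S) (pair_sum (psum {h..k} {1..r}) (psum {h..k} I))
    \<le> card Z * ((r * k + 1) ^ r) ^ card (prime_factors m) * energy S (psum {h..k} I)"
proof (rule energy_pairs_le_class[where cg = "\<lambda>z w. \<forall>j\<in>{h..<h + r}. int (m ^ h) dvd (\<Sum>i\<in>{1..r}. int (z i) ^ j) - (\<Sum>i\<in>{1..r}. int (w i) ^ j)"])
  show finZ: "finite Z"
    by (rule finite_subset[OF Z], rule finite_subset[OF _ finite_PiE[of "{1..r}" "\<lambda>_. {..Q}"]]) auto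
  show "finite S" by fact
  fix z w x y
  assume xy: "x \<in> S" "y \<in> S" and eq: "pair_sum (psum {h..k} {1..r}) (psum {h..k} I) (z, x) = pair_sum (psum {h..k} {1..r}) (psum {h..k} I) (w, y)"
  show "\<forall>j\<in>{h..<h + r}. int (m ^ h) dvd (\<Sum>i\<in>{1..r}. int (z i) ^ j) - (\<Sum>i\<in>{1..r}. int (w i) ^ j)"
  proof
    fix j assume j: "j \<in> {h..<h + r}"
    have "(\<Sum>i\<in>{1..r}. int (z i) ^ j) + (\<Sum>i\<in>I. int (x i) ^ j) = (\<Sum>i\<in>{1..r}. int (w i) ^ j) + (\<Sum>i\<in>I. int (y i) ^ j)"
      using fun_cong[OF eq, of j] j h by (auto simp: pair_sum_def psum_def)
    then have "(\<Sum>i\<in>{1..r}. int (z i) ^ j) - (\<Sum>i\<in>{1..r}. int (w i) ^ j) = (\<Sum>i\<in>I. int (y i) ^ j) - (\<Sum>i\<in>I. int (x i) ^ j)"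
      by linarith
    also have "int (m ^ h) dvd \<dots>"
    proof -
      have "int (m ^ h) dvd (\<Sum>i\<in>I. int (u i) ^ j)" if "u \<in> S" for u
      proof (rule dvd_sum)
        fix i assume "i \<in> I"
        then have "int m dvd int (u i)" using dvd that by simp
        then have "int m ^ j dvd int (u i) ^ j" by (rule dvd_power_same)
        moreover have "int m ^ h dvd int m ^ j" using j by (intro le_imp_power_dvd) auto
        ultimately show "int (m ^ h) dvd int (u i) ^ j" by (simp add: dvd_trans)
      qed
      then show ?thesis using xy by (intro dvd_diff) auto
    qed
    finally show "int (m ^ h) dvd (\<Sum>i\<in>{1..r}. int (z i) ^ j) - (\<Sum>i\<in>{1..r}. int (w i) ^ j)" .
  qed
next
  fix w assume "w \<in> Z"
  have "card {z\<in>Z. \<forall>j\<in>{h..<h + r}. int (m ^ h) dvd (\<Sum>i\<in>{1..r}. int (z i) ^ j) - (\<Sum>i\<in>{1..r}. int (w i) ^ j)}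
     \<le> card {z \<in> {1..r} \<rightarrow>\<^sub>E {..Q}. nonsing m {1..r} z \<and>
            (\<forall>j\<in>{h..<h + r}. int (m ^ h) dvd (\<Sum>i\<in>{1..r}. int (z i) ^ j) - (\<Sum>i\<in>{1..r}. int (w i) ^ j))}"
    using Z by (intro card_mono finite_subset[OF _ finite_PiE[of "{1..r}" "\<lambda>_. {..Q}"]]) auto
  also have "\<dots> \<le> ((r * k + 1) ^ r) ^ card (prime_factors m)"
    using m h Q by (intro card_power_sum_class_le) auto
  finally show "card {z\<in>Z. \<forall>j\<in>{h..<h + r}. int (m ^ h) dvd (\<Sum>i\<in>{1..r}. int (z i) ^ j) - (\<Sum>i\<in>{1..r}. int (w i) ^ j)}
     \<le> ((r * k + 1) ^ r) ^ card (prime_factors m)" .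
qed

text \<open>With at most \<open>t\<close> variables the system is nearly diagonal: distinct tuples
  are counted by the congruence bound modulo one huge prime, and a coincidence reduces to one
  variable fewer.\<close>

lemma J_small_le:
  assumes h: "h \<ge> 1" "h + t = Suc k" and t: "t \<ge> 1" and C: "finite C" "C \<noteq> {}" "0 \<notin> C" and r: "r \<le> t"
  shows "real (J r k h C) \<le> (4 * real t ^ 4) ^ r * real ((t * k + 1) ^ t) * real (card C) ^ r"
  using r
proof (induction r)
  case 0
  show ?case by (simp add: J_0)
next
  case (Suc r)
  define K where "K = real ((t * k + 1) ^ t)"
  define X where "X = real (card C)"
  define n where "n = Suc r"
  define V where "V = pair_sum (psum {h..k} {1..n}) (psum {h..k} ({} :: nat set))"
  define Z where "Z = {z \<in> {1..n} \<rightarrow>\<^sub>E C. inj_on z {1..n}}"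
  define N where "N = {(z, x). z \<in> {1..n} \<rightarrow>\<^sub>E C \<and> \<not> inj_on z {1..n} \<and> x \<in> ({} :: nat set) \<rightarrow>\<^sub>E C}"
  have K: "K \<ge> 1" unfolding K_def by (simp add: one_le_power del: of_nat_power)
  have X: "X \<ge> 1" using C by (simp add: X_def Suc_le_eq card_gt_0_iff)
  have finP: "finite ({1..n} \<rightarrow>\<^sub>E C)" using C by (intro finite_PiE) auto
  have finZ: "finite Z" "card Z \<le> card C ^ n"
  proof -
    show "finite Z" using finP by (simp add: Z_def)
    have "card Z \<le> card ({1..n} \<rightarrow>\<^sub>E C)" using finP by (intro card_mono) (auto simp: Z_def)
    then show "card Z \<le> card C ^ n" by (simp add: card_PiE)
  qed
  define Q where "Q = Max C"
  have Q: "x \<le> Q" if "x \<in> C" for x using C that by (simp add: Q_def)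
  \<comment> \<open>Modulo a prime beyond \<open>Max C\<close>, distinct elements of
    \<open>C\<close> stay distinct and nonzero, so every injective tuple is nonsingular. There are
    no further variables, hence the empty index set.\<close>
  obtain p where p: "prime p" "p > max Q k" using bigger_prime by blast
  have pf: "prime_factors p = {p}" using p by (simp add: prime_factorization_prime)
  have EZ: "energy (Z \<times> (({} :: nat set) \<rightarrow>\<^sub>E C)) V \<le> card Z * ((n * k + 1) ^ n) ^ card (prime_factors p) * energy (({} :: nat set) \<rightarrow>\<^sub>E C) (psum {h..k} ({} :: nat set))"
    unfolding V_def
  proof (rule energy_class_nonsing_le)
    show "Q < p ^ h" using p h self_le_power[of p h] prime_gt_0_nat[of p] by simp
    show "Z \<subseteq> {z \<in> {1..n} \<rightarrow>\<^sub>E {..Q}. nonsing p {1..n} z}"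
    proof
      fix z assume z: "z \<in> Z"
      then have zz: "z \<in> {1..n} \<rightarrow>\<^sub>E C" "inj_on z {1..n}" by (auto simp: Z_def)
      have zi: "z i \<in> C" if "i \<in> {1..n}" for i using zz that by auto
      have b: "z i > 0" "z i < p" if "i \<in> {1..n}" for i
        using Q[OF zi[OF that]] zi[OF that] C p by (auto simp: gr0_conv_Suc) (metis not0_implies_Suc)
      have "\<not> p dvd z i" if "i \<in> {1..n}" for i using b[OF that] by (auto dest: dvd_imp_le)
      moreover have "\<not> int p dvd int (z i) - int (z i')" if "i \<in> {1..n}" "i' \<in> {1..n}" "i \<noteq> i'" for i i'
      proof
        assume "int p dvd int (z i) - int (z i')"
        then have "int (z i) mod int p = int (z i') mod int p" by (simp add: mod_eq_dvd_iff)
        then have "z i = z i'" using b that by simp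
        then show False using inj_onD[OF zz(2)] that by blast
      qed
      moreover have "z \<in> {1..n} \<rightarrow>\<^sub>E {..Q}" using zz Q by (auto simp: PiE_iff)
      ultimately show "z \<in> {z \<in> {1..n} \<rightarrow>\<^sub>E {..Q}. nonsing p {1..n} z}" by (auto simp: nonsing_def pf)
    qed
  qed (use h p Suc.prems pf prime_gt_0_nat in \<open>auto simp: n_def\<close>)
  have "energy (({} :: nat set) \<rightarrow>\<^sub>E C) (psum {h..k} ({} :: nat set)) = 1"
    using J_0[of k h C] by (simp add: J_eq_energy)
  then have "real (energy (Z \<times> (({} :: nat set) \<rightarrow>\<^sub>E C)) V) \<le> real (card Z) * real ((n * k + 1) ^ n)"
    using EZ by (simp add: pf flip: of_nat_mult del: of_nat_power)
  also have "\<dots> \<le> X ^ n * K"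
  proof (rule mult_mono)
    show "real (card Z) \<le> X ^ n" using finZ(2) unfolding X_def by (metis of_nat_le_iff of_nat_power)
    have "(n * k + 1) ^ n \<le> (t * k + 1) ^ n" using Suc.prems by (intro power_mono add_right_mono mult_le_mono1) (auto simp: n_def)
    also have "\<dots> \<le> (t * k + 1) ^ t" using Suc.prems by (intro power_increasing) (auto simp: n_def)
    finally show "real ((n * k + 1) ^ n) \<le> K" unfolding K_def of_nat_le_iff .
  qed (use X in auto)
  finally have E1: "real (energy (Z \<times> (({} :: nat set) \<rightarrow>\<^sub>E C)) V) \<le> X ^ n * K" .
  have "real (energy N V) \<le> real (card {1..n}) ^ 4 * (real (card C) * real (J (card {1..n} + card ({} :: nat set) - 1) k h C))"
    unfolding N_def V_def by (rule energy_nondistinct_le') (use C in \<open>auto simp: n_def\<close>)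
  also have "\<dots> = real n ^ 4 * (X * real (J r k h C))" by (simp add: n_def X_def)
  also have "\<dots> \<le> real t ^ 4 * (X * ((4 * real t ^ 4) ^ r * K * X ^ r))"
    using Suc X unfolding K_def X_def by (intro mult_mono power_mono) (auto simp: n_def)
  finally have E2: "real (energy N V) \<le> real t ^ 4 * (X * ((4 * real t ^ 4) ^ r * K * X ^ r))" .
  have "real (J n k h C) = real (energy (({1..n} \<rightarrow>\<^sub>E C) \<times> (({} :: nat set) \<rightarrow>\<^sub>E C)) V)"
    unfolding V_def using C by (subst energy_pair_eq_J) auto
  also have "\<dots> \<le> real (card {0, 1 :: nat}) * (\<Sum>i\<in>{0, 1 :: nat}. real (energy (if i = 0 then Z \<times> (({} :: nat set) \<rightarrow>\<^sub>E C) else N) V))"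
  proof (rule energy_UN_le_card)
    show "finite (if i = 0 then Z \<times> (({} :: nat set) \<rightarrow>\<^sub>E C) else N)" for i :: nat
      using finZ finite_subset[of N "({1..n} \<rightarrow>\<^sub>E C) \<times> (({} :: nat set) \<rightarrow>\<^sub>E C)"] finP C by (auto simp: N_def)
  qed (auto simp: Z_def N_def)
  also have "\<dots> = 2 * (real (energy (Z \<times> (({} :: nat set) \<rightarrow>\<^sub>E C)) V) + real (energy N V))" by simp
  also have "\<dots> \<le> 2 * (X ^ n * K + real t ^ 4 * (X * ((4 * real t ^ 4) ^ r * K * X ^ r)))"
    using E1 E2 by simp
  \<comment> \<open>Half of the factor \<open>(4 * real t ^ 4) ^ n\<close> is used up by the
    coincidences; the other half is at least 2 and covers the distinct tuples.\<close>
  also have "\<dots> = X ^ n * K * (2 + (4 * real t ^ 4) ^ n / 2)"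
    by (simp add: n_def field_simps)
  also have "\<dots> \<le> X ^ n * K * (4 * real t ^ 4) ^ n"
  proof (rule mult_left_mono)
    have "(4::real) * 1 \<le> 4 * real t ^ 4" using t by (intro mult_left_mono one_le_power) auto
    then have "(4::real) ^ 1 \<le> (4 * real t ^ 4) ^ 1" by simp
    also have "\<dots> \<le> (4 * real t ^ 4) ^ n"
      using \<open>4 * 1 \<le> 4 * real t ^ 4\<close> by (intro power_increasing) (auto simp: n_def)
    finally show "2 + (4 * real t ^ 4) ^ n / 2 \<le> (4 * real t ^ 4) ^ n" by simp
  qed (use X K in auto)
  finally show ?case by (simp add: K_def X_def n_def mult_ac)
qed

text \<open>Tuples with repeated split variables and those with a bad variable are both bounded by
  multiples of the mean value with \<open>t + s - 1\<close> variables. Either the good tuples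
  dominate, or the last ratio is small and \<open>log_convex_bound\<close> descends to
  \<open>t\<close> variables.\<close>

lemma one_step:
  fixes w :: "nat \<Rightarrow> real"
  assumes h: "h \<ge> 1" "h + t = Suc k" and t: "t \<ge> 1" and s: "s \<ge> 1"
    and C: "finite C" "C \<noteq> {}" "\<And>x. x \<in> C \<Longrightarrow> x \<le> Q"
    and M: "finite M" "\<And>m. m \<in> M \<Longrightarrow> m > 0" "\<And>m p. m \<in> M \<Longrightarrow> p \<in> prime_factors m \<Longrightarrow> k < p"
      "\<And>m. m \<in> M \<Longrightarrow> Q < m ^ h"
    and w: "\<And>m. m \<in> M \<Longrightarrow> w m > 0" and b: "b \<ge> 1" and \<Gamma>: "\<Gamma> \<ge> 0"
    and bad: "\<And>z. z \<in> {1..t} \<rightarrow>\<^sub>E C \<Longrightarrow> inj_on z {1..t} \<Longrightarrow>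
      real (card {x\<in>C. \<not> (\<exists>m\<in>M. m dvd x \<and> nonsing m {1..t} z)}) \<le> b"
    and good: "\<And>m. m \<in> M \<Longrightarrow> real (card C) ^ t * real (((t * k + 1) ^ t) ^ card (prime_factors m))
        * real (J s k h {x\<in>C. m dvd x}) \<le> \<Gamma> * w m ^ (2 * s)"
  shows "real (J (t + s) k h C) \<le> 6 * real s * \<Gamma> * (\<Sum>m\<in>M. w m) ^ (2 * s) \<or>
    real (J (t + s) k h C) \<le> (6 * (real t ^ 4 + (real s)\<^sup>2) * real (card C) * b) ^ s * real (J t k h C)"
proof -
  define V where "V = pair_sum (psum {h..k} {1..t}) (psum {h..k} {1..s})"
  define X where "X = real (card C)"
  define N where "N = {(z, x). z \<in> {1..t} \<rightarrow>\<^sub>E C \<and> \<not> inj_on z {1..t} \<and> x \<in> {1..s} \<rightarrow>\<^sub>E C}"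
  define Bz where "Bz z = {x. inj_on z {1..t} \<and> \<not> (\<exists>m\<in>M. m dvd x \<and> nonsing m {1..t} z)}" for z
  define Bd where "Bd a = {(z, x). z \<in> {1..t} \<rightarrow>\<^sub>E C \<and> x \<in> {1..s} \<rightarrow>\<^sub>E C \<and> x a \<in> Bz z}" for a
  define Z where "Z m = {z \<in> {1..t} \<rightarrow>\<^sub>E C. nonsing m {1..t} z}" for m
  define G where "G = {(z, x). x \<in> {1..s} \<rightarrow>\<^sub>E C \<and> (\<forall>i\<in>{1..s}. \<exists>m\<in>M. m dvd x i \<and> z \<in> Z m)}"
  define J1 where "J1 = real (J (t + s - 1) k h C)"
  have X: "X \<ge> 1" using C by (simp add: X_def Suc_le_eq card_gt_0_iff)
  have J1: "J1 \<ge> 0" by (simp add: J1_def)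
  have fint: "finite ({1..t} \<rightarrow>\<^sub>E C)" and fins: "finite ({1..s} \<rightarrow>\<^sub>E C)" using C by (auto intro: finite_PiE)
  have finZ: "finite (Z m)" for m using fint by (simp add: Z_def)
  have fin: "finite (({1..t} \<rightarrow>\<^sub>E C) \<times> ({1..s} \<rightarrow>\<^sub>E C))" using fint fins by simp
  have sub: "N \<subseteq> ({1..t} \<rightarrow>\<^sub>E C) \<times> ({1..s} \<rightarrow>\<^sub>E C)" "Bd a \<subseteq> ({1..t} \<rightarrow>\<^sub>E C) \<times> ({1..s} \<rightarrow>\<^sub>E C)"
    "G \<subseteq> ({1..t} \<rightarrow>\<^sub>E C) \<times> ({1..s} \<rightarrow>\<^sub>E C)" for a
    using s by (auto simp: N_def Bd_def G_def Z_def)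
  note finNBG = sub[THEN finite_subset, OF fin]
  have EN: "real (energy N V) \<le> real t ^ 4 * (X * b * J1)"
  proof -
    have "real (energy N V) \<le> real (card {1..t}) ^ 4 * (real (card C) * real (J (card {1..t} + card {1..s} - 1) k h C))"
      unfolding N_def V_def by (rule energy_nondistinct_le') (use C t in auto)
    also have "\<dots> = real t ^ 4 * (X * 1 * J1)" by (simp add: X_def J1_def)
    also have "\<dots> \<le> real t ^ 4 * (X * b * J1)" using b X J1 by (intro mult_left_mono mult_right_mono) auto
    finally show ?thesis .
  qed
  have EBa: "real (energy (Bd a) V) \<le> X * b * J1" if "a \<in> {1..s}" for a
  proof -
    have "real (energy (Bd a) V) \<le> real (card C) * b * real (J (card {1..t} + card {1..s} - 1) k h C)"
      unfolding Bd_def V_def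
    proof (rule energy_bad_le)
      fix z assume z: "z \<in> {1..t} \<rightarrow>\<^sub>E C"
      show "real (card {c \<in> C. c \<in> Bz z}) \<le> b"
        using bad[OF z] b by (cases "inj_on z {1..t}") (auto simp: Bz_def)
    qed (use C that in auto)
    then show ?thesis by (simp add: X_def J1_def)
  qed
  have EB: "real (energy (\<Union>a\<in>{1..s}. Bd a) V) \<le> (real s)\<^sup>2 * (X * b * J1)"
  proof -
    have "real (energy (\<Union>a\<in>{1..s}. Bd a) V) \<le> real (card {1..s}) * (\<Sum>a\<in>{1..s}. real (energy (Bd a) V))"
      by (rule energy_UN_le_card) (use finNBG in auto)
    also have "\<dots> \<le> real (card {1..s}) * (\<Sum>a\<in>{1..s}. X * b * J1)"
      using EBa by (intro mult_left_mono sum_mono) auto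
    finally show ?thesis by (simp add: power2_eq_square)
  qed
  have EG: "real (energy G V) \<le> real s * \<Gamma> * (\<Sum>m\<in>M. w m) ^ (2 * s)"
    unfolding G_def V_def
  proof (rule energy_good_le)
    fix m assume m: "m \<in> M"
    define S where "S = {1..s} \<rightarrow>\<^sub>E {x\<in>C. m dvd x}"
    have finS: "finite S" unfolding S_def using C by (intro finite_PiE) auto
    have "energy (Z m \<times> S) (pair_sum (psum {h..k} {1..t}) (psum {h..k} {1..s}))
        \<le> card (Z m) * ((t * k + 1) ^ t) ^ card (prime_factors m) * energy S (psum {h..k} {1..s})"
    proof (rule energy_class_nonsing_le)
      show "Z m \<subseteq> {z \<in> {1..t} \<rightarrow>\<^sub>E {..Q}. nonsing m {1..t} z}" using C(3) by (auto simp: Z_def PiE_iff)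
      show "m dvd x i" if "x \<in> S" "i \<in> {1..s}" for x i
        using PiE_mem[of x "{1..s}" _ i] that unfolding S_def by blast
    qed (use h m M finS in auto)
    also have "\<dots> \<le> card C ^ t * ((t * k + 1) ^ t) ^ card (prime_factors m) * J s k h {x\<in>C. m dvd x}"
    proof (intro mult_le_mono)
      have "card (Z m) \<le> card ({1..t} \<rightarrow>\<^sub>E C)" using fint by (intro card_mono) (auto simp: Z_def)
      then show "card (Z m) \<le> card C ^ t" by (simp add: card_PiE)
    qed (auto simp: S_def J_eq_energy)
    finally have "real (energy (Z m \<times> S) (pair_sum (psum {h..k} {1..t}) (psum {h..k} {1..s})))
        \<le> real (card C ^ t * ((t * k + 1) ^ t) ^ card (prime_factors m) * J s k h {x\<in>C. m dvd x})"
      by (rule of_nat_mono)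
    also have "\<dots> \<le> \<Gamma> * w m ^ (2 * s)" using good[OF m] by simp
    finally show "real (energy (Z m \<times> ({1..s} \<rightarrow>\<^sub>E {x \<in> C. m dvd x})) (pair_sum (psum {h..k} {1..t}) (psum {h..k} {1..s}))) \<le> \<Gamma> * w m ^ (2 * s)"
      by (simp add: S_def)
  qed (use C M w s finZ \<Gamma> in \<open>auto simp: vanish_off_psum\<close>)
  have "real (J (t + s) k h C) = real (energy (({1..t} \<rightarrow>\<^sub>E C) \<times> ({1..s} \<rightarrow>\<^sub>E C)) V)"
    unfolding V_def using C by (subst energy_pair_eq_J) auto
  also have "\<dots> \<le> real (card {0, 1, 2 :: nat}) * (\<Sum>i\<in>{0, 1, 2 :: nat}. real (energy (if i = 0 then N else if i = 1 then (\<Union>a\<in>{1..s}. Bd a) else G) V))"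
  proof (rule energy_UN_le_card)
    show "({1..t} \<rightarrow>\<^sub>E C) \<times> ({1..s} \<rightarrow>\<^sub>E C) \<subseteq> (\<Union>i\<in>{0, 1, 2 :: nat}. if i = 0 then N else if i = 1 then (\<Union>a\<in>{1..s}. Bd a) else G)"
    proof safe
      fix z x assume zx: "z \<in> {1..t} \<rightarrow>\<^sub>E C" "x \<in> {1..s} \<rightarrow>\<^sub>E C"
      have "(z, x) \<in> N \<or> (\<exists>a\<in>{1..s}. (z, x) \<in> Bd a) \<or> (z, x) \<in> G"
        unfolding N_def Bd_def G_def Bz_def Z_def using zx by blast
      then show "(z, x) \<in> (\<Union>i\<in>{0, 1, 2 :: nat}. if i = 0 then N else if i = 1 then (\<Union>a\<in>{1..s}. Bd a) else G)"
        by auto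
    qed
  qed (use finNBG in auto)
  also have "\<dots> = 3 * (real (energy N V) + real (energy (\<Union>a\<in>{1..s}. Bd a) V) + real (energy G V))" by simp
  also have "\<dots> \<le> 3 * ((real t ^ 4 + (real s)\<^sup>2) * (X * b * J1)) + 3 * (real s * \<Gamma> * (\<Sum>m\<in>M. w m) ^ (2 * s))"
    using EN EB EG by (simp add: algebra_simps)
  finally have main: "real (J (t + s) k h C) \<le> 3 * ((real t ^ 4 + (real s)\<^sup>2) * (X * b * J1)) + 3 * (real s * \<Gamma> * (\<Sum>m\<in>M. w m) ^ (2 * s))" .
  show ?thesis
  proof (cases "real (J (t + s) k h C) \<le> 6 * real s * \<Gamma> * (\<Sum>m\<in>M. w m) ^ (2 * s)")
    case False
    then have le: "real (J (t + s) k h C) \<le> 6 * (real t ^ 4 + (real s)\<^sup>2) * X * b * J1"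
    proof -
      define T where "T = real s * \<Gamma> * (\<Sum>m\<in>M. w m) ^ (2 * s)"
      have "6 * real s * \<Gamma> * (\<Sum>m\<in>M. w m) ^ (2 * s) = 6 * T" by (simp add: T_def)
      then have "real (J (t + s) k h C) \<le> 6 * ((real t ^ 4 + (real s)\<^sup>2) * (X * b * J1))"
        using main False unfolding T_def [symmetric] by linarith
      then show ?thesis by (simp only: mult.assoc)
    qed
    define n where "n = t + s - 1"
    have n: "t + s = Suc n" using s by (simp add: n_def)
    have "real (J (Suc n) k h C) \<le> (6 * (real t ^ 4 + (real s)\<^sup>2) * X * b) ^ (Suc n - t) * real (J t k h C)"
    proof (rule log_convex_bound[where a = "\<lambda>i. real (J i k h C)", OF J_pos[OF C(1,2)] J_log_convex[OF C(1)]])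
      show "real (J (Suc n) k h C) \<le> 6 * (real t ^ 4 + (real s)\<^sup>2) * X * b * real (J n k h C)"
        using le by (simp add: n J1_def)
    qed (use n s in auto)
    moreover have "Suc n - t = s" using n by simp
    ultimately show ?thesis by (simp add: n X_def)
  qed simp
qed

text \<open>Write \<open>x = b * a\<close> with \<open>b\<close> its largest divisor free of
  singular primes. Then \<open>a\<close> consists of singular primes, and \<open>b > U\<close> would
  yield a nonsingular modulus in \<open>(U, U * R]\<close>, so at most \<open>U\<close> values of
  \<open>b\<close> occur.\<close>

lemma card_nonsingular_free_le:
  fixes z :: "nat \<Rightarrow> nat"
  assumes R: "R > 1" and U: "U \<ge> 1" and \<xi>: "0 < \<xi>" "\<xi> < 1" and y: "y \<ge> 0"
    and z: "z \<in> {1..t} \<rightarrow>\<^sub>E smooth_set (R powr y) R" "inj_on z {1..t}"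
  defines "M \<equiv> {m \<in> smooth_set (U * R) R. U < real m}"
  shows "real (card {x \<in> smooth_set (R powr y) R. \<not> (\<exists>m\<in>M. m dvd x \<and> nonsing m {1..t} z)})
    \<le> \<xi> powr (- 2 * y) * (1 / (1 - \<xi>)) powr (2 * (real t)\<^sup>2 * y) * U"
proof -
  define C where "C = smooth_set (R powr y) R"
  \<comment> \<open>Pairs index all relevant quantities at once: the diagonal stands for the
    \<open>z i\<close>, the rest for their differences.\<close>
  define n where "n q = (if fst q = snd q then z (fst q) else nat \<bar>int (z (fst q)) - int (z (snd q))\<bar>)" for q :: "nat \<times> nat"
  define I where "I = {1..t} \<times> {1..t}"
  define S where "S q = {p \<in> smooth_primes R. p dvd n q}" for q
  define Sz where "Sz = (\<Union>q\<in>I. S q)"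
  have zC: "z i \<in> C" if "i \<in> {1..t}" for i using PiE_mem[OF z(1) that] by (simp add: C_def)
  have zb: "0 < z i" "real (z i) \<le> R powr y" if "i \<in> {1..t}" for i
    using zC[OF that] by (auto simp: C_def smooth_set_iff)
  have nq: "0 < n q" "real (n q) \<le> R powr y" if "q \<in> I" for q
  proof -
    have i: "fst q \<in> {1..t}" "snd q \<in> {1..t}" using that by (auto simp: I_def)
    have "z (fst q) \<noteq> z (snd q)" if "fst q \<noteq> snd q" using inj_onD[OF z(2)] i that by blast
    then show "0 < n q" using zb[OF i(1)] by (auto simp: n_def)
    have "real (n q) \<le> max (real (z (fst q))) (real (z (snd q)))" by (auto simp: n_def)
    then show "real (n q) \<le> R powr y" using zb[OF i(1)] zb[OF i(2)] by linarith
  qed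
  have finS: "finite (S q)" for q unfolding S_def using finite_smooth_primes by simp
  have finI: "finite I" by (simp add: I_def)
  have finSz: "finite Sz" unfolding Sz_def using finI finS by auto
  have cardSz: "real (card Sz) \<le> 2 * (real t)\<^sup>2 * y"
  proof -
    have "card Sz \<le> (\<Sum>q\<in>I. card (S q))" unfolding Sz_def using finI by (rule card_UN_le)
    then have "real (card Sz) \<le> (\<Sum>q\<in>I. real (card (S q)))" using of_nat_mono by fastforce
    also have "\<dots> \<le> (\<Sum>q\<in>I. 2 * y)"
      by (intro sum_mono card_large_prime_divisors_le[OF R nq finS]) (auto simp: S_def smooth_primes_def)
    also have "\<dots> = 2 * (real t)\<^sup>2 * y" by (simp add: I_def card_cartesian_product power2_eq_square)
    finally show ?thesis .
  qed
  have ns: "nonsing m {1..t} z" if "prime_factors m \<subseteq> smooth_primes R" "prime_factors m \<inter> Sz = {}" for m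
    unfolding nonsing_def
  proof (intro ballI conjI impI)
    fix p i assume p: "p \<in> prime_factors m" and i: "i \<in> {1..t}"
    have pS: "p \<notin> S q" if "q \<in> I" for q
      using \<open>prime_factors m \<inter> Sz = {}\<close> p that unfolding Sz_def by blast
    have "p \<notin> S (i, i)" using i by (intro pS) (auto simp: I_def)
    then show "\<not> p dvd z i" using that p by (auto simp: S_def n_def)
    fix i' assume i': "i' \<in> {1..t}" "i \<noteq> i'"
    have "p \<notin> S (i, i')" using i i' by (intro pS) (auto simp: I_def)
    then have "\<not> p dvd nat \<bar>int (z i) - int (z i')\<bar>" using that p i' by (auto simp: S_def n_def)
    then show "\<not> int p dvd int (z i) - int (z i')" using int_dvd_int_iff[of p "nat \<bar>int (z i) - int (z i')\<bar>"] by simp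
  qed
  define A where "A = {a. 0 < a \<and> real a \<le> R powr y \<and> prime_factors a \<subseteq> Sz}"
  have finA: "finite A"
    by (rule finite_subset[of _ "{..nat \<lfloor>R powr y\<rfloor>}"]) (auto simp: A_def le_nat_floor)
  define u where "u = nat \<lfloor>U\<rfloor>"
  have sub: "{x \<in> C. \<not> (\<exists>m\<in>M. m dvd x \<and> nonsing m {1..t} z)} \<subseteq> (\<lambda>(a, b). a * b) ` (A \<times> {1..u})"
  proof
    fix x assume "x \<in> {x \<in> C. \<not> (\<exists>m\<in>M. m dvd x \<and> nonsing m {1..t} z)}"
    then have x: "x \<in> C" and nm: "\<And>m. m \<in> M \<Longrightarrow> m dvd x \<Longrightarrow> \<not> nonsing m {1..t} z" by auto
    have xC: "0 < x" "real x \<le> R powr y" "prime_factors x \<subseteq> smooth_primes R"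
      using x by (auto simp: C_def smooth_set_iff)
    define Dv where "Dv = {d. d dvd x \<and> prime_factors d \<inter> Sz = {}}"
    have finD: "finite Dv" unfolding Dv_def by (rule finite_subset[of _ "{d. d dvd x}"]) (use xC in auto)
    have "1 \<in> Dv" by (simp add: Dv_def)
    define b where "b = Max Dv"
    have b: "b \<in> Dv" "\<And>d. d \<in> Dv \<Longrightarrow> d \<le> b" unfolding b_def using finD \<open>1 \<in> Dv\<close> by (auto intro: Max_in)
    then obtain a where a: "x = b * a" by (auto simp: Dv_def)
    have ab0: "a > 0" "b > 0" using xC a by auto
    have "prime_factors a \<subseteq> Sz"
    proof
      fix p assume p: "p \<in> prime_factors a"
      then obtain c where c: "a = p * c" by (auto simp: prime_factors_dvd)
      have pp: "prime p" using p by auto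
      show "p \<in> Sz"
      proof (rule ccontr)
        assume "p \<notin> Sz"
        have "prime_factors (b * p) = prime_factors b \<union> {p}"
          using ab0 pp prime_gt_0_nat[OF pp] by (simp add: prime_factorization_mult prime_factorization_prime)
        then have "b * p \<in> Dv" using b(1) \<open>p \<notin> Sz\<close> a c by (auto simp: Dv_def mult.assoc)
        then have "b * p \<le> b" by (rule b(2))
        then show False using ab0 prime_gt_1_nat[OF pp] by simp
      qed
    qed
    moreover have "a \<le> x" using a ab0 by simp
    ultimately have "a \<in> A" using ab0 xC by (auto simp: A_def)
    moreover have "real b \<le> U"
    proof (rule ccontr)
      assume "\<not> real b \<le> U"
      define Ev where "Ev = {d. d dvd b \<and> U < real d}"
      have finE: "finite Ev" unfolding Ev_def by (rule finite_subset[of _ "{d. d dvd b}"]) (use ab0 in auto)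
      have "b \<in> Ev" using \<open>\<not> real b \<le> U\<close> by (simp add: Ev_def)
      \<comment> \<open>The least divisor of \<open>b\<close> above \<open>U\<close>: dropping one
        prime factor, which is at most \<open>R\<close>, falls to \<open>U\<close> or below, so
        \<open>m <= U * R\<close>.\<close>
      define m where "m = Min Ev"
      have m: "m \<in> Ev" "\<And>d. d \<in> Ev \<Longrightarrow> m \<le> d" unfolding m_def using finE \<open>b \<in> Ev\<close> by (auto intro: Min_in)
      have mb: "m dvd b" "U < real m" using m by (auto simp: Ev_def)
      have m0: "m > 1" using mb U by linarith
      then obtain p where p: "prime p" "p dvd m" using prime_factor_nat by (metis less_numeral_extra(4))
      then obtain c where c: "m = p * c" by auto
      have c0: "c > 0" using m0 c by (cases c) auto
      have mx: "m dvd x" using mb a by auto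
      have pfm: "prime_factors m \<subseteq> prime_factors b" using mb ab0 by (intro dvd_prime_factors) auto
      have pfx: "prime_factors m \<subseteq> smooth_primes R"
        using dvd_prime_factors[of x m] mx xC by auto
      have "c < m" using c c0 prime_gt_1_nat[OF p(1)] by simp
      then have "c \<notin> Ev" using m(2) by force
      then have "real c \<le> U" using mb c by (auto simp: Ev_def dest: dvd_mult_right)
      moreover have "real p \<le> R" using p m0 pfx by (auto simp: prime_factors_dvd smooth_primes_def)
      ultimately have "real m \<le> U * R" using c U by (simp add: mult.commute[of "real p"] mult_mono)
      then have "m \<in> M" using mb pfx m0 by (simp add: M_def smooth_set_iff)
      moreover have "nonsing m {1..t} z" using pfx pfm b(1) by (intro ns) (auto simp: Dv_def)
      ultimately show False using nm mx by blast
    qed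
    then have "b \<in> {1..u}" using ab0 by (simp add: u_def le_nat_floor)
    ultimately show "x \<in> (\<lambda>(a, b). a * b) ` (A \<times> {1..u})" using a by (intro image_eqI[of _ _ "(a, b)"]) auto
  qed
  have "card {x \<in> C. \<not> (\<exists>m\<in>M. m dvd x \<and> nonsing m {1..t} z)} \<le> card (A \<times> {1..u})"
    using surj_card_le[OF _ sub] finA by auto
  then have "real (card {x \<in> C. \<not> (\<exists>m\<in>M. m dvd x \<and> nonsing m {1..t} z)}) \<le> real (card A) * real u"
    using of_nat_mono[of _ "card (A \<times> {1..u})"] by (fastforce simp: card_cartesian_product)
  also have "\<dots> \<le> (\<xi> powr (- 2 * y) * (1 / (1 - \<xi>)) powr (2 * (real t)\<^sup>2 * y)) * U"
  proof (rule mult_mono)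
    have "real (card A) \<le> \<xi> powr (- 2 * y) * (1 / (1 - \<xi>)) ^ card Sz"
      unfolding A_def by (rule card_supported_le[OF R \<xi> finSz]) (auto simp: Sz_def S_def smooth_primes_def)
    also have "(1 / (1 - \<xi>)) ^ card Sz = (1 / (1 - \<xi>)) powr real (card Sz)" using \<xi> by (simp add: powr_realpow)
    also have "\<dots> \<le> (1 / (1 - \<xi>)) powr (2 * (real t)\<^sup>2 * y)" using \<xi> cardSz by (intro powr_mono) (auto simp: field_simps)
    finally show "real (card A) \<le> \<xi> powr (- 2 * y) * (1 / (1 - \<xi>)) powr (2 * (real t)\<^sup>2 * y)"
      by (simp add: mult_left_mono)
    show "real u \<le> U" unfolding u_def using U by linarith
  qed auto
  finally show ?thesis by (simp add: C_def)
qed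

text \<open>The equations are homogeneous, so the common factor \<open>m\<close> can be divided
  out.\<close>

lemma J_multiples_le:
  assumes m: "m > 0"
  shows "J s k h {x \<in> smooth_set Q R. m dvd x} \<le> J s k h (smooth_set (Q / real m) R)"
proof -
  define f where "f x = (\<lambda>i\<in>{1..s}. x i div m)" for x :: "nat \<Rightarrow> nat"
  define S where "S = {1..s} \<rightarrow>\<^sub>E {x \<in> smooth_set Q R. m dvd x}"
  define T where "T = {1..s} \<rightarrow>\<^sub>E smooth_set (Q / real m) R"
  show ?thesis unfolding J_eq_energy S_def [symmetric] T_def [symmetric]
  proof (rule energy_inj_le[of _ f])
    show "finite T" unfolding T_def using finite_smooth_set by (intro finite_PiE) auto
    have mem: "x div m \<in> smooth_set (Q / real m) R" if x: "x \<in> smooth_set Q R" "m dvd x" for x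
    proof -
      obtain c where c: "x = m * c" using x(2) by auto
      have xx: "0 < x" "real x \<le> Q" "prime_factors x \<subseteq> smooth_primes R" using x by (auto simp: smooth_set_iff)
      have "prime_factors c \<subseteq> prime_factors x" using c xx by (intro dvd_prime_factors) auto
      then show ?thesis using c xx m by (auto simp: smooth_set_iff field_simps)
    qed
    show "f ` S \<subseteq> T"
    proof (rule image_subsetI)
      fix x assume "x \<in> S"
      then have "x i div m \<in> smooth_set (Q / real m) R" if "i \<in> {1..s}" for i
        using PiE_mem[of x "{1..s}" _ i] that mem unfolding S_def by blast
      then show "f x \<in> T" unfolding f_def T_def restrict_PiE_iff by blast
    qed
    have mult: "x i = m * f x i" if "x \<in> S" "i \<in> {1..s}" for x i
    proof -
      have "m dvd x i" using PiE_mem[of x "{1..s}" _ i] that unfolding S_def by blast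
      then show ?thesis using that by (simp add: f_def)
    qed
    show "inj_on f S"
    proof (rule inj_onI)
      fix x x' assume x: "x \<in> S" "x' \<in> S" "f x = f x'"
      show "x = x'"
        by (rule PiE_ext[OF x(1,2)[unfolded S_def]]) (use mult[OF x(1)] mult[OF x(2)] x(3) in metis)
    qed
    fix x x' assume x: "x \<in> S" "x' \<in> S"
      and eq: "psum {h..k} {1..s} x = psum {h..k} {1..s} x'"
    have ps: "psum {h..k} {1..s} x j = int m ^ j * psum {h..k} {1..s} (f x) j" if "x \<in> S" for x j
    proof -
      have "(\<Sum>i\<in>{1..s}. int (x i) ^ j) = (\<Sum>i\<in>{1..s}. int m ^ j * int (f x i) ^ j)"
      proof (rule sum.cong)
        fix i assume "i \<in> {1..s}"
        then have "int (x i) = int m * int (f x i)" using mult[OF that] by (metis of_nat_mult)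
        then show "int (x i) ^ j = int m ^ j * int (f x i) ^ j" by (simp add: power_mult_distrib)
      qed simp
      then show ?thesis by (simp add: psum_def sum_distrib_left)
    qed
    have "psum {h..k} {1..s} (f x) j = psum {h..k} {1..s} (f x') j" for j
      using fun_cong[OF eq, of j] unfolding ps[OF x(1)] ps[OF x(2)] using m by simp
    then show "psum {h..k} {1..s} (f x) = psum {h..k} {1..s} (f x')" by (rule ext)
  qed
qed

section \<open>The differencing step for smooth numbers\<close>

lemma one_mem_smooth_set: "1 \<le> P \<Longrightarrow> 1 \<in> smooth_set P R"
  by (simp add: smooth_set_iff)

text \<open>With \<open>\<xi> = 16 / k^2\<close>, the first factor is
  \<open>exp (4 * y * ln k - 2 * y * ln 16)\<close> and \<open>ln 16 >= 2\<close>. The second is at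
  most \<open>exp y\<close>, because \<open>t <= 0.12 * k\<close> keeps
  \<open>2 * t^2 * \<xi>\<close> below 1/2. The spare \<open>exp (- 3 * y)\<close> later absorbs
  polynomial factors.\<close>

lemma rankin_constant_le:
  assumes k: "k \<ge> (60::real)" and t: "0 \<le> t" "t \<le> 0.12 * k" and y: "y \<ge> 0"
  shows "(16 / k\<^sup>2) powr (- 2 * y) * (1 / (1 - 16 / k\<^sup>2)) powr (2 * t\<^sup>2 * y) \<le> exp (4 * y * ln k - 3 * y)"
proof -
  define \<xi> where "\<xi> = 16 / k\<^sup>2"
  have "(60::real)\<^sup>2 \<le> k\<^sup>2" using k by (intro power_mono) auto
  then have k2: "k\<^sup>2 \<ge> 3600" by simp
  have \<xi>: "0 < \<xi>" "\<xi> \<le> 16 / 3600" unfolding \<xi>_def using k2 k by (auto intro!: divide_left_mono)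
  have ln\<xi>: "ln \<xi> = ln 16 - 2 * ln k" using k by (simp add: \<xi>_def ln_div ln_realpow)
  have "exp 2 = exp (1::real) ^ 2" by (simp add: exp_of_nat_mult [symmetric])
  also have "\<dots> \<le> 2.72 ^ 2" using e_less_272 by (intro power_mono) auto
  finally have "exp 2 \<le> (16::real)" by (simp add: power2_eq_square)
  then have ln16: "ln 16 \<ge> (2::real)" by (subst ln_ge_iff) auto
  have 1: "\<xi> powr (- 2 * y) \<le> exp (4 * y * ln k - 4 * y)"
  proof -
    have "\<xi> powr (- 2 * y) = exp (4 * y * ln k - 2 * y * ln 16)"
      using \<xi> by (simp add: powr_def ln\<xi> algebra_simps)
    also have "\<dots> \<le> exp (4 * y * ln k - 4 * y)"
      using mult_left_mono[OF ln16, of "2 * y"] y by simp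
    finally show ?thesis .
  qed
  have 2: "(1 / (1 - \<xi>)) powr (2 * t\<^sup>2 * y) \<le> exp y"
  proof -
    have "ln (1 / (1 - \<xi>)) \<le> 1 / (1 - \<xi>) - 1" using \<xi> by (intro ln_le_minus_one) auto
    also have "\<dots> = \<xi> / (1 - \<xi>)" using \<xi> by (simp add: field_simps)
    also have "\<dots> \<le> \<xi> / (3584 / 3600)" using \<xi> by (intro divide_left_mono) auto
    finally have l: "ln (1 / (1 - \<xi>)) \<le> \<xi> * 3600 / 3584" by simp
    have "t\<^sup>2 \<le> (0.12 * k)\<^sup>2" using t by (intro power_mono) auto
    then have "2 * t\<^sup>2 * y * ln (1 / (1 - \<xi>)) \<le> 2 * (0.12 * k)\<^sup>2 * y * (\<xi> * 3600 / 3584)"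
      using l y \<xi> by (intro mult_mono) auto
    also have "\<dots> = y * (2 * 0.0144 * 16 * 3600 / 3584)" using k by (simp add: \<xi>_def power2_eq_square field_simps)
    also have "\<dots> \<le> y * 1" using y by (intro mult_left_mono) auto
    finally show ?thesis using \<xi> by (simp add: powr_def)
  qed
  have "\<xi> powr (- 2 * y) * (1 / (1 - \<xi>)) powr (2 * t\<^sup>2 * y) \<le> exp (4 * y * ln k - 4 * y) * exp y"
    using 1 2 by (intro mult_mono) auto
  also have "\<dots> = exp (4 * y * ln k - 3 * y)" by (simp add: exp_add [symmetric])
  finally show ?thesis by (simp add: \<xi>_def)
qed

text \<open>The dichotomy of \<open>one_step\<close> in logarithmic form, given a bound for
  \<open>s\<close> variables that grows like the height to the power \<open>E\<close>. The lower
  limit for \<open>y'\<close> reflects the largest admissible modulus.\<close>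

lemma ln_J_step:
  fixes h k s t :: nat and y R E c0 :: real
  assumes h: "h \<ge> 1" "h + t = Suc k" and t: "t \<ge> 1" "real t \<le> (12 / 100) * real k" and s: "s \<ge> 1"
    and k: "k \<ge> 60" and R: "ln R \<ge> 40" "R > 0" "real k \<le> sqrt R" "200 \<le> sqrt R"
    and y: "1.05 \<le> y" "200 * y \<le> sqrt R" and E: "0 \<le> E" "E \<le> 2 * real s"
    and IH: "\<And>y'. (1 - 1 / real h) * y - 1 \<le> y' \<Longrightarrow> y' \<le> y \<Longrightarrow>
        real (J s k h (smooth_set (R powr y') R)) \<le> exp (c0 + y' * ln R * E)"
  defines "x \<equiv> y * ln R + y * ln (2.86 / y)"
  shows "ln (real (J (t + s) k h (smooth_set (R powr y) R)))
       \<le> ln (6 * real s) + real t * x + 4 * real t * ln (real k) * (y / real h + 1) + c0 + y * ln R * E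
         + (2 * real s - E) * (y / real h + 1) * ln R + (21 / 10) * real s
   \<or> ln (real (J (t + s) k h (smooth_set (R powr y) R)))
       \<le> real s * (ln (6 * (real t ^ 4 + (real s)\<^sup>2)) + x + 4 * y * ln (real k) - 3 * y + y / real h * ln R)
         + real t * (ln (4 * real t ^ 4) + 2 * ln (real k) + x)"
proof -
  define C where "C = smooth_set (R powr y) R"
  define U where "U = R powr (y / real h)"
  define M where "M = {m \<in> smooth_set (U * R) R. U < real m}"
  \<comment> \<open>Dividing the height by \<open>m\<close> multiplies the inductive bound by
    \<open>m powr (- E)\<close>, which is exactly \<open>w m ^ (2 * s)\<close> for weights
    \<open>m powr (- \<theta>)\<close>; hence \<open>\<Gamma>\<close> does not depend on
    \<open>m\<close>.\<close>
  define \<theta> where "\<theta> = E / (2 * real s)"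
  define w where "w m = real m powr (- \<theta>)" for m :: nat
  define \<kappa> where "\<kappa> = 4 * real t * ln (real k) * (y / real h + 1)"
  define \<Gamma> where "\<Gamma> = exp (real t * x + \<kappa> + c0 + y * ln R * E)"
  define b where "b = exp (4 * y * ln (real k) - 3 * y + y / real h * ln R)"
  define Q where "Q = nat \<lfloor>R powr y\<rfloor>"
  have R1: "R > 1" using R(1,2) ln_le_zero_iff[of R] by linarith
  have y0: "y > 0" using y by simp
  have U: "U \<ge> 1" unfolding U_def using R1 y0 by (intro ge_one_powr_ge_zero) auto
  have R1y: "R powr y \<ge> 1" using R1 y0 by (intro ge_one_powr_ge_zero) auto
  have finC: "finite C" unfolding C_def by (rule finite_smooth_set)
  have neC: "C \<noteq> {}" unfolding C_def using one_mem_smooth_set[OF R1y] by blast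
  have cardC: "real (card C) \<le> exp x" "real (card C) \<ge> 1"
  proof -
    have "real (card C) \<le> R powr y * (2.86 / y) powr y"
      unfolding C_def by (rule card_smooth_set_le) (use R y in auto)
    also have "\<dots> = exp x" unfolding x_def using R1 y0 by (simp add: powr_def exp_add mult.commute)
    finally show "real (card C) \<le> exp x" .
    show "real (card C) \<ge> 1" using finC neC by (simp add: Suc_le_eq card_gt_0_iff)
  qed
  have Mprop: "m > 0" "U < real m" "real m \<le> U * R" "prime_factors m \<subseteq> smooth_primes R" if "m \<in> M" for m
    using that by (auto simp: M_def smooth_set_iff)
  have finM: "finite M" unfolding M_def using finite_smooth_set by simp
  have lnk: "ln (real k) \<ge> 0" using k by simp
  have tk: "real (t * k + 1) \<le> real k ^ 2"
  proof -
    have "real t * real k \<le> (12 / 100) * real k * real k" using t by (intro mult_right_mono) auto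
    moreover have "1 \<le> 0.88 * real k * real k"
      using k mult_mono[of 60 "real k" 60 "real k"] by simp
    ultimately show ?thesis by (simp add: power2_eq_square)
  qed
  have b1: "b \<ge> 1"
  proof -
    have "1 \<le> ln (real k)" using k e_less_272 by (subst ln_ge_iff) auto
    then have "y * 3 \<le> y * (4 * ln (real k))" using y0 by (intro mult_left_mono) auto
    moreover have "0 \<le> y / real h * ln R" using y0 R(1) by (intro mult_nonneg_nonneg) auto
    ultimately have "0 \<le> 4 * y * ln (real k) - 3 * y + y / real h * ln R" by linarith
    then show ?thesis unfolding b_def one_le_exp_iff .
  qed
  have step: "real (J (t + s) k h C) \<le> 6 * real s * \<Gamma> * (\<Sum>m\<in>M. w m) ^ (2 * s) \<or>
      real (J (t + s) k h C) \<le> (6 * (real t ^ 4 + (real s)\<^sup>2) * real (card C) * b) ^ s * real (J t k h C)"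
  proof (rule one_step[OF h t(1) s finC neC])
    show "x \<le> Q" if "x \<in> C" for x using that by (auto simp: C_def smooth_set_iff Q_def le_nat_floor)
    show "finite M" by (rule finM)
    show "m > 0" if "m \<in> M" for m using Mprop[OF that] by simp
    show "k < p" if "m \<in> M" "p \<in> prime_factors m" for m p
    proof -
      have "sqrt R < real p" using Mprop(4)[OF that(1)] that(2) by (auto simp: smooth_primes_def)
      then show ?thesis using R(3) by linarith
    qed
    show "Q < m ^ h" if "m \<in> M" for m
    proof -
      have "real Q \<le> R powr y" unfolding Q_def using R1y by linarith
      also have "\<dots> = U ^ h" unfolding U_def using h R1 by (simp add: powr_powr flip: powr_realpow)
      also have "\<dots> < real m ^ h" using Mprop[OF that] U h by (intro power_strict_mono) auto
      finally show ?thesis by (simp only: of_nat_power [symmetric] of_nat_less_iff)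
    qed
    show "w m > 0" if "m \<in> M" for m using Mprop[OF that] by (simp add: w_def)
    show "b \<ge> 1" by (rule b1)
    show "\<Gamma> \<ge> 0" by (simp add: \<Gamma>_def)
    show "real (card {x \<in> C. \<not> (\<exists>m\<in>M. m dvd x \<and> nonsing m {1..t} z)}) \<le> b"
      if z: "z \<in> {1..t} \<rightarrow>\<^sub>E C" "inj_on z {1..t}" for z
    proof -
      have "(60::real)\<^sup>2 \<le> (real k)\<^sup>2" using k by (intro power_mono) auto
      then have "(real k)\<^sup>2 > 16" by simp
      then have \<xi>: "0 < 16 / (real k)\<^sup>2" "16 / (real k)\<^sup>2 < 1" using k by (simp_all add: pos_divide_less_eq)
      have "real (card {x \<in> C. \<not> (\<exists>m\<in>M. m dvd x \<and> nonsing m {1..t} z)})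
          \<le> (16 / (real k)\<^sup>2) powr (- 2 * y) * (1 / (1 - 16 / (real k)\<^sup>2)) powr (2 * (real t)\<^sup>2 * y) * U"
        unfolding C_def M_def by (rule card_nonsingular_free_le) (use R1 U \<xi> y0 z in \<open>auto simp: C_def\<close>)
      also have "\<dots> \<le> exp (4 * y * ln (real k) - 3 * y) * U"
        by (intro mult_right_mono rankin_constant_le) (use k t y0 U in auto)
      also have "\<dots> = b" using R1 by (simp add: b_def U_def powr_def exp_add)
      finally show ?thesis .
    qed
    show "real (card C) ^ t * real (((t * k + 1) ^ t) ^ card (prime_factors m)) * real (J s k h {x \<in> C. m dvd x})
        \<le> \<Gamma> * w m ^ (2 * s)" if m: "m \<in> M" for m
    proof -
      note mm = Mprop[OF m]
      define y' where "y' = y - ln (real m) / ln R"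
      have lnR: "ln R > 0" using R by linarith
      have mle: "real m \<le> R powr (y / real h + 1)" using mm(3) R1 by (simp add: U_def powr_add)
      have lnm: "ln (real m) \<le> (y / real h + 1) * ln R" "ln (real m) \<ge> 0"
      proof -
        have "ln (real m) \<le> ln (R powr (y / real h + 1))" using mle mm by (intro ln_mono) auto
        then show "ln (real m) \<le> (y / real h + 1) * ln R" using R1 by (simp add: ln_powr)
        show "ln (real m) \<ge> 0" using mm by (simp add: Suc_le_eq)
      qed
      have 1: "real (card C) ^ t \<le> exp (real t * x)"
      proof -
        have "real (card C) ^ t \<le> exp x ^ t" using cardC by (intro power_mono) auto
        then show ?thesis by (simp add: exp_of_nat_mult)
      qed
      have 2: "real (((t * k + 1) ^ t) ^ card (prime_factors m)) \<le> exp \<kappa>"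
      proof -
        have c: "real (card (prime_factors m)) \<le> 2 * (y / real h + 1)"
          by (rule card_large_prime_divisors_le[OF R1 mm(1) mle])
             (use mm in \<open>auto simp: smooth_primes_def prime_factors_dvd\<close>)
        have "real (((t * k + 1) ^ t) ^ card (prime_factors m)) = real (t * k + 1) ^ (t * card (prime_factors m))"
          by (simp only: of_nat_power power_mult)
        also have "\<dots> \<le> (real k ^ 2) ^ (t * card (prime_factors m))" using tk by (intro power_mono) auto
        also have "\<dots> = exp (2 * real t * ln (real k) * real (card (prime_factors m)))"
        proof -
          have "exp (2 * real t * ln (real k) * real (card (prime_factors m)))
             = exp (real (2 * (t * card (prime_factors m))) * ln (real k))" by (simp add: mult_ac)
          also have "\<dots> = real k ^ (2 * (t * card (prime_factors m)))"
            unfolding exp_of_nat_mult using k by simp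
          finally show ?thesis by (simp only: power_mult)
        qed
        also have "\<dots> \<le> exp \<kappa>"
          using mult_left_mono[OF c, of "2 * real t * ln (real k)"] lnk by (simp add: \<kappa>_def algebra_simps)
        finally show ?thesis .
      qed
      have 3: "real (J s k h {x \<in> C. m dvd x}) \<le> exp (c0 + y' * ln R * E)"
      proof -
        have "R powr y / real m = R powr y'"
          using mm R1 lnR by (simp add: y'_def powr_def left_diff_distrib exp_diff)
        then have "real (J s k h {x \<in> C. m dvd x}) \<le> real (J s k h (smooth_set (R powr y') R))"
          unfolding C_def using J_multiples_le[OF mm(1), of s k h "R powr y" R] by simp
        also have "\<dots> \<le> exp (c0 + y' * ln R * E)"
        proof (rule IH)
          have "ln (real m) / ln R \<le> y / real h + 1" using lnm lnR by (simp add: pos_divide_le_eq)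
          then show "(1 - 1 / real h) * y - 1 \<le> y'" unfolding y'_def by (simp add: left_diff_distrib)
          show "y' \<le> y" unfolding y'_def using lnm lnR by simp
        qed
        finally show ?thesis .
      qed
      have wm: "w m ^ (2 * s) = exp (- E * ln (real m))"
      proof -
        have "w m ^ (2 * s) = exp (real (2 * s) * (- \<theta> * ln (real m)))"
          unfolding exp_of_nat_mult using mm by (simp add: w_def powr_def)
        also have "real (2 * s) * (- \<theta> * ln (real m)) = - E * ln (real m)" using s by (simp add: \<theta>_def)
        finally show ?thesis .
      qed
      have "real (card C) ^ t * real (((t * k + 1) ^ t) ^ card (prime_factors m)) * real (J s k h {x \<in> C. m dvd x})
          \<le> exp (real t * x) * exp \<kappa> * exp (c0 + y' * ln R * E)"
        using 1 2 3 by (intro mult_mono) auto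
      also have "\<dots> = \<Gamma> * w m ^ (2 * s)"
        unfolding \<Gamma>_def wm exp_add [symmetric] using lnR by (simp add: y'_def field_simps)
      finally show ?thesis .
    qed
  qed
  have Jpos: "real (J (t + s) k h C) > 0" by (rule J_pos[OF finC neC])
  from step show ?thesis
  proof
    assume le: "real (J (t + s) k h C) \<le> 6 * real s * \<Gamma> * (\<Sum>m\<in>M. w m) ^ (2 * s)"
    have \<theta>: "0 \<le> \<theta>" "\<theta> \<le> 1" using E s by (auto simp: \<theta>_def)
    \<comment> \<open>From \<open>m powr (- \<theta>) = m powr (1 - \<theta>) / m\<close> and the
      bound for the sum of reciprocals; raising \<open>exp 1.05\<close> to the power
      \<open>2 * s\<close> gives the term \<open>(21 / 10) * real s\<close>.\<close>
    define G where "G = (U * R) powr (1 - \<theta>) * exp 1.05"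
    have UR: "U * R > 0" using U R1 by simp
    have "(\<Sum>m\<in>M. w m) \<le> (\<Sum>m\<in>M. (U * R) powr (1 - \<theta>) * (1 / real m))"
    proof (rule sum_mono)
      fix m assume "m \<in> M"
      note mm = Mprop[OF this]
      have "w m = real m powr (1 - \<theta>) * (1 / real m)" using mm by (simp add: w_def powr_diff powr_minus field_simps)
      also have "\<dots> \<le> (U * R) powr (1 - \<theta>) * (1 / real m)"
        using mm \<theta> by (intro mult_right_mono powr_mono2) auto
      finally show "w m \<le> (U * R) powr (1 - \<theta>) * (1 / real m)" .
    qed
    also have "\<dots> = (U * R) powr (1 - \<theta>) * (\<Sum>m\<in>M. 1 / real m)" by (simp add: sum_distrib_left)
    also have "\<dots> \<le> G" unfolding G_def
      using sum_inverse_smooth_le[OF R(1,2,4) finM] Mprop by (intro mult_left_mono) auto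
    finally have "(\<Sum>m\<in>M. w m) \<le> G" .
    then have "(\<Sum>m\<in>M. w m) ^ (2 * s) \<le> G ^ (2 * s)" by (intro power_mono sum_nonneg) (auto simp: w_def)
    then have "6 * real s * \<Gamma> * (\<Sum>m\<in>M. w m) ^ (2 * s) \<le> 6 * real s * \<Gamma> * G ^ (2 * s)"
      by (intro mult_left_mono) (auto simp: \<Gamma>_def)
    with le have "real (J (t + s) k h C) \<le> 6 * real s * \<Gamma> * G ^ (2 * s)" by linarith
    then have "ln (real (J (t + s) k h C)) \<le> ln (6 * real s * \<Gamma> * G ^ (2 * s))" using Jpos by (intro ln_mono) auto
    also have "\<dots> = ln (6 * real s) + ln \<Gamma> + 2 * real s * ln G"
      using s UR U R1 by (simp add: ln_mult ln_realpow \<Gamma>_def G_def)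
    also have "ln G = (1 - \<theta>) * ((y / real h + 1) * ln R) + 1.05"
      using UR U R1 by (simp add: G_def ln_mult ln_powr U_def algebra_simps)
    also have "2 * real s * ((1 - \<theta>) * ((y / real h + 1) * ln R) + 1.05)
       = (2 * real s - E) * (y / real h + 1) * ln R + (21 / 10) * real s"
    proof -
      have e: "2 * real s - E = 2 * real s * (1 - \<theta>)" using s by (simp add: \<theta>_def field_simps)
      show ?thesis unfolding e by (simp add: algebra_simps diff_divide_distrib)
    qed
    finally show ?thesis by (simp add: \<Gamma>_def \<kappa>_def C_def algebra_simps)
  next
    assume le: "real (J (t + s) k h C) \<le> (6 * (real t ^ 4 + (real s)\<^sup>2) * real (card C) * b) ^ s * real (J t k h C)"
    define c where "c = 6 * (real t ^ 4 + (real s)\<^sup>2)"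
    have c: "c > 0" unfolding c_def using s by (simp add: add_nonneg_pos)
    have Jt: "real (J t k h C) \<le> (4 * real t ^ 4) ^ t * real ((t * k + 1) ^ t) * real (card C) ^ t"
      by (rule J_small_le) (use h t finC neC in \<open>auto simp: C_def smooth_set_iff\<close>)
    also have "\<dots> = (4 * real t ^ 4 * real (t * k + 1) * real (card C)) ^ t"
      by (simp only: power_mult_distrib of_nat_power)
    also have "\<dots> \<le> (4 * real t ^ 4 * real k ^ 2 * exp x) ^ t"
      using tk cardC by (intro power_mono mult_mono) auto
    finally have Jt: "real (J t k h C) \<le> (4 * real t ^ 4 * real k ^ 2 * exp x) ^ t" .
    have "(c * real (card C) * b) ^ s \<le> (c * exp x * b) ^ s"
      using c cardC b1 by (intro power_mono mult_mono) auto
    then have "(c * real (card C) * b) ^ s * real (J t k h C) \<le> (c * exp x * b) ^ s * (4 * real t ^ 4 * real k ^ 2 * exp x) ^ t"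
      using Jt c b1 by (intro mult_mono) auto
    with le have "real (J (t + s) k h C) \<le> (c * exp x * b) ^ s * (4 * real t ^ 4 * real k ^ 2 * exp x) ^ t"
      unfolding c_def by linarith
    then have "ln (real (J (t + s) k h C)) \<le> ln ((c * exp x * b) ^ s * (4 * real t ^ 4 * real k ^ 2 * exp x) ^ t)"
      using Jpos by (intro ln_mono) auto
    also have "\<dots> = real s * (ln c + x + ln b) + real t * (ln (4 * real t ^ 4) + 2 * ln (real k) + x)"
      using c t k by (simp add: ln_mult ln_realpow b_def)
    finally show ?thesis by (simp add: c_def b_def C_def algebra_simps)
  qed
qed

section \<open>Iteration\<close>

lemma exp_minus_ge_cubic:
  fixes x :: real
  shows "1 - x + x\<^sup>2 / 2 - x ^ 3 / 6 \<le> exp (- x)"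
proof -
  obtain u where "exp (- x) = (\<Sum>m<4. (- x) ^ m / fact m) + exp u / fact 4 * (- x) ^ 4"
    using Maclaurin_exp_le[of "- x" 4] by blast
  moreover have "(\<Sum>m<4. (- x) ^ m / fact m) = 1 - x + x\<^sup>2 / 2 - x ^ 3 / 6"
    by (simp add: eval_nat_numeral fact_numeral)
  moreover have "exp u / fact 4 * (- x) ^ 4 \<ge> 0" by simp
  ultimately show ?thesis by linarith
qed

text \<open>Reduces numerical lower bounds for \<open>exp\<close> to rational arithmetic.\<close>

lemma exp_minus_ge_power:
  fixes x :: real
  assumes "0 \<le> x" "x \<le> real n" "n > 0"
  shows "(1 - x / real n) ^ n \<le> exp (- x)"
proof -
  have "(1 - x / real n) ^ n \<le> exp (- x / real n) ^ n"
    using assms exp_ge_add_one_self[of "- x / real n"] by (intro power_mono) (auto simp: field_simps)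
  also have "\<dots> = exp (- x)" using assms by (simp add: exp_of_nat_mult [symmetric])
  finally show ?thesis .
qed

text \<open>With \<open>H = h * t\<close>, a smooth substitute for the solution of
  \<open>G (n + t) = t + (1 - 1/h) * G n\<close>, \<open>G 0 = 0\<close>: it tends to the fixed
  point \<open>H\<close>. The height exponent for \<open>n\<close> variables is
  \<open>2 * n - saving H n\<close>.\<close>

definition saving :: "real \<Rightarrow> real \<Rightarrow> real" where
  "saving H n = H * (1 - exp (- (n / H)))"

text \<open>For \<open>u = n / H <= 1/2\<close> the cubic term of the expansion is at most
  \<open>u^2 / 12\<close>, which leaves \<open>1/2 - 1/12 = 5/12\<close> as quadratic coefficient;
  the bad alternative relies on this gap.\<close>

lemma saving_bounds:
  assumes "H > 0" "0 \<le> n"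
  shows "0 \<le> saving H n" "saving H n \<le> n"
    and "n \<le> H / 2 \<Longrightarrow> saving H n \<le> n - 5 / 12 * (n\<^sup>2 / H)"
proof -
  have u: "n / H \<ge> 0" using assms by simp
  show "0 \<le> saving H n" unfolding saving_def using assms u by simp
  have "saving H n \<le> H * (n / H)"
    unfolding saving_def using assms exp_ge_add_one_self[of "- (n / H)"] by (intro mult_left_mono) auto
  then show "saving H n \<le> n" using assms by simp
  assume n: "n \<le> H / 2"
  define u where "u = n / H"
  have u: "0 \<le> u" "u \<le> 1 / 2" using assms n by (auto simp: u_def field_simps)
  have "u ^ 3 \<le> u\<^sup>2 * (1 / 2)" using u by (simp only: power3_eq_cube power2_eq_square) (intro mult_left_mono, auto)
  then have "1 - exp (- u) \<le> u - 5 / 12 * u\<^sup>2" using exp_minus_ge_cubic[of u] by (simp add: field_simps)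
  then have "saving H n \<le> H * (u - 5 / 12 * u\<^sup>2)" unfolding saving_def u_def using assms by (intro mult_left_mono) auto
  also have "\<dots> = n - 5 / 12 * (n\<^sup>2 / H)" using assms by (simp add: u_def field_simps power2_eq_square)
  finally show "saving H n \<le> n - 5 / 12 * (n\<^sup>2 / H)" .
qed

text \<open>The surplus arises because \<open>exp (- 1/h)\<close> exceeds \<open>1 - 1/h\<close> by
  at least \<open>1 / (4 * h^2)\<close>, multiplied by \<open>h * t\<close> and by
  \<open>exp (- s / (h * t)) >= 1/2\<close>.\<close>

lemma saving_step:
  fixes h t s :: real
  assumes h: "h \<ge> 1" and t: "t > 0" and s: "0 \<le> s" "s \<le> h * t / 2"
  shows "saving (h * t) (s + t) - saving (h * t) s * (1 - 1 / h) + t / (8 * h) \<le> t"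
proof -
  define e where "e = exp (- (s / (h * t)))"
  define f where "f = exp (- (1 / h))"
  have ef: "exp (- ((s + t) / (h * t))) = e * f"
    using h t by (simp add: e_def f_def exp_add [symmetric] add_divide_distrib)
  have "e \<ge> 1 - s / (h * t)" using exp_ge_add_one_self[of "- (s / (h * t))"] by (simp add: e_def)
  moreover have "s / (h * t) \<le> 1 / 2" using h t s by (simp add: field_simps)
  ultimately have e: "e \<ge> 1 / 2" by linarith
  have "(1 - (1 / h) / real 2) ^ 2 \<le> f" unfolding f_def using h by (intro exp_minus_ge_power) (auto simp: field_simps)
  then have f: "f - 1 + 1 / h \<ge> 1 / (4 * h\<^sup>2)" using h by (simp add: power2_eq_square field_simps)
  have "t - saving (h * t) (s + t) + saving (h * t) s * (1 - 1 / h) = h * t * e * (f - 1 + 1 / h)"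
    unfolding saving_def ef e_def [symmetric] using h t by (simp add: field_simps)
  also have "\<dots> \<ge> h * t * (1 / 2) * (1 / (4 * h\<^sup>2))"
    using e f h t by (intro mult_mono) auto
  also have "h * t * (1 / 2) * (1 / (4 * h\<^sup>2)) = t / (8 * h)" using h by (simp add: power2_eq_square)
  finally show ?thesis by linarith
qed

text \<open>The slope is tuned to \<open>smooth_density_le\<close>, where
  \<open>4 * 0.0687 / 0.9\<close> must not exceed 0.3054; \<open>60 = 64 * 15 / 16\<close> reduces
  \<open>ln 60\<close> to \<open>ln 2\<close>.\<close>

lemma ln_ge_60_bounds:
  assumes "k \<ge> (60::real)"
  shows "4 \<le> ln k" "ln k \<le> (687 / 10000) * k"
proof -
  have "exp 4 = exp (1::real) ^ 4" by (simp add: exp_of_nat_mult [symmetric])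
  also have "\<dots> \<le> 2.72 ^ 4" using e_less_272 by (intro power_mono) auto
  also have "\<dots> \<le> k" using assms by (simp add: eval_nat_numeral)
  finally show "4 \<le> ln k" using assms by (subst ln_ge_iff) auto
  have "ln (60::real) = ln (64 * (15 / 16))" by simp
  also have "\<dots> = ln 64 + ln (15 / 16)" by (rule ln_mult_pos) auto
  also have "ln (64::real) = 6 * ln 2" using ln_realpow[of 2 6] by simp
  also have "ln (15 / 16 :: real) \<le> 15 / 16 - 1" by (rule ln_le_minus_one) auto
  finally have 60: "ln (60::real) \<le> 4105 / 1000" using ln2_le_25_over_36 by simp
  have "ln (k / 60) \<le> k / 60 - 1" using assms by (intro ln_le_minus_one) auto
  then have "ln k \<le> ln 60 + k / 60 - 1" using assms by (simp add: ln_div)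
  then show "ln k \<le> (687 / 10000) * k" using 60 assms by linarith
qed

text \<open>Origin of the 10 in \<open>ln (1 / (10 * \<eta>))\<close>: for
  \<open>y >= 0.39 / \<eta>\<close>, \<open>2.86 / y\<close> is at most
  \<open>10 * \<eta> * 286 / 390\<close>, and the logarithm of \<open>286 / 390\<close> pays for the
  Bezout cost \<open>4 * ln k / h\<close>.\<close>

lemma smooth_density_le:
  fixes k h \<eta> y Y :: real
  assumes k: "k \<ge> 60" and h: "0.9 * k \<le> h" and \<eta>: "0 < \<eta>" "10 * \<eta> < 1"
    and y: "(39 / 100) / \<eta> \<le> y" and Y: "Y \<le> y"
  shows "y * ln (2.86 / y) + 4 * y * ln k / h \<le> - (Y * ln (1 / (10 * \<eta>)))"
proof -
  have "0 < (39 / 100) / \<eta>" using \<eta> by simp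
  then have y0: "y > 0" using y by linarith
  have "2.86 / y \<le> 2.86 / ((39 / 100) / \<eta>)" using y y0 \<eta> by (intro divide_left_mono) auto
  also have "\<dots> = 10 * \<eta> * (286 / 390)" by simp
  finally have "ln (2.86 / y) \<le> ln (10 * \<eta> * (286 / 390))" using y0 by (intro ln_mono) auto
  also have "\<dots> = ln (10 * \<eta>) + ln (286 / 390)" using \<eta> by (intro ln_mult_pos) auto
  also have "ln (286 / 390 :: real) \<le> - 0.3054"
  proof -
    have "(286 / 390 :: real) \<le> (1 - 0.3054 / real 16) ^ 16" by (simp add: power_divide)
    also have "\<dots> \<le> exp (- 0.3054)" by (rule exp_minus_ge_power) auto
    finally have "ln (286 / 390 :: real) \<le> ln (exp (- 0.3054))" by (intro ln_mono) auto
    then show ?thesis by simp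
  qed
  finally have 1: "ln (2.86 / y) \<le> ln (10 * \<eta>) - 0.3054" by simp
  have "4 * ln k / h \<le> 4 * ((687 / 10000) * k) / (0.9 * k)"
    using ln_ge_60_bounds[OF k] k h by (intro frac_le) auto
  also have "\<dots> \<le> 0.3054" using k by simp
  finally have "ln (2.86 / y) + 4 * ln k / h \<le> ln (10 * \<eta>)" using 1 by linarith
  then have "y * (ln (2.86 / y) + 4 * ln k / h) \<le> y * ln (10 * \<eta>)" using y0 by (intro mult_left_mono) auto
  also have "\<dots> = - (y * ln (1 / (10 * \<eta>)))" using \<eta> by (simp add: ln_div)
  also have "\<dots> \<le> - (Y * ln (1 / (10 * \<eta>)))"
    using Y \<eta> by (simp add: mult_right_mono)
  finally show ?thesis by (simp add: distrib_left mult_ac)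
qed

text \<open>At most \<open>h / 2\<close> contractions by \<open>1 - 1/h\<close> retain a factor near
  \<open>exp (- 1/2)\<close>, namely 0.594 for \<open>h >= 54\<close>. Since
  \<open>h <= 1 / (2 * \<eta>)\<close>, subtracting \<open>h\<close> leaves at least
  \<open>(0.594 - 0.203) / \<eta>\<close>.\<close>

lemma length_lower_bound:
  fixes h \<eta> \<tau> :: real
  assumes h: "h \<ge> 54" and \<eta>: "\<eta> > 0" "h \<le> 1 / (2 * \<eta>)" and \<tau>: "0 \<le> \<tau>" "\<tau> \<le> h / 2"
  shows "(39 / 100) / \<eta> \<le> (1 / \<eta> + h) * (1 - 1 / h) powr \<tau> - h"
proof -
  have "ln (h / (h - 1)) \<le> h / (h - 1) - 1" using h by (intro ln_le_minus_one) auto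
  also have "\<dots> = 1 / (h - 1)" using h by (simp add: field_simps)
  finally have l0: "ln (h / (h - 1)) \<le> 1 / (h - 1)" .
  have l: "ln (1 - 1 / h) \<ge> - (1 / (h - 1))"
  proof -
    have "1 - 1 / h = (h - 1) / h" using h by (simp add: field_simps)
    then have "ln (1 - 1 / h) = - ln (h / (h - 1))" using h by (simp add: ln_div)
    then show ?thesis using l0 by linarith
  qed
  have "(594 / 1000 :: real) \<le> (1 - 0.5095 / real 16) ^ 16" by (simp add: power_divide)
  also have "\<dots> \<le> exp (- 0.5095)" by (rule exp_minus_ge_power) auto
  also have "\<dots> \<le> exp (h / 2 * ln (1 - 1 / h))"
  proof -
    have "h / 2 * (1 / (h - 1)) \<le> 0.5095" using h by (simp add: field_simps)
    moreover have "h / 2 * (- (1 / (h - 1))) \<le> h / 2 * ln (1 - 1 / h)" using l h by (intro mult_left_mono) auto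
    ultimately have "- 0.5095 \<le> h / 2 * ln (1 - 1 / h)" by linarith
    then show ?thesis by simp
  qed
  also have "\<dots> = (1 - 1 / h) powr (h / 2)" using h by (simp add: powr_def)
  also have "\<dots> \<le> (1 - 1 / h) powr \<tau>" using h \<tau> by (intro powr_mono') auto
  finally have x: "594 / 1000 \<le> (1 - 1 / h) powr \<tau>" .
  have "(1 / \<eta> + h) * (594 / 1000) \<le> (1 / \<eta> + h) * (1 - 1 / h) powr \<tau>"
    using x h \<eta> by (intro mult_left_mono) auto
  moreover have "(39 / 100) / \<eta> \<le> (1 / \<eta> + h) * (594 / 1000) - h" using \<eta> by (simp add: field_simps)
  ultimately show ?thesis by linarith
qed

text \<open>
  The quadratic form \<open>21/8 A\<^sup>2 - 4 A q + 5/3 q\<^sup>2\<close> is positive definite, and this dictates the constant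
  \<open>10.5 = 4 * 21/8\<close> of the theorem.
\<close>

lemma bad_case_inequality:
  fixes A h k \<rho> L y z q :: real
  assumes A: "A \<ge> 18" and h: "0 < h" "h \<le> k" and \<rho>: "\<rho> \<ge> 4 * k * L / A" "\<rho> \<ge> 10 * L" and L: "L \<ge> 0"
    and y: "6 \<le> y" "y \<le> z" and q: "q \<ge> 1"
  shows "(q - 1) * (4 * y * L + y * \<rho> / h) + 6 * L \<le> q\<^sup>2 * (1 + \<rho> / 2) + (21 / 8) * A * L * z + y * \<rho> * (5 / 12 * (q\<^sup>2 / h))"
proof -
  have quad: "5 / 12 * q\<^sup>2 - q + 1 \<ge> 0"
  proof -
    have "5 / 12 * q\<^sup>2 - q + 1 = 5 / 12 * (q - 6 / 5)\<^sup>2 + 2 / 5" by (simp add: power2_eq_square algebra_simps)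
    then show ?thesis by simp
  qed
  have "4 * L / A \<le> \<rho> / h"
  proof -
    have "4 * L / A * h \<le> 4 * L / A * k" using L A h by (intro mult_left_mono) auto
    then have "4 * L / A * h \<le> \<rho>" using \<rho> by (simp add: mult_ac)
    then show ?thesis using h by (simp add: pos_le_divide_eq)
  qed
  then have "(5 / 12 * q\<^sup>2 - q + 1) * (4 * L / A) \<le> (5 / 12 * q\<^sup>2 - q + 1) * (\<rho> / h)"
    using quad by (intro mult_left_mono) auto
  moreover have "(5 / 12 * q\<^sup>2 - q + 1) * (4 * L / A) + (21 / 8) * A * L - 4 * (q - 1) * L \<ge> L"
  proof -
    \<comment> \<open>Completes the square at \<open>q = 1.2 * (A + 1)\<close>;
      \<open>A >= 18\<close> makes the remainder nonnegative.\<close>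
    have "A * (0.225 * A - 1.8) \<ge> 0" using A by simp
    then have "0 \<le> 5 / 3 * (q - 1.2 * (A + 1))\<^sup>2 + (A * (0.225 * A - 1.8) + 1.6)" by simp
    also have "\<dots> = (5 / 12 * q\<^sup>2 - q + 1) * 4 + (21 / 8) * A\<^sup>2 - 4 * (q - 1) * A - A"
      by (simp add: power2_eq_square field_simps)
    finally have "0 \<le> L / A * ((5 / 12 * q\<^sup>2 - q + 1) * 4 + (21 / 8) * A\<^sup>2 - 4 * (q - 1) * A - A)"
      using L A by simp
    also have "\<dots> = (5 / 12 * q\<^sup>2 - q + 1) * (4 * L / A) + (21 / 8) * A * L - 4 * (q - 1) * L - L"
      using A by (simp add: field_simps power2_eq_square)
    finally show ?thesis by simp
  qed
  ultimately have "L \<le> (5 / 12 * q\<^sup>2 - q + 1) * (\<rho> / h) + (21 / 8) * A * L - 4 * (q - 1) * L" by linarith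
  then have "y * L \<le> y * ((5 / 12 * q\<^sup>2 - q + 1) * (\<rho> / h) + (21 / 8) * A * L - 4 * (q - 1) * L)"
    using y by (intro mult_left_mono) auto
  moreover have "6 * L \<le> y * L" using y L by (intro mult_right_mono) auto
  moreover have "(21 / 8) * A * L * y \<le> (21 / 8) * A * L * z" using y A L by (intro mult_left_mono) auto
  moreover have "0 \<le> q\<^sup>2 * (1 + \<rho> / 2)" using \<rho> L by simp
  ultimately show ?thesis by (simp add: algebra_simps add_divide_distrib diff_divide_distrib)
qed

text \<open>
  One step replaces the height \<open>R powr y\<close> by \<open>R powr y'\<close> with \<open>y' \<ge> (1 - 1/h) y - 1\<close>. Starting from \<open>y = 1/\<eta>\<close> with
  \<open>s\<close> variables, \<open>len n\<close> is the resulting lower bound for the exponent when \<open>n\<close> variables remain, and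
  \<open>A\<close> stands for \<open>4 ln k / (D k \<eta>)\<close>.
\<close>

lemma J_bound_induction:
  fixes h k t s :: nat and R \<eta> A :: real
  assumes k: "k \<ge> 60" and h: "(9 / 10) * real k \<le> real h" "h + t = Suc k" and t: "t \<ge> 3" "real t \<le> (12 / 100) * real k"
    and s: "real s \<le> real h * real t / 2"
    and \<eta>: "0 < \<eta>" "real k \<le> 1 / (2 * \<eta>)" "1 / \<eta> \<le> real k ^ 3" and A: "A \<ge> 18"
    and R: "R > 0" "ln R \<ge> 4 * real k * ln (real k) / A" "ln R \<ge> 10 * ln (real k)" "ln R \<ge> 10 * \<eta> * (real k)\<^sup>2"
  defines "len \<equiv> \<lambda>n. (1 / \<eta> + real h) * (1 - 1 / real h) powr ((real s - real n) / real t) - real h"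
  defines "\<Psi> \<equiv> \<lambda>n. (real n)\<^sup>2 / real t + ln R * ((real n)\<^sup>2 / (2 * real t))
      + (21 / 8) * A * real t * ln (real k) / \<eta> - real n * len 0 * ln (1 / (10 * \<eta>))"
  shows "n \<le> s \<Longrightarrow> len n \<le> y \<Longrightarrow> y \<le> 1 / \<eta> \<Longrightarrow>
    real (J n k h (smooth_set (R powr y) R)) \<le> exp (\<Psi> n + y * ln R * (2 * real n - saving (real h * real t) (real n)))"
proof (induction n arbitrary: y rule: less_induct)
  case (less n)
  define L where "L = ln (real k)"
  define \<rho> where "\<rho> = ln R"
  define v where "v = ln (1 / (10 * \<eta>))"
  define Y where "Y = len 0"
  define x where "x = y * ln R + y * ln (2.86 / y)"
  define H where "H = real h * real t"
  define G where "G = (\<lambda>n. saving H (real n))"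
  define C where "C = smooth_set (R powr y) R"
  define a0 where "a0 = (21 / 8) * A * real t * L / \<eta>"
  have \<Psi>: "\<Psi> n = (real n)\<^sup>2 / real t + \<rho> * ((real n)\<^sup>2 / (2 * real t)) + a0 - real n * Y * v" for n
    by (simp add: \<Psi>_def \<rho>_def a0_def L_def Y_def v_def)
  have h54: "real h \<ge> 54" using k h by linarith
  have hk: "real h \<le> real k" using h t by linarith
  have t0: "real t > 0" "real t \<ge> 3" using t by auto
  have H0: "H > 0" using h54 t0 by (simp add: H_def)
  have L: "4 \<le> L" "L \<le> (687 / 10000) * real k" using ln_ge_60_bounds[of "real k"] k by (auto simp: L_def)
  have \<eta>10: "10 * \<eta> < 1"
  proof -
    have "60 \<le> 1 / (2 * \<eta>)" using \<eta> k by linarith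
    then show ?thesis using \<eta> by (simp add: field_simps)
  qed
  have v0: "v \<ge> 0" unfolding v_def using \<eta> \<eta>10 by simp
  have \<tau>: "0 \<le> (real s - real m) / real t" "(real s - real m) / real t \<le> real h / 2" if "m \<le> s" for m
  proof -
    show "0 \<le> (real s - real m) / real t" using that t0 by simp
    have "real s - real m \<le> real h / 2 * real t" using s by simp
    then show "(real s - real m) / real t \<le> real h / 2" using t0 by (simp add: pos_divide_le_eq)
  qed
  have h\<eta>: "real h \<le> 1 / (2 * \<eta>)" using hk \<eta> by linarith
  have len: "(39 / 100) / \<eta> \<le> len m" if "m \<le> s" for m
    unfolding len_def using \<tau>[OF that] h54 \<eta> h\<eta> by (intro length_lower_bound) auto
  have y: "(39 / 100) / \<eta> \<le> y" using len[of n] less.prems by linarith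
  have yk: "(78 / 100) * real k \<le> y"
  proof -
    have "(78 / 100) * real k \<le> (78 / 100) * (1 / (2 * \<eta>))" using \<eta> by (intro mult_left_mono) auto
    also have "\<dots> = (39 / 100) / \<eta>" by simp
    finally show ?thesis using y by linarith
  qed
  then have y46: "y \<ge> 46" using k by linarith
  have lenmono: "Y \<le> len n"
  proof -
    have "(1 - 1 / real h) powr ((real s - real 0) / real t) \<le> (1 - 1 / real h) powr ((real s - real n) / real t)"
      using h54 t0 by (intro powr_mono') (auto simp: divide_right_mono)
    then show ?thesis unfolding Y_def len_def using \<eta> by (simp add: mult_left_mono)
  qed
  have Yy: "Y \<le> y" using lenmono less.prems by linarith
  have dens: "y * ln (2.86 / y) + 4 * y * L / real h \<le> - (Y * v)"
    unfolding L_def v_def by (rule smooth_density_le) (use k h \<eta> \<eta>10 y Yy in auto)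
  have yLh: "0 \<le> 4 * y * L / real h" using y46 L by simp
  have xle: "x \<le> y * \<rho> - Y * v - 4 * y * L / real h" using dens by (simp add: x_def \<rho>_def)
  have xle': "x \<le> y * \<rho> - Y * v" using xle yLh by linarith
  have \<rho>: "\<rho> \<ge> 4 * real k * L / A" "\<rho> \<ge> 10 * L" using R by (auto simp: \<rho>_def L_def)
  \<comment> \<open>Needed so that the surplus of \<open>saving_step\<close>, multiplied by
    \<open>y * \<rho>\<close>, outweighs a term linear in the number of variables.\<close>
  have y\<rho>: "y * \<rho> \<ge> (39 / 10) * (real k)\<^sup>2"
  proof -
    have "(39 / 100) / \<eta> * (10 * \<eta> * (real k)\<^sup>2) \<le> y * \<rho>"
      using R y y46 \<eta> unfolding \<rho>_def by (intro mult_mono) auto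
    then show ?thesis using \<eta> by simp
  qed
  have R40: "ln R \<ge> 40" using R(3) L by (simp add: L_def)
  \<comment> \<open>The fifth power leaves room for \<open>200 * y\<close>, since
    \<open>y <= 1 / \<eta> <= real k ^ 3\<close>.\<close>
  have sqR: "sqrt R \<ge> real k ^ 5"
  proof -
    have "real k ^ 5 = exp (5 * L)" using k exp_of_nat_mult[of 5 L] by (simp add: L_def)
    also have "\<dots> \<le> exp (ln R / 2)" using R(3) by (simp add: L_def)
    also have "\<dots> = sqrt R" using R(1) by (simp add: ln_sqrt [symmetric])
    finally show ?thesis .
  qed
  have k2: "(real k)\<^sup>2 \<ge> 3600" using power_mono[of 60 "real k" 2] k by simp
  have "200 * real k ^ 3 \<le> (real k)\<^sup>2 * real k ^ 3" using k2 by (intro mult_right_mono) auto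
  also have "\<dots> = real k ^ 5" by (simp add: power_add [symmetric])
  finally have k35: "200 * real k ^ 3 \<le> sqrt R" using sqR by linarith
  have y200: "200 * y \<le> sqrt R" using k35 less.prems(3) \<eta>(3) by linarith
  have k3: "real k \<le> real k ^ 3" "1 \<le> real k ^ 3" using k by (auto intro: self_le_power one_le_power)
  have sqRk: "real k \<le> sqrt R" "200 \<le> sqrt R" using k35 k3 by linarith+
  have R1: "R > 1" using R40 R(1) ln_le_zero_iff[of R] by linarith
  have R1y: "R powr y \<ge> 1" using R1 y46 by (intro ge_one_powr_ge_zero) auto
  have finC: "finite C" unfolding C_def by (rule finite_smooth_set)
  have neC: "C \<noteq> {}" unfolding C_def using one_mem_smooth_set[OF R1y] by blast
  have a0: "a0 \<ge> 6 * real t * L"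
  proof -
    have "1 \<le> 1 / \<eta>" using \<eta> \<eta>10 by simp
    have "6 * (real t * L) \<le> (21 / 8) * A * (real t * L)" using A t0 L by (intro mult_right_mono) auto
    also have "\<dots> = (21 / 8) * A * (real t * L) * 1" by simp
    also have "\<dots> \<le> (21 / 8) * A * (real t * L) * (1 / \<eta>)"
      using \<open>1 \<le> 1 / \<eta>\<close> A t0 L by (intro mult_left_mono) auto
    finally show ?thesis by (simp add: a0_def mult.assoc)
  qed
  have t4: "real t ^ 4 \<le> (20736 / 100000000) * real k ^ 4"
  proof -
    have "real t ^ 4 \<le> ((12 / 100) * real k) ^ 4" using t0 t by (intro power_mono) auto
    also have "\<dots> = (20736 / 100000000) * real k ^ 4" by (simp add: power_mult_distrib power_divide)
    finally show ?thesis .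
  qed
  have k40: "real k ^ 4 \<ge> 0" by simp
  have tk2: "4 * real t ^ 4 \<le> real k ^ 4" "real t * real k + 1 \<le> (real k)\<^sup>2"
  proof -
    show "4 * real t ^ 4 \<le> real k ^ 4" using t4 k40 by linarith
    have "real t * real k \<le> (12 / 100) * real k * real k" using t by (intro mult_right_mono) auto
    then show "real t * real k + 1 \<le> (real k)\<^sup>2" using k2 by (simp add: power2_eq_square)
  qed
  have ln4t: "ln (4 * real t ^ 4) \<le> 4 * L"
    using ln_mono[of "4 * real t ^ 4" "real k ^ 4"] tk2(1) t0 k by (simp add: L_def ln_realpow)
  have G: "0 \<le> G m" "G m \<le> real m" for m unfolding G_def using saving_bounds[OF H0] by auto
  have Jpos: "real (J n k h C) > 0" by (rule J_pos[OF finC neC])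
  have y\<rho>0: "y * \<rho> \<ge> 0" using y\<rho> by (meson order_trans zero_le_power2 mult_nonneg_nonneg zero_le_numeral zero_le_divide_iff)
  have goal: "ln (real (J n k h C)) \<le> \<Psi> n + y * \<rho> * (2 * real n - G n)"
  proof (cases "n \<le> t")
    \<comment> \<open>Base case: the nearly diagonal bound costs \<open>6 * real t * L\<close>,
      which \<open>a0\<close> covers.\<close>
    case True
    have "real (J n k h C) \<le> (4 * real t ^ 4) ^ n * real ((t * k + 1) ^ t) * real (card C) ^ n"
      by (rule J_small_le) (use h h54 t finC neC True in \<open>auto simp: C_def smooth_set_iff\<close>)
    also have "\<dots> \<le> (real k ^ 4) ^ t * ((real k)\<^sup>2) ^ t * exp x ^ n"
    proof (intro mult_mono)
      have "(4 * real t ^ 4) ^ n \<le> (real k ^ 4) ^ n" using tk2(1) by (intro power_mono) auto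
      also have "\<dots> \<le> (real k ^ 4) ^ t" using True k by (intro power_increasing one_le_power) auto
      finally show "(4 * real t ^ 4) ^ n \<le> (real k ^ 4) ^ t" .
      show "real ((t * k + 1) ^ t) \<le> ((real k)\<^sup>2) ^ t"
        unfolding of_nat_power using tk2(2) by (intro power_mono) auto
      have "real (card C) \<le> R powr y * (2.86 / y) powr y"
        unfolding C_def by (rule card_smooth_set_le) (use R40 R y200 y46 in auto)
      also have "\<dots> = exp x" unfolding x_def using R1 y46 by (simp add: powr_def exp_add mult.commute)
      finally show "real (card C) ^ n \<le> exp x ^ n" by (intro power_mono) auto
    qed auto
    finally have "ln (real (J n k h C)) \<le> ln ((real k ^ 4) ^ t * ((real k)\<^sup>2) ^ t * exp x ^ n)"
      using Jpos by (intro ln_mono) auto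
    also have "\<dots> = 6 * real t * L + real n * x"
      using k by (simp add: ln_mult ln_realpow L_def)
    also have "real n * x \<le> real n * (y * \<rho> - Y * v)" using xle' by (intro mult_left_mono) auto
    also have "\<dots> \<le> y * \<rho> * (2 * real n - G n) - real n * Y * v"
      using mult_left_mono[OF G(2)[of n] y\<rho>0] by (simp add: algebra_simps)
    also have "6 * real t * L + (y * \<rho> * (2 * real n - G n) - real n * Y * v) \<le> \<Psi> n + y * \<rho> * (2 * real n - G n)"
    proof -
      have "0 \<le> (real n)\<^sup>2 / real t" "0 \<le> \<rho> * ((real n)\<^sup>2 / (2 * real t))" using R40 by (auto simp: \<rho>_def)
      then show ?thesis using a0 unfolding \<Psi> by linarith
    qed
    finally show ?thesis by simp
  next
    case False
    define m where "m = n - t"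
    have m: "n = t + m" "m \<ge> 1" "m < n" using False t by (auto simp: m_def)
    have nr: "real n = real t + real m" using m by simp
    have ns: "real n \<le> H / 2" using less.prems(1) s by (simp add: H_def)
    have ms: "real m \<le> H / 2" using ns nr t0 by linarith
    define E where "E = 2 * real m - G m"
    have E: "0 \<le> E" "E \<le> 2 * real m" using G[of m] by (auto simp: E_def)
    have IH: "real (J m k h (smooth_set (R powr y') R)) \<le> exp (\<Psi> m + y' * ln R * E)"
      if y': "(1 - 1 / real h) * y - 1 \<le> y'" "y' \<le> y" for y'
    proof -
      \<comment> \<open>Adding \<open>h\<close> turns \<open>y' = (1 - 1/h) * y - 1\<close> into
        multiplication by \<open>1 - 1/h\<close>, hence the closed form of
        \<open>len\<close>.\<close>
      have "len m \<le> y'"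
      proof -
        have "(real s - real m) / real t = (real s - real n) / real t + 1" using nr t0 by (simp add: field_simps)
        then have "(1 - 1 / real h) powr ((real s - real m) / real t) = (1 - 1 / real h) powr ((real s - real n) / real t) * (1 - 1 / real h)"
          using h54 by (simp add: powr_add)
        then have "len m = (1 - 1 / real h) * (len n + real h) - real h"
          by (simp add: len_def mult_ac)
        also have "\<dots> = (1 - 1 / real h) * len n - 1" using h54 by (simp add: field_simps)
        also have "\<dots> \<le> (1 - 1 / real h) * y - 1"
          using less.prems(2) h54 by (intro diff_right_mono mult_left_mono) auto
        finally show ?thesis using y' by linarith
      qed
      moreover have "y' \<le> 1 / \<eta>" using y' less.prems by linarith
      ultimately show ?thesis using less.IH[OF m(3), of y'] less.prems(1) m(3) by (simp add: E_def G_def H_def)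
    qed
    have "ln (real (J (t + m) k h (smooth_set (R powr y) R)))
       \<le> ln (6 * real m) + real t * x + 4 * real t * ln (real k) * (y / real h + 1) + \<Psi> m + y * ln R * E
         + (2 * real m - E) * (y / real h + 1) * ln R + (21 / 10) * real m
     \<or> ln (real (J (t + m) k h (smooth_set (R powr y) R)))
       \<le> real m * (ln (6 * (real t ^ 4 + (real m)\<^sup>2)) + x + 4 * y * ln (real k) - 3 * y + y / real h * ln R)
         + real t * (ln (4 * real t ^ 4) + 2 * ln (real k) + x)"
      unfolding x_def
      by (rule ln_J_step) (use h h54 t m k R40 R sqRk y46 y200 E IH in auto)
    then have "ln (real (J n k h C))
       \<le> ln (6 * real m) + real t * x + 4 * real t * L * (y / real h + 1) + \<Psi> m + y * \<rho> * E
         + G m * (y / real h + 1) * \<rho> + (21 / 10) * real m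
     \<or> ln (real (J n k h C))
       \<le> real m * (ln (6 * (real t ^ 4 + (real m)\<^sup>2)) + x + 4 * y * L - 3 * y + y / real h * \<rho>)
         + real t * (ln (4 * real t ^ 4) + 2 * L + x)"
      by (simp add: m(1) C_def L_def \<rho>_def E_def)
    moreover have ln6m: "6 * real m \<le> (real k)\<^sup>2"
    proof -
      have "real m \<le> real k * ((12 / 100) * real k) / 2"
        using ms mult_mono[OF hk t(2)] t0 hk unfolding H_def by simp
      then show ?thesis by (simp add: power2_eq_square)
    qed
    ultimately show ?thesis
    proof (elim disjE)
      assume good: "ln (real (J n k h C))
       \<le> ln (6 * real m) + real t * x + 4 * real t * L * (y / real h + 1) + \<Psi> m + y * \<rho> * E
         + G m * (y / real h + 1) * \<rho> + (21 / 10) * real m"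
      have 1: "ln (6 * real m) \<le> 2 * L"
        using ln_mono[of "6 * real m" "(real k)\<^sup>2"] ln6m m k by (simp add: L_def ln_realpow)
      have 2: "real t * x \<le> real t * (y * \<rho>) - real t * Y * v - 4 * real t * L * (y / real h)"
        using mult_left_mono[OF xle, of "real t"] t0 by (simp add: algebra_simps)
      \<comment> \<open>The increments of \<open>\<Psi>\<close> pay for the step:
        \<open>2 * m\<close> goes against \<open>(21 / 10) * m\<close>, \<open>\<rho> * m\<close>
        against the extra factor \<open>R\<close> in the modulus, and
        \<open>\<rho> * t / 2 >= 5 * t * L\<close> against the logarithmic terms;
        \<open>t * Y * v\<close> is the density gain of the split variables.\<close>
      have 3: "\<Psi> n = \<Psi> m + (2 * real m + real t) + \<rho> * (real m + real t / 2) - real t * Y * v"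
      proof -
        have q: "(real n)\<^sup>2 / real t = (real m)\<^sup>2 / real t + (2 * real m + real t)"
          unfolding nr using t0 by (simp add: power2_eq_square field_simps)
        have "(real n)\<^sup>2 / (2 * real t) = (real n)\<^sup>2 / real t / 2" by simp
        also have "\<dots> = (real m)\<^sup>2 / (2 * real t) + (real m + real t / 2)" unfolding q by (simp add: add_divide_distrib)
        finally have q2: "(real n)\<^sup>2 / (2 * real t) = (real m)\<^sup>2 / (2 * real t) + (real m + real t / 2)" .
        show ?thesis unfolding \<Psi> q q2 unfolding nr by (simp add: algebra_simps)
      qed
      have 4: "y * \<rho> * (real t + E + G m / real h) + y * \<rho> * (real t / (8 * real h)) \<le> y * \<rho> * (2 * real n - G n)"
      proof -
        have "G n - G m * (1 - 1 / real h) + real t / (8 * real h) \<le> real t"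
          unfolding G_def nr H_def using saving_step[of "real h" "real t" "real m"] h54 t0 ms
          by (simp add: H_def add.commute)
        then have "real t + E + G m / real h + real t / (8 * real h) \<le> 2 * real n - G n"
          unfolding E_def nr by (simp add: algebra_simps)
        then have "y * \<rho> * (real t + E + G m / real h + real t / (8 * real h)) \<le> y * \<rho> * (2 * real n - G n)"
          using y\<rho>0 by (rule mult_left_mono)
        then show ?thesis by (simp only: distrib_left)
      qed
      \<comment> \<open>The part of \<open>(21 / 10) * m\<close> not covered by the increment of
        \<open>n^2 / t\<close> comes from the surplus in the saving.\<close>
      have 5: "y * \<rho> * (real t / (8 * real h)) \<ge> (1 / 10) * real m"
      proof -
        have "real h * real t \<le> real k * real t" using hk t0 by (intro mult_right_mono) auto
        then have "real m \<le> real k * real t / 2" using ms unfolding H_def by linarith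
        then have "(1 / 10) * real m \<le> (39 / 10) * (real k)\<^sup>2 * (real t / (8 * real k))"
          using k t0 by (simp add: power2_eq_square)
        also have "\<dots> \<le> (39 / 10) * (real k)\<^sup>2 * (real t / (8 * real h))"
          using hk h54 t0 by (intro mult_left_mono divide_left_mono) auto
        also have "\<dots> \<le> y * \<rho> * (real t / (8 * real h))"
          using y\<rho> h54 t0 by (intro mult_right_mono) auto
        finally show ?thesis .
      qed
      have 6: "G m * \<rho> \<le> real m * \<rho>" using G[of m] R40 by (intro mult_right_mono) (auto simp: \<rho>_def)
      have 7: "real t * (5 * L) \<le> real t * (\<rho> / 2)" using \<rho> t0 by (intro mult_left_mono) auto
      have 8: "2 * L \<le> real t * L" using t0 L by (intro mult_right_mono) auto
      have e1: "G m * (y / real h + 1) * \<rho> = y * \<rho> * (G m / real h) + G m * \<rho>" by (simp add: algebra_simps)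
      have e2: "4 * real t * L * (y / real h + 1) = 4 * real t * L * (y / real h) + 4 * (real t * L)" by (simp add: algebra_simps)
      have e3: "y * \<rho> * (real t + E + G m / real h) = real t * (y * \<rho>) + y * \<rho> * E + y * \<rho> * (G m / real h)" by (simp add: algebra_simps)
      have e4: "\<rho> * (real m + real t / 2) = real m * \<rho> + real t * (\<rho> / 2)" by (simp add: algebra_simps)
      have e5: "real t * (5 * L) = 5 * (real t * L)" by simp
      show ?thesis using good 1 2 3 4 5 6 7 8 t0 unfolding e1 e2 e3 e4 e5 by linarith
    next
      assume bad: "ln (real (J n k h C))
       \<le> real m * (ln (6 * (real t ^ 4 + (real m)\<^sup>2)) + x + 4 * y * L - 3 * y + y / real h * \<rho>)
         + real t * (ln (4 * real t ^ 4) + 2 * L + x)"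
      \<comment> \<open>The combinatorial factor is a power of \<open>k\<close>, so its logarithm
        fits into the spare \<open>3 * y\<close> of \<open>rankin_constant_le\<close>.\<close>
      have "6 * (real t ^ 4 + (real m)\<^sup>2) \<le> real k ^ 4"
      proof -
        have "(6 * real m)\<^sup>2 \<le> ((real k)\<^sup>2)\<^sup>2" using ln6m by (intro power_mono) auto
        then have "36 * (real m)\<^sup>2 \<le> real k ^ 4" by (simp add: power_mult_distrib)
        then have "6 * (real m)\<^sup>2 \<le> real k ^ 4 / 2" using k40 by linarith
        moreover have "6 * real t ^ 4 \<le> real k ^ 4 / 2" using t4 k40 by linarith
        ultimately show ?thesis unfolding distrib_left by linarith
      qed
      then have "ln (6 * (real t ^ 4 + (real m)\<^sup>2)) \<le> ln (real k ^ 4)" using t0 by (intro ln_mono) (auto simp: add_pos_nonneg)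
      also have "\<dots> = 4 * L" using k by (simp add: L_def ln_realpow)
      finally have "ln (6 * (real t ^ 4 + (real m)\<^sup>2)) \<le> 3 * y" using yk L by linarith
      then have "real m * (ln (6 * (real t ^ 4 + (real m)\<^sup>2)) + x + 4 * y * L - 3 * y + y / real h * \<rho>)
          \<le> real m * (x + 4 * y * L + y / real h * \<rho>)" by (intro mult_left_mono) auto
      moreover have "real t * (ln (4 * real t ^ 4) + 2 * L + x) \<le> real t * (6 * L + x)"
        using ln4t t0 by (intro mult_left_mono) auto
      moreover have "real m * (x + 4 * y * L + y / real h * \<rho>) + real t * (6 * L + x)
          = real n * x + (real m * (4 * y * L + y * \<rho> / real h) + 6 * (real t * L))" unfolding nr by (simp add: algebra_simps)
      moreover have "real n * x \<le> real n * (y * \<rho> - Y * v)" using xle' by (intro mult_left_mono) auto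
      ultimately have 1: "ln (real (J n k h C)) \<le> real n * (y * \<rho> - Y * v) + (real m * (4 * y * L + y * \<rho> / real h) + 6 * (real t * L))"
        using bad by linarith
      \<comment> \<open>The number of steps as a real parameter; after division by \<open>t\<close>
        the claim is quadratic in \<open>q\<close>.\<close>
      define q where "q = real n / real t"
      have q: "real n = q * real t" "real m = (q - 1) * real t" using nr t0 by (auto simp: q_def field_simps)
      have "q \<ge> 1" using q(1) nr t0 by (simp add: q_def)
      have "(q - 1) * (4 * y * L + y * \<rho> / real h) + 6 * L
          \<le> q\<^sup>2 * (1 + \<rho> / 2) + (21 / 8) * A * L * (1 / \<eta>) + y * \<rho> * (5 / 12 * (q\<^sup>2 / real h))"
        by (rule bad_case_inequality[where k = "real k"]) (use A h54 hk \<rho> L y46 less.prems \<open>q \<ge> 1\<close> in auto)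
      then have "((q - 1) * (4 * y * L + y * \<rho> / real h) + 6 * L) * real t
          \<le> (q\<^sup>2 * (1 + \<rho> / 2) + (21 / 8) * A * L * (1 / \<eta>) + y * \<rho> * (5 / 12 * (q\<^sup>2 / real h))) * real t"
        using t0 by (intro mult_right_mono) auto
      also have "\<dots> = (real n)\<^sup>2 / real t + \<rho> * ((real n)\<^sup>2 / (2 * real t)) + a0 + y * \<rho> * (5 / 12 * ((real n)\<^sup>2 / H))"
        unfolding q(1) a0_def H_def using t0 h54 by (simp add: power2_eq_square field_simps)
      finally have 2: "real m * (4 * y * L + y * \<rho> / real h) + 6 * (real t * L)
          \<le> (real n)\<^sup>2 / real t + \<rho> * ((real n)\<^sup>2 / (2 * real t)) + a0 + y * \<rho> * (5 / 12 * ((real n)\<^sup>2 / H))"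
        unfolding q(2) by (simp add: algebra_simps diff_divide_distrib)
      have "y * \<rho> * (5 / 12 * ((real n)\<^sup>2 / H)) \<le> y * \<rho> * (real n - G n)"
        using saving_bounds(3)[OF H0 _ ns] y\<rho>0 unfolding G_def by (intro mult_left_mono) auto
      then show ?thesis using 1 2 unfolding \<Psi> by (simp add: algebra_simps)
    qed
  qed
  have "real (J n k h C) = exp (ln (real (J n k h C)))" using Jpos by simp
  also have "\<dots> \<le> exp (\<Psi> n + y * \<rho> * (2 * real n - G n))" using goal by simp
  finally show ?case by (simp add: C_def \<rho>_def G_def H_def)
qed

theorem theorem4:
  fixes k h s t :: nat and P D \<eta> C :: real
  assumes "t = k - h + 1"
    and "k \<ge> 60"
    and "0.9 * real k \<le> real h" and "h \<le> k - 2"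
    and "2 * t \<le> s" and "s \<le> (h div 2) * t"
    and "D \<ge> 10"
    and "P \<ge> exp (D * real k ^ 2)"
    and "2 / real k ^ 3 < \<eta>" and "\<eta> \<le> 1 / (2 * real k)"
    and "18 / real k \<le> 4 * ln (real k) / (D * real k ^ 2 * \<eta>)"
    and "4 * ln (real k) / (D * real k ^ 2 * \<eta>) \<le> 0.4"
    and "C = real s ^ 2 / real t
           + 10.5 * real t * (ln (real k)) ^ 2 / (D * real k * \<eta> ^ 2)
           - real s * ((1 / \<eta> + real h) * (1 - 1 / real h) powr (real s / real t) - real h)
               * ln (1 / (10 * \<eta>))"
  shows "real (J s k h (\<C> P (P powr \<eta>)))
       \<le> exp C * P powr (2 * real s - real t / 2 * (real h + real k)
             + real t * (real t - 1) / 2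
             + \<eta> * real s ^ 2 / (2 * real t)
             + real h * real t * exp (- (real s / (real h * real t))))"
proof -
  define L where "L = ln (real k)"
  \<comment> \<open>\<open>A / k\<close> is the quantity confined by the hypotheses to the interval
    from \<open>18 / k\<close> to 0.4. It eliminates \<open>D\<close>, because
    \<open>\<eta> * D * k^2 = 4 * k * L / A\<close>.\<close>
  define A where "A = 4 * L / (D * real k * \<eta>)"
  define R where "R = P powr \<eta>"
  have k: "real k \<ge> 60" using assms(2) by simp
  have L: "L \<ge> 4" using ln_ge_60_bounds(1)[OF k] by (simp add: L_def)
  have hk: "h + t = Suc k" "h + 2 \<le> k" using assms(1,2,4) by auto
  have h54: "real h \<ge> 54" using assms(3) k by simp
  have t: "t \<ge> 3" "real t \<le> 12 / 100 * real k"
  proof -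
    show "t \<ge> 3" using hk by linarith
    have "real h + real t = 1 + real k" using hk(1) by linarith
    then show "real t \<le> 12 / 100 * real k" using assms(3) k by simp
  qed
  have hkt: "real k = real h + real t - 1" using hk(1) by linarith
  have t0: "real t > 0" using t by simp
  have D0: "D > 0" using assms(7) by simp
  have \<eta>0: "\<eta> > 0"
  proof -
    have "0 < 2 / real k ^ 3" using k by simp
    then show ?thesis using assms(9) by linarith
  qed
  have Dk\<eta>: "D * real k * \<eta> > 0" using D0 k \<eta>0 by simp
  have \<lambda>: "4 * ln (real k) / (D * real k ^ 2 * \<eta>) = A / real k"
    using k D0 \<eta>0 by (simp add: A_def L_def power2_eq_square mult_ac)
  have A18: "A \<ge> 18" using assms(11) k unfolding \<lambda> by (simp add: divide_le_cancel)
  have A4: "A \<le> 2 / 5 * real k" using assms(12) k unfolding \<lambda> by (simp add: pos_divide_le_eq)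
  have lnP: "ln P \<ge> D * (real k)\<^sup>2" and P0: "P > 0"
  proof -
    show "P > 0" using assms(8) exp_gt_zero[of "D * real k ^ 2"] by linarith
    then show "ln P \<ge> D * (real k)\<^sup>2" using assms(8) by (simp add: ln_ge_iff)
  qed
  have lnR: "ln R = \<eta> * ln P" using P0 by (simp add: R_def ln_powr)
  have R0: "R > 0" using P0 by (simp add: R_def)
  have RD: "ln R \<ge> \<eta> * (D * (real k)\<^sup>2)" unfolding lnR using lnP \<eta>0 by (intro mult_left_mono) auto
  have A0: "A > 0" using A18 by simp
  have eqA: "\<eta> * (D * (real k)\<^sup>2) = 4 * real k * L / A"
    using Dk\<eta> A0 L k D0 \<eta>0 by (simp add: A_def power2_eq_square)
  have RA: "ln R \<ge> 4 * real k * L / A" using RD eqA by simp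
  \<comment> \<open>The upper bound 0.4 is used here: \<open>A <= 0.4 * k\<close> is equivalent to
    \<open>4 * k * L / A >= 10 * L\<close>.\<close>
  have R10: "ln R \<ge> 10 * L"
  proof -
    have "10 * L * A \<le> 10 * L * (2 / 5 * real k)" using A4 L by (intro mult_left_mono) auto
    then have "10 * L \<le> 4 * real k * L / A" using A0 by (simp add: pos_le_divide_eq mult_ac)
    then show ?thesis using RA by linarith
  qed
  have R10\<eta>: "ln R \<ge> 10 * \<eta> * (real k)\<^sup>2"
  proof -
    have "\<eta> * (10 * (real k)\<^sup>2) \<le> \<eta> * (D * (real k)\<^sup>2)"
      using assms(7) \<eta>0 by (intro mult_left_mono mult_right_mono) auto
    then show ?thesis using RD by (simp add: mult_ac)
  qed
  have \<eta>1: "real k \<le> 1 / (2 * \<eta>)" using assms(10) \<eta>0 k by (simp add: field_simps)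
  have \<eta>3: "1 / \<eta> \<le> real k ^ 3"
  proof -
    have "1 / \<eta> \<le> 1 / (2 / real k ^ 3)" using assms(9) k \<eta>0 by (intro divide_left_mono) auto
    also have "\<dots> = real k ^ 3 / 2" by simp
    also have "\<dots> \<le> real k ^ 3" by simp
    finally show ?thesis .
  qed
  have s: "real s \<le> real h * real t / 2"
  proof -
    have "2 * s \<le> 2 * (h div 2) * t" using assms(6) by simp
    also have "\<dots> \<le> h * t" by (intro mult_right_mono) auto
    finally have "2 * s \<le> h * t" .
    then have "real (2 * s) \<le> real (h * t)" by (rule of_nat_mono)
    then show ?thesis by simp
  qed
  have RP: "R powr (1 / \<eta>) = P" using P0 \<eta>0 by (simp add: R_def powr_powr)
  \<comment> \<open>The redundant \<open>real 0\<close> matches the instance \<open>len 0\<close> in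
    \<open>J_bound_induction\<close>.\<close>
  define len0 where "len0 = (1 / \<eta> + real h) * (1 - 1 / real h) powr ((real s - real 0) / real t) - real h"
  have le1: "(1 / \<eta> + real h) * (1 - 1 / real h) powr ((real s - real s) / real t) - real h \<le> 1 / \<eta>"
    using h54 by simp
  have "real (J s k h (smooth_set (R powr (1 / \<eta>)) R)) \<le> exp ((real s)\<^sup>2 / real t + ln R * ((real s)\<^sup>2 / (2 * real t))
      + 21 / 8 * A * real t * ln (real k) / \<eta> - real s * len0 * ln (1 / (10 * \<eta>))
      + 1 / \<eta> * ln R * (2 * real s - saving (real h * real t) (real s)))"
    unfolding len0_def
    by (rule J_bound_induction[OF _ _ hk(1) t s \<eta>0 \<eta>1 \<eta>3 A18 R0 _ _ R10\<eta> order_refl le1 order_refl])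
       (use assms(2,3) RA R10 in \<open>auto simp: L_def\<close>)
  also have "smooth_set (R powr (1 / \<eta>)) R = \<C> P (P powr \<eta>)" unfolding RP by (simp add: R_def)
  also have "(real s)\<^sup>2 / real t + ln R * ((real s)\<^sup>2 / (2 * real t))
      + 21 / 8 * A * real t * ln (real k) / \<eta> - real s * len0 * ln (1 / (10 * \<eta>))
      + 1 / \<eta> * ln R * (2 * real s - saving (real h * real t) (real s))
    = C + (2 * real s - real t / 2 * (real h + real k)
             + real t * (real t - 1) / 2
             + \<eta> * real s ^ 2 / (2 * real t)
             + real h * real t * exp (- (real s / (real h * real t)))) * ln P"
  proof -
    have 1: "21 / 8 * A * real t * ln (real k) / \<eta> = 10.5 * real t * (ln (real k)) ^ 2 / (D * real k * \<eta> ^ 2)"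
      by (simp add: A_def L_def power2_eq_square mult_ac)
    have 2: "1 / \<eta> * ln R = ln P" using \<eta>0 by (simp add: lnR)
    \<comment> \<open>Because \<open>h + k = 2 * h + t - 1\<close>, the polynomial terms of the
      stated exponent collapse to \<open>- h * t\<close>.\<close>
    have 3: "2 * real s - saving (real h * real t) (real s) = 2 * real s - real t / 2 * (real h + real k)
        + real t * (real t - 1) / 2 + real h * real t * exp (- (real s / (real h * real t)))"
      unfolding saving_def hkt by (simp add: field_simps)
    have 4: "C = (real s)\<^sup>2 / real t + 21 / 8 * A * real t * ln (real k) / \<eta> - real s * len0 * ln (1 / (10 * \<eta>))"
      unfolding 1 assms(13) len0_def by simp
    show ?thesis unfolding 2 3 4 lnR using \<eta>0 by (simp add: algebra_simps)
  qed
  also have "exp (C + (2 * real s - real t / 2 * (real h + real k)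
             + real t * (real t - 1) / 2
             + \<eta> * real s ^ 2 / (2 * real t)
             + real h * real t * exp (- (real s / (real h * real t)))) * ln P)
    = exp C * P powr (2 * real s - real t / 2 * (real h + real k)
             + real t * (real t - 1) / 2
             + \<eta> * real s ^ 2 / (2 * real t)
             + real h * real t * exp (- (real s / (real h * real t))))"
    using P0 by (simp add: exp_add powr_def)
  finally show ?thesis .
qed

end
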